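(* There is an incremental interval coloring algorithm (an implementation of Algorithm KT-SLS) which, on a sequence of $n$ interval insertions, maintains after each insertion a proper coloring of the inserted intervals using at most $3\omega - 2$ colors, and supports insertion of an interval in amortized $O(\log n + \Delta)$ time per update, where $\Delta$ is the maximum degree of a vertex in the interval graph formed by the $n$ intervals.
   Context: Incremental interval coloring: closed intervals arrive one at a time; after each arrival the algorithm must maintain a proper coloring (intersecting intervals receive distinct colors) of all intervals inserted so far. $\omega$ denotes the size of a maximum clique in the interval graph of the intervals (two intervals adjacent iff they intersect). Algorithm KT-SLS: when $I_i$ arrives, for real $t$ let $h_t$ be the smallest nonnegative integer that is not the level $L(I)$ of any earlier interval $I$ containing $t$; set $L(I_i)=\max_{t\in I_i} h_t$, and let the offset $o(I_i)$ be the smallest value in $\{1,2,3\}$ different from the offsets of the neighbors of $I_i$ having level $L(I_i)$; the color is $(L(I_i),o(I_i))$. *)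

theory Defs
  imports Complex_Main "HOL-Library.Ramsey"
begin

section \<open>Interval graphs\<close>

text \<open>
  A pair \<open>(a, b)\<close> with \<open>a \<le> b\<close> stands for the closed interval \<open>{a..b}\<close>.  Intervals may be
  inserted repeatedly, so the vertices of the interval graph are positions in the insertion
  sequence.
\<close>

type_synonym interval = "real \<times> real"

definition is_interval_pair :: "interval \<Rightarrow> bool" where
  "is_interval_pair I \<longleftrightarrow> fst I \<le> snd I"

definition points :: "interval \<Rightarrow> real set" where
  "points I = {fst I..snd I}"

definition intersects :: "interval \<Rightarrow> interval \<Rightarrow> bool" where
  "intersects I J \<longleftrightarrow> points I \<inter> points J \<noteq> {}"

definition ivl_vertices :: "interval list \<Rightarrow> nat set" where
  "ivl_vertices Is = {..<length Is}"

definition ivl_edges :: "interval list \<Rightarrow> nat set set" where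
  "ivl_edges Is =
    {{i, j} | i j. i \<in> ivl_vertices Is \<and> j \<in> ivl_vertices Is \<and> i \<noteq> j \<and>
       intersects (Is ! i) (Is ! j)}"

definition clique_number :: "interval list \<Rightarrow> nat" where
  "clique_number Is = Max {card K | K. K \<subseteq> ivl_vertices Is \<and> clique K (ivl_edges Is)}"

definition degree :: "interval list \<Rightarrow> nat \<Rightarrow> nat" where
  "degree Is i = card {j. {i, j} \<in> ivl_edges Is}"

definition max_degree :: "interval list \<Rightarrow> nat" where
  "max_degree Is = Max (degree Is ` ivl_vertices Is)"

definition proper_coloring :: "interval list \<Rightarrow> (nat \<Rightarrow> 'c) \<Rightarrow> bool" where
  "proper_coloring Is col \<longleftrightarrow> (\<forall>i j. {i, j} \<in> ivl_edges Is \<longrightarrow> col i \<noteq> col j)"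

section \<open>Algorithm KT-SLS\<close>

text \<open>
  A configuration lists the intervals inserted so far, in order of arrival, each with its
  color, that is, its (level, offset) pair.
\<close>

type_synonym color = "nat \<times> nat"
type_synonym config = "(interval \<times> color) list"

definition height :: "config \<Rightarrow> real \<Rightarrow> nat" where
  "height cs t = (LEAST h. \<forall>(J, l, q) \<in> set cs. t \<in> points J \<longrightarrow> l \<noteq> h)"

definition new_level :: "config \<Rightarrow> interval \<Rightarrow> nat" where
  "new_level cs I = Max (height cs ` points I)"

definition new_offset :: "config \<Rightarrow> interval \<Rightarrow> nat" where
  "new_offset cs I =
    (LEAST k. k \<in> {1, 2, 3} \<and>
       (\<forall>(J, l, q) \<in> set cs. intersects I J \<and> l = new_level cs I \<longrightarrow> q \<noteq> k))"

definition kt_sls_step :: "config \<Rightarrow> interval \<Rightarrow> config" where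
  "kt_sls_step cs I = cs @ [(I, new_level cs I, new_offset cs I)]"

definition kt_sls :: "interval list \<Rightarrow> color list" where
  "kt_sls Is = map snd (foldl kt_sls_step [] Is)"

section \<open>The machine model\<close>

text \<open>
  Programs run on a random access machine with registers and arrays of words (natural
  numbers) and registers and arrays of reals.  Reals can only be copied and compared.
  Words can only be copied, compared, incremented and decremented; so in \<open>t\<close> steps a program
  produces no word larger than \<open>O(t)\<close>, and charging unit cost per operation is legitimate for
  words of logarithmic length.
\<close>

type_synonym vname = string

record state =
  wvar :: "vname \<Rightarrow> nat"
  rvar :: "vname \<Rightarrow> real"
  warr :: "vname \<Rightarrow> nat \<Rightarrow> nat"
  rarr :: "vname \<Rightarrow> nat \<Rightarrow> real"

datatype wexp = WConst nat | WVar vname | WArr vname wexp | WSucc wexp | WPred wexp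

datatype rexp = RVar vname | RArr vname wexp

datatype bexp =
    WLess wexp wexp | WEq wexp wexp | RLess rexp rexp | Not bexp | And bexp bexp

datatype com =
    Skip
  | WAssign vname wexp
  | WStore vname wexp wexp
  | RAssign vname rexp
  | RStore vname wexp rexp
  | Seq com com
  | If bexp com com
  | While bexp com

fun wval :: "wexp \<Rightarrow> state \<Rightarrow> nat" where
  "wval (WConst k) s = k"
| "wval (WVar x) s = wvar s x"
| "wval (WArr a e) s = warr s a (wval e s)"
| "wval (WSucc e) s = wval e s + 1"
| "wval (WPred e) s = wval e s - 1"

fun rval :: "rexp \<Rightarrow> state \<Rightarrow> real" where
  "rval (RVar x) s = rvar s x"
| "rval (RArr a e) s = rarr s a (wval e s)"

fun bval :: "bexp \<Rightarrow> state \<Rightarrow> bool" where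
  "bval (WLess d e) s \<longleftrightarrow> wval d s < wval e s"
| "bval (WEq d e) s \<longleftrightarrow> wval d s = wval e s"
| "bval (RLess d e) s \<longleftrightarrow> rval d s < rval e s"
| "bval (Not b) s \<longleftrightarrow> \<not> bval b s"
| "bval (And b c) s \<longleftrightarrow> bval b s \<and> bval c s"

text \<open>The number of operations needed to evaluate an expression.\<close>

fun wcost :: "wexp \<Rightarrow> nat" where
  "wcost (WConst k) = 1"
| "wcost (WVar x) = 1"
| "wcost (WArr a e) = wcost e + 1"
| "wcost (WSucc e) = wcost e + 1"
| "wcost (WPred e) = wcost e + 1"

fun rcost :: "rexp \<Rightarrow> nat" where
  "rcost (RVar x) = 1"
| "rcost (RArr a e) = wcost e + 1"

fun bcost :: "bexp \<Rightarrow> nat" where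
  "bcost (WLess d e) = wcost d + wcost e + 1"
| "bcost (WEq d e) = wcost d + wcost e + 1"
| "bcost (RLess d e) = rcost d + rcost e + 1"
| "bcost (Not b) = bcost b + 1"
| "bcost (And b c) = bcost b + bcost c + 1"

text \<open>\<open>exec c s n s'\<close>: started in \<open>s\<close>, program \<open>c\<close> terminates in \<open>s'\<close> after \<open>n\<close> operations.\<close>

inductive exec :: "com \<Rightarrow> state \<Rightarrow> nat \<Rightarrow> state \<Rightarrow> bool" where
  Skip: "exec Skip s 1 s"
| WAssign: "exec (WAssign x e) s (wcost e + 1) (s\<lparr>wvar := (wvar s)(x := wval e s)\<rparr>)"
| WStore: "exec (WStore a d e) s (wcost d + wcost e + 1)
    (s\<lparr>warr := (warr s)(a := (warr s a)(wval d s := wval e s))\<rparr>)"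
| RAssign: "exec (RAssign x e) s (rcost e + 1) (s\<lparr>rvar := (rvar s)(x := rval e s)\<rparr>)"
| RStore: "exec (RStore a d e) s (wcost d + rcost e + 1)
    (s\<lparr>rarr := (rarr s)(a := (rarr s a)(wval d s := rval e s))\<rparr>)"
| Seq: "exec c1 s m s' \<Longrightarrow> exec c2 s' n s'' \<Longrightarrow> exec (Seq c1 c2) s (m + n) s''"
| IfTrue: "bval b s \<Longrightarrow> exec c1 s n s' \<Longrightarrow> exec (If b c1 c2) s (bcost b + n) s'"
| IfFalse: "\<not> bval b s \<Longrightarrow> exec c2 s n s' \<Longrightarrow> exec (If b c1 c2) s (bcost b + n) s'"
| WhileFalse: "\<not> bval b s \<Longrightarrow> exec (While b c) s (bcost b) s"
| WhileTrue: "bval b s \<Longrightarrow> exec c s m s' \<Longrightarrow> exec (While b c) s' n s'' \<Longrightarrow>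
    exec (While b c) s (bcost b + m + n) s''"

inductive_cases exec_SkipE: "exec Skip s n s'"
inductive_cases exec_WAssignE: "exec (WAssign x e) s n s'"
inductive_cases exec_WStoreE: "exec (WStore a d e) s n s'"
inductive_cases exec_RAssignE: "exec (RAssign x e) s n s'"
inductive_cases exec_RStoreE: "exec (RStore a d e) s n s'"
inductive_cases exec_SeqE: "exec (Seq c1 c2) s n s'"
inductive_cases exec_IfE: "exec (If b c1 c2) s n s'"
inductive_cases exec_WhileE: "exec (While b c) s n s'"

lemma exec_deterministic:
  "exec c s m s' \<Longrightarrow> exec c s n s'' \<Longrightarrow> n = m \<and> s'' = s'"
proof (induction arbitrary: n s'' rule: exec.induct)
  case Skip then show ?case by (auto elim: exec_SkipE)
next
  case WAssign then show ?case by (auto elim: exec_WAssignE)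
next
  case WStore then show ?case by (auto elim: exec_WStoreE)
next
  case RAssign then show ?case by (auto elim: exec_RAssignE)
next
  case RStore then show ?case by (auto elim: exec_RStoreE)
next
  case Seq from Seq.prems show ?case by (rule exec_SeqE) (use Seq.IH in blast)
next
  case IfTrue
  from IfTrue.prems show ?case by (rule exec_IfE) (use IfTrue.hyps IfTrue.IH in blast)+
next
  case IfFalse
  from IfFalse.prems show ?case by (rule exec_IfE) (use IfFalse.hyps IfFalse.IH in blast)+
next
  case WhileFalse
  from WhileFalse.prems show ?case by (rule exec_WhileE) (use WhileFalse.hyps in blast)+
next
  case WhileTrue
  from WhileTrue.prems show ?case by (rule exec_WhileE) (use WhileTrue.hyps WhileTrue.IH in blast)+
qed

section \<open>Incremental algorithms\<close>

text \<open>
  An incremental algorithm is a program that is run once per arriving interval.  The endpoints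
  of the interval are placed in the real registers \<open>lo\<close> and \<open>hi\<close>; everything else persists
  between insertions.  The color of the \<open>j\<close>-th interval (counting from 0) has to be available
  in the word arrays \<open>level\<close> and \<open>offset\<close> at index \<open>j\<close>.
\<close>

definition initial_state :: state where
  "initial_state =
    \<lparr>wvar = (\<lambda>_. 0), rvar = (\<lambda>_. 0), warr = (\<lambda>_ _. 0), rarr = (\<lambda>_ _. 0)\<rparr>"

definition with_input :: "interval \<Rightarrow> state \<Rightarrow> state" where
  "with_input I s = s\<lparr>rvar := (rvar s)(''lo'' := fst I, ''hi'' := snd I)\<rparr>"

definition current_color :: "state \<Rightarrow> nat \<Rightarrow> color" where
  "current_color s j = (warr s ''level'' j, warr s ''offset'' j)"

text \<open>
  \<open>s i\<close> is the state after the first \<open>i\<close> insertions, and \<open>T i\<close> the time taken by the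
  insertion of interval \<open>i\<close>.
\<close>

definition run_insertions ::
    "com \<Rightarrow> interval list \<Rightarrow> (nat \<Rightarrow> state) \<Rightarrow> (nat \<Rightarrow> nat) \<Rightarrow> bool" where
  "run_insertions P Is s T \<longleftrightarrow>
    s 0 = initial_state \<and>
    (\<forall>i < length Is. exec P (with_input (Is ! i) (s i)) (T i) (s (Suc i)))"

end

theory Submission
  imports Defs
begin

text \<open>
  All endpoints are kept sorted, as the leaves of a 2-3-4 tree and in a doubly linked list, with left
  endpoints first among equal coordinates.  After inserting the endpoints of \<open>I\<close>, sweeping the
  list between them meets every neighbor of \<open>I\<close> except those containing its left endpoint.  If
  \<open>J\<close> is one of those, all endpoints listed between the left endpoints of \<open>J\<close> and \<open>I\<close> belong to
  \<open>J\<close> or its neighbors; so walking back over twice the maximal degree plus two endpoints finds all of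
  them.  During the sweep a candidate level \<open>M\<close>, which only grows, and the number of levels up to
  \<open>M\<close> missing at the current point suffice to compute the maximal height.

  For the number of colors: when \<open>I\<close> gets level \<open>l\<close>, some point of \<open>I\<close> is covered by all lower
  levels, and no other interval of level \<open>l\<close>, earlier or later, contains it.  Hence an interval meets
  at most two others of its level, and level \<open>l\<close> forces a clique of size \<open>l + 1\<close>.
\<close>

section \<open>Cost and frame reasoning for programs\<close>

text \<open>The machine shapes the construction: words can only be incremented and decremented, so
  indices cannot be halved and keys cannot be hashed, and logarithmic time has to come from pointers
  alone.

  The bound on the walk is known to the program because an insertion lists all neighbors anyway:
  their degrees are updated on the spot, and the maximum \<open>W\<close> never decreases. The list
  of neighbors also pays for everything else outside the tree. The stretch swept holds at most two
  endpoints per neighbor. The level is at most the number of neighbors, since each lower level is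
  occupied by a different one, so raising \<open>M\<close> one by one is affordable. Only levels of
  neighbors can have nonzero counters, so these are cleared without scanning all levels.

  Correctness of \<open>M\<close> has two sides. It never exceeds the true level, because the
  intervals counted whenever it is raised share a point of the new interval. It is not too small,
  because every point of the new interval corresponds to a position of the sweep at which some level
  up to \<open>M\<close> was free, and \<open>M\<close> only grows. The time bound holds for each
  insertion separately.\<close>

fun loop_free :: "com \<Rightarrow> bool" where
  "loop_free (Seq c d) = (loop_free c \<and> loop_free d)"
| "loop_free (If b c d) = (loop_free c \<and> loop_free d)"
| "loop_free (While b c) = False"
| "loop_free c = True"

fun effect :: "com \<Rightarrow> state \<Rightarrow> state" where
  "effect Skip s = s"
| "effect (WAssign x e) s = s\<lparr>wvar := (wvar s)(x := wval e s)\<rparr>"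
| "effect (WStore a d e) s = s\<lparr>warr := (warr s)(a := (warr s a)(wval d s := wval e s))\<rparr>"
| "effect (RAssign x e) s = s\<lparr>rvar := (rvar s)(x := rval e s)\<rparr>"
| "effect (RStore a d e) s = s\<lparr>rarr := (rarr s)(a := (rarr s a)(wval d s := rval e s))\<rparr>"
| "effect (Seq c d) s = effect d (effect c s)"
| "effect (If b c d) s = (if bval b s then effect c s else effect d s)"
| "effect (While b c) s = s"

text \<open>Adding both branches of a conditional is crude but keeps the bound a closed numeral that
  \<open>simp\<close> can compute.\<close>

fun max_cost :: "com \<Rightarrow> nat" where
  "max_cost Skip = 1"
| "max_cost (WAssign x e) = wcost e + 1"
| "max_cost (WStore a d e) = wcost d + wcost e + 1"
| "max_cost (RAssign x e) = rcost e + 1"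
| "max_cost (RStore a d e) = wcost d + rcost e + 1"
| "max_cost (Seq c d) = max_cost c + max_cost d"
| "max_cost (If b c d) = bcost b + max_cost c + max_cost d"
| "max_cost (While b c) = bcost b"

text \<open>Total correctness with the exact cost as an argument of the postcondition. Sequencing
  thus becomes nesting: the cost already spent is added inside the postcondition of what follows, as
  in \<open>runs_Seq\<close>.\<close>

definition runs :: "com \<Rightarrow> state \<Rightarrow> (nat \<Rightarrow> state \<Rightarrow> bool) \<Rightarrow> bool" where
  "runs c s Q \<longleftrightarrow> (\<exists>n s'. exec c s n s' \<and> Q n s')"

text \<open>The weakening step also receives the execution, so that frame facts about intermediate
  states can be extracted with \<open>exec_unchanged\<close> after a postcondition has been
  established.\<close>

lemma runs_mono: "runs c s Q \<Longrightarrow> (\<And>n s'. exec c s n s' \<Longrightarrow> Q n s' \<Longrightarrow> R n s') \<Longrightarrow> runs c s R"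
  unfolding runs_def by blast

lemma exec_loop_free:
  "loop_free c \<Longrightarrow> \<exists>n \<le> max_cost c. exec c s n (effect c s)"
proof (induction c arbitrary: s)
  case (Seq c d)
  obtain m where m: "m \<le> max_cost c" "exec c s m (effect c s)" using Seq by auto
  obtain n where n: "n \<le> max_cost d" "exec d (effect c s) n (effect d (effect c s))"
    using Seq by fastforce
  from exec.Seq[OF m(2) n(2)] m n show ?case by (auto intro!: exI[of _ "m + n"])
next
  case (If b c d)
  show ?case
  proof (cases "bval b s")
    case True
    obtain m where m: "m \<le> max_cost c" "exec c s m (effect c s)" using If by auto
    from exec.IfTrue[OF True m(2)] m True show ?thesis by (auto intro!: exI[of _ "bcost b + m"])
  next
    case False
    obtain m where m: "m \<le> max_cost d" "exec d s m (effect d s)" using If by fastforce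
    from exec.IfFalse[OF False m(2)] m False show ?thesis by (auto intro!: exI[of _ "bcost b + m"])
  qed
qed (simp_all only: effect.simps max_cost.simps loop_free.simps, (blast intro: exec.intros order_refl)+)

lemma runs_loop_free:
  assumes "loop_free c" "\<And>n. n \<le> max_cost c \<Longrightarrow> Q n (effect c s)"
  shows "runs c s Q"
  using exec_loop_free[OF assms(1), of s] assms(2) unfolding runs_def by blast

lemma runs_Seq:
  "runs c s (\<lambda>n s'. runs d s' (\<lambda>m. Q (n + m))) \<Longrightarrow> runs (Seq c d) s Q"
  unfolding runs_def using exec.Seq by blast

lemma runs_If_loop_free_cond:
  assumes "bval b s \<Longrightarrow> runs c s (\<lambda>n. Q (bcost b + n))"
    and "\<not> bval b s \<Longrightarrow> runs d s (\<lambda>n. Q (bcost b + n))"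
  shows "runs (If b c d) s Q"
  using assms exec.IfTrue exec.IfFalse unfolding runs_def by (cases "bval b s") blast+

lemma runs_While_False: "\<not> bval b s \<Longrightarrow> Q (bcost b) s \<Longrightarrow> runs (While b c) s Q"
  unfolding runs_def using exec.WhileFalse by blast

lemma runs_While_True:
  "bval b s \<Longrightarrow> runs c s (\<lambda>n s'. runs (While b c) s' (\<lambda>m. Q (bcost b + n + m))) \<Longrightarrow>
   runs (While b c) s Q"
  unfolding runs_def using exec.WhileTrue by blast

fun wvars :: "com \<Rightarrow> vname set" where
  "wvars (WAssign x e) = {x}"
| "wvars (Seq c d) = wvars c \<union> wvars d"
| "wvars (If b c d) = wvars c \<union> wvars d"
| "wvars (While b c) = wvars c"
| "wvars c = {}"

fun warrs :: "com \<Rightarrow> vname set" where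
  "warrs (WStore x d e) = {x}"
| "warrs (Seq c d) = warrs c \<union> warrs d"
| "warrs (If b c d) = warrs c \<union> warrs d"
| "warrs (While b c) = warrs c"
| "warrs c = {}"

fun rvars :: "com \<Rightarrow> vname set" where
  "rvars (RAssign x e) = {x}"
| "rvars (Seq c d) = rvars c \<union> rvars d"
| "rvars (If b c d) = rvars c \<union> rvars d"
| "rvars (While b c) = rvars c"
| "rvars c = {}"

fun rarrs :: "com \<Rightarrow> vname set" where
  "rarrs (RStore x d e) = {x}"
| "rarrs (Seq c d) = rarrs c \<union> rarrs d"
| "rarrs (If b c d) = rarrs c \<union> rarrs d"
| "rarrs (While b c) = rarrs c"
| "rarrs c = {}"

text \<open>A purely syntactic frame that treats an array as a whole. For arrays written at some
  addresses only, such as those of the search tree, \<open>tree_frame\<close> gives the finer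
  statement.\<close>

definition unchanged :: "com \<Rightarrow> state \<Rightarrow> state \<Rightarrow> bool" where
  "unchanged c s s' \<longleftrightarrow>
    (\<forall>v. v \<notin> wvars c \<longrightarrow> wvar s' v = wvar s v) \<and>
    (\<forall>v. v \<notin> rvars c \<longrightarrow> rvar s' v = rvar s v) \<and>
    (\<forall>v. v \<notin> warrs c \<longrightarrow> warr s' v = warr s v) \<and>
    (\<forall>v. v \<notin> rarrs c \<longrightarrow> rarr s' v = rarr s v)"

lemma exec_unchanged: "exec c s n s' \<Longrightarrow> unchanged c s s'"
  by (induction rule: exec.induct) (auto simp: unchanged_def)

lemma unchangedD:
  assumes "unchanged c s s'"
  shows "v \<notin> wvars c \<Longrightarrow> wvar s' v = wvar s v" "v \<notin> rvars c \<Longrightarrow> rvar s' v = rvar s v"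
    "v \<notin> warrs c \<Longrightarrow> warr s' v = warr s v" "v \<notin> rarrs c \<Longrightarrow> rarr s' v = rarr s v"
  using assms unfolding unchanged_def by auto

lemma unchanged_refl: "unchanged c s s"
  by (simp add: unchanged_def)

lemma unchanged_trans: "unchanged c s s' \<Longrightarrow> unchanged c s' s'' \<Longrightarrow> unchanged c s s''"
  by (simp add: unchanged_def)

text \<open>The potential \<open>\<psi>\<close> amortizes the cost of loops nested in the body.\<close>

lemma runs_While_list:
  fixes \<psi> :: "state \<Rightarrow> nat"
  assumes step: "\<And>pre e post s. xs = pre @ e # post \<Longrightarrow> I pre (e # post) s \<Longrightarrow>
      unchanged c s0 s \<Longrightarrow> bval b s \<and> runs c s (\<lambda>n s'. I (pre @ [e]) post s' \<and> n + \<psi> s' \<le> \<psi> s + K)"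
    and final: "\<And>s. I xs [] s \<Longrightarrow> unchanged c s0 s \<Longrightarrow> \<not> bval b s"
    and init: "I [] xs s0"
  shows "runs (While b c) s0
    (\<lambda>n s'. I xs [] s' \<and> n + \<psi> s' \<le> \<psi> s0 + (K + bcost b) * length xs + bcost b)"
proof -
  \<comment> \<open>Generalized over the split into processed and remaining elements. Potential
    differences telescope over the iterations.\<close>
  have "runs (While b c) s
      (\<lambda>n s'. I xs [] s' \<and> n + \<psi> s' \<le> \<psi> s + (K + bcost b) * length post + bcost b)"
    if "xs = pre @ post" "I pre post s" "unchanged c s0 s" for pre post s
    using that
  proof (induction post arbitrary: pre s)
    case Nil
    then show ?case using final by (auto intro: runs_While_False)
  next
    case (Cons e post)
    have b: "bval b s" and r: "runs c s (\<lambda>n s'. I (pre @ [e]) post s' \<and> n + \<psi> s' \<le> \<psi> s + K)"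
      using step[OF Cons.prems] by auto
    show ?case
    proof (rule runs_While_True[OF b], rule runs_mono[OF r])
      fix n s' assume ex: "exec c s n s'" and "I (pre @ [e]) post s' \<and> n + \<psi> s' \<le> \<psi> s + K"
      then have i: "I (pre @ [e]) post s'" and n: "n + \<psi> s' \<le> \<psi> s + K" by auto
      have "runs (While b c) s' (\<lambda>m s''. I xs [] s'' \<and>
          m + \<psi> s'' \<le> \<psi> s' + (K + bcost b) * length post + bcost b)"
        using Cons.IH[of "pre @ [e]" s'] Cons.prems(1) i
          unchanged_trans[OF Cons.prems(3) exec_unchanged[OF ex]] by simp
      then show "runs (While b c) s' (\<lambda>m s''. I xs [] s'' \<and>
          bcost b + n + m + \<psi> s'' \<le> \<psi> s + (K + bcost b) * length (e # post) + bcost b)"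
        by (rule runs_mono) (use n in \<open>auto simp: algebra_simps\<close>)
    qed
  qed
  from this[of "[]" xs s0] init unchanged_refl show ?thesis by simp
qed

section \<open>The search tree\<close>

text \<open>A linked list segment with next pointer \<open>f\<close>; \<open>e\<close> is the
  successor of the last cell, for instance 0 at the end of a child list or an inner address for a
  stretch of a longer list.\<close>

fun chain :: "(nat \<Rightarrow> nat) \<Rightarrow> nat list \<Rightarrow> nat \<Rightarrow> bool" where
  "chain f [] e = True"
| "chain f (a # as) e = (f a = hd (as @ [e]) \<and> chain f as e)"

lemma chain_append: "chain f (as @ bs) e \<longleftrightarrow> chain f as (hd (bs @ [e])) \<and> chain f bs e"
  by (induction as) (auto simp: hd_append)

lemma chain_cong: "(\<And>a. a \<in> set as \<Longrightarrow> f a = g a) \<Longrightarrow> chain f as e = chain g as e"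
  by (induction as) auto

text \<open>Splicing in \<open>z\<close> behind \<open>y\<close>. The new pointer function is
  constrained only on the cells of the list, so the lemma covers updates that change further
  entries, such as cutting the child list of a split node.\<close>

lemma chain_insert:
  assumes "chain f (as @ y # bs) e" "distinct (as @ y # bs)" "z \<notin> set (as @ y # bs)"
    and "g y = z" "g z = f y" "\<And>a. a \<in> set as \<union> set bs \<Longrightarrow> g a = f a"
  shows "chain g (as @ y # z # bs) e"
proof -
  have "chain g as y" "chain g bs e"
    using assms(1,6) chain_cong[of as g f y] chain_cong[of bs g f e] by (auto simp: chain_append)
  then show ?thesis using assms by (auto simp: chain_append)
qed

text \<open>Ghost trees: a node carries its address only, while keys and pointers stay in the state
  and are tied to the tree by \<open>represents\<close>.\<close>

datatype tree = Node (root: nat) (kids: "tree list")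

fun nodes :: "tree \<Rightarrow> nat list" where
  "nodes (Node a ts) = a # concat (map nodes ts)"

fun leaves :: "tree \<Rightarrow> nat list" where
  "leaves (Node a ts) = (if ts = [] then [a] else concat (map leaves ts))"

text \<open>The 2-3-4 condition with all leaves at depth \<open>h\<close>, meant for the nodes below
  the root. The root is treated separately in \<open>index\<close>, as it may have a single
  child.\<close>

fun balanced :: "nat \<Rightarrow> tree \<Rightarrow> bool" where
  "balanced 0 (Node a ts) = (ts = [])"
| "balanced (Suc h) (Node a ts) = (2 \<le> length ts \<and> length ts \<le> 4 \<and> (\<forall>t \<in> set ts. balanced h t))"

text \<open>
  First child, next sibling representation.  The key of an inner node is that of its first
  leaf; for a first child it is irrelevant, as the search never reads it.
\<close>

fun represents :: "state \<Rightarrow> tree \<Rightarrow> bool" where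
  "represents s (Node a ts) \<longleftrightarrow>
    warr s ''dn'' a = hd (map root ts @ [0]) \<and>
    warr s ''ct'' a = length ts \<and>
    chain (warr s ''nx'') (map root ts) 0 \<and>
    (\<forall>t \<in> set (tl ts). rarr s ''ky'' (root t) = rarr s ''ky'' (hd (leaves t))) \<and>
    (\<forall>t \<in> set ts. represents s t)"

lemma leaves_nonempty [simp]: "leaves t \<noteq> []"
proof (induction t)
  case (Node a ts)
  then show ?case by (cases ts) auto
qed

lemma root_in_nodes [simp]: "root t \<in> set (nodes t)"
  by (cases t) auto

lemma leaves_subset_nodes: "set (leaves t) \<subseteq> set (nodes t)"
  by (induction t) auto

lemma hd_leaves_in_nodes [simp]: "hd (leaves t) \<in> set (nodes t)"
  using leaves_subset_nodes[of t] hd_in_set[OF leaves_nonempty] by blast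

text \<open>Every inner node has at least two children of smaller height. Read backwards this is the
  logarithmic bound on the height.\<close>

lemma length_leaves: "balanced h t \<Longrightarrow> 2 ^ h \<le> length (leaves t)"
proof (induction h t rule: balanced.induct)
  case (2 h a ts)
  then obtain t1 t2 us where ts: "ts = t1 # t2 # us"
    by (cases ts; cases "tl ts") auto
  have "2 ^ h \<le> length (leaves t1)" "2 ^ h \<le> length (leaves t2)" using 2 ts by auto
  then show ?case using ts by simp
qed auto

text \<open>The sibling pointer of the root belongs to the child list of its parent. Hence
  \<open>nx\<close> has to agree on proper descendants only.\<close>

lemma represents_cong:
  assumes "\<And>a. a \<in> set (nodes t) \<Longrightarrow> warr s' ''dn'' a = warr s ''dn'' a"
    and "\<And>a. a \<in> set (nodes t) \<Longrightarrow> warr s' ''ct'' a = warr s ''ct'' a"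
    and "\<And>a. a \<in> set (nodes t) \<Longrightarrow> rarr s' ''ky'' a = rarr s ''ky'' a"
    and "\<And>c a. c \<in> set (kids t) \<Longrightarrow> a \<in> set (nodes c) \<Longrightarrow> warr s' ''nx'' a = warr s ''nx'' a"
  shows "represents s t \<Longrightarrow> represents s' t"
  using assms
proof (induction t)
  case (Node a ts)
  have nx: "chain (warr s' ''nx'') (map root ts) 0 = chain (warr s ''nx'') (map root ts) 0"
    by (rule chain_cong) (use Node.prems(5) in auto)
  have "represents s' t" if "t \<in> set ts" for t
  proof (rule Node.IH[OF that])
    show "represents s t" using Node.prems(1) that by simp
    show "warr s' ''nx'' a = warr s ''nx'' a" if "c \<in> set (kids t)" "a \<in> set (nodes c)" for c a
      using Node.prems(5)[of t] \<open>t \<in> set ts\<close> that by (cases t) auto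
  qed (use Node.prems(2-4) that in auto)
  moreover have "rarr s' ''ky'' (root t) = rarr s' ''ky'' (hd (leaves t))" if "t \<in> set (tl ts)" for t
  proof -
    from that have "t \<in> set ts" by (cases ts) auto
    then have "rarr s' ''ky'' (root t) = rarr s ''ky'' (root t)"
      "rarr s' ''ky'' (hd (leaves t)) = rarr s ''ky'' (hd (leaves t))"
      using Node.prems(4) root_in_nodes[of t] hd_leaves_in_nodes[of t]
      by (auto simp del: root_in_nodes hd_leaves_in_nodes)
    then show ?thesis using Node.prems(1) that by simp
  qed
  ultimately show ?case using Node.prems nx by simp
qed

section \<open>Programs for top-down insertion\<close>

definition link :: com where
  "link = Seq (WAssign ''z'' (WVar ''fr'')) (Seq (WAssign ''fr'' (WSucc (WVar ''fr'')))
    (Seq (WStore ''nx'' (WVar ''z'') (WArr ''nx'' (WVar ''y'')))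
    (Seq (WStore ''nx'' (WVar ''y'') (WVar ''z''))
     (WStore ''ct'' (WVar ''x'') (WSucc (WArr ''ct'' (WVar ''x'')))))))"

text \<open>The first child is taken without a test, which is why its key may be arbitrary. Address
  0 ends a child list.\<close>

definition scan :: "(wexp \<Rightarrow> bexp) \<Rightarrow> com" where
  "scan tst = Seq (WAssign ''y'' (WArr ''dn'' (WVar ''x'')))
    (While (And (Not (WEq (WArr ''nx'' (WVar ''y'')) (WConst 0))) (tst (WArr ''nx'' (WVar ''y''))))
      (WAssign ''y'' (WArr ''nx'' (WVar ''y''))))"

text \<open>
  A full child is split before the search descends into it, so splits never propagate upwards and
  the parents need not be remembered.
\<close>

definition split_body :: "(wexp \<Rightarrow> bexp) \<Rightarrow> com" where
  "split_body tst = Seq link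
    (Seq (WAssign ''d'' (WArr ''nx'' (WArr ''dn'' (WVar ''y''))))
    (Seq (WStore ''dn'' (WVar ''z'') (WArr ''nx'' (WVar ''d'')))
    (Seq (WStore ''nx'' (WVar ''d'') (WConst 0))
    (Seq (WStore ''ct'' (WVar ''z'') (WConst 2))
    (Seq (WStore ''ct'' (WVar ''y'') (WConst 2))
    (Seq (RStore ''ky'' (WVar ''z'') (RArr ''ky'' (WArr ''dn'' (WVar ''z''))))
     (If (tst (WVar ''z'')) (WAssign ''y'' (WVar ''z'')) Skip)))))))"

definition split :: "(wexp \<Rightarrow> bexp) \<Rightarrow> com" where
  "split tst = If (WEq (WArr ''ct'' (WVar ''y'')) (WConst 4)) (split_body tst) Skip"

definition add_leaf :: "rexp \<Rightarrow> com" where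
  "add_leaf key = Seq link (Seq (WStore ''dn'' (WVar ''z'') (WConst 0))
    (Seq (WStore ''ct'' (WVar ''z'') (WConst 0)) (RStore ''ky'' (WVar ''z'') key)))"

text \<open>Leaves have \<open>dn\<close> 0, so the loop stops at a parent of leaves. Along the way
  \<open>x\<close> has at most three children, which leaves room for the sibling created by a
  split.\<close>

definition descend :: "(wexp \<Rightarrow> bexp) \<Rightarrow> com" where
  "descend tst = While (Not (WEq (WArr ''dn'' (WArr ''dn'' (WVar ''x''))) (WConst 0)))
    (Seq (scan tst) (Seq (split tst) (WAssign ''x'' (WVar ''y''))))"

text \<open>Covers both searches, by left and by right endpoint. The predicate sees only the stored
  key; the endpoint searched for is fixed through the real registers \<open>rv\<close>. The constant
  4 is what the negated comparison costs beyond evaluating the address.\<close>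

definition is_test :: "(wexp \<Rightarrow> bexp) \<Rightarrow> (real \<Rightarrow> bool) \<Rightarrow> (vname \<Rightarrow> real) \<Rightarrow> bool" where
  "is_test tst P rv \<longleftrightarrow>
    (\<forall>e s. rvar s = rv \<longrightarrow> bval (tst e) s = P (rarr s ''ky'' (wval e s))) \<and>
    (\<forall>e. bcost (tst e) \<le> wcost e + 4)"

lemma is_testD:
  assumes "is_test tst P (rvar s)"
  shows "bval (tst e) s = P (rarr s ''ky'' (wval e s))" "bcost (tst e) \<le> wcost e + 4"
  using assms unfolding is_test_def by auto

text \<open>Only the keys on both sides of the stopping point are recorded, since that is what
  \<open>split_position\<close> uses to place the threshold.\<close>

lemma runs_scan_loop:
  assumes tst: "is_test tst P (rvar s)"
    and "chain (warr s ''nx'') (map root ts) 0" "0 \<notin> set (map root ts)"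
    and "ts = as @ c # bs" "wvar s ''y'' = root c" "as \<noteq> [] \<longrightarrow> P (rarr s ''ky'' (root c))"
  shows "runs (While (And (Not (WEq (WArr ''nx'' (WVar ''y'')) (WConst 0)))
          (tst (WArr ''nx'' (WVar ''y'')))) (WAssign ''y'' (WArr ''nx'' (WVar ''y'')))) s
    (\<lambda>n s'. \<exists>as c bs. ts = as @ c # bs \<and> s' = s\<lparr>wvar := (wvar s)(''y'' := root c)\<rparr> \<and>
       (as \<noteq> [] \<longrightarrow> P (rarr s ''ky'' (root c))) \<and>
       (bs \<noteq> [] \<longrightarrow> \<not> P (rarr s ''ky'' (root (hd bs)))) \<and> n \<le> 15 + 18 * length ts)"
    (is "runs (While ?b ?c) s ?Q")
proof -
  have cost: "bcost ?b \<le> 12" using is_testD(2)[OF tst, of "WArr ''nx'' (WVar ''y'')"] by simp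
  have main: "runs (While ?b ?c) s' (\<lambda>n s''. \<exists>as c bs. ts = as @ c # bs \<and>
       s'' = s\<lparr>wvar := (wvar s)(''y'' := root c)\<rparr> \<and>
       (as \<noteq> [] \<longrightarrow> P (rarr s ''ky'' (root c))) \<and>
       (bs \<noteq> [] \<longrightarrow> \<not> P (rarr s ''ky'' (root (hd bs)))) \<and> n \<le> 15 + 18 * length bs0)"
    if "ts = as @ c # bs0" "s' = s\<lparr>wvar := (wvar s)(''y'' := root c)\<rparr>"
      "as \<noteq> [] \<longrightarrow> P (rarr s ''ky'' (root c))" for as c bs0 s'
    using that
  proof (induction bs0 arbitrary: as c s')
    case Nil
    then have "warr s ''nx'' (root c) = 0" using assms(2) by (simp add: chain_append)
    then show ?case using Nil cost by (intro runs_While_False) auto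
  next
    case (Cons b bs)
    have nx: "warr s ''nx'' (root c) = root b" using assms(2) Cons.prems(1) by (simp add: chain_append)
    have b0: "root b \<noteq> 0" using assms(3) Cons.prems(1) by auto
    have t: "bval (tst (WArr ''nx'' (WVar ''y''))) s' = P (rarr s ''ky'' (root b))"
      using is_testD(1)[of tst P s'] tst Cons.prems nx by simp
    show ?case
    proof (cases "P (rarr s ''ky'' (root b))")
      case False
      then show ?thesis using Cons.prems cost t
        by (intro runs_While_False) (simp, rule_tac x = as in exI, rule_tac x = c in exI,
            rule_tac x = "b # bs" in exI, auto)
    next
      case True
      show ?thesis
      proof (rule runs_While_True, goal_cases)
        case 1 then show ?case using True t nx b0 Cons.prems by simp
      next
        case 2
        show ?case
        proof (rule runs_loop_free, simp, rule runs_mono[OF Cons.IH[of "as @ [c]" b]], goal_cases)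
          case 1 then show ?case using Cons.prems by simp
        next
          case 2 then show ?case using Cons.prems nx by (simp add: fun_upd_def cong: if_cong)
        next
          case 3 then show ?case using True by simp
        next
          case (4 n m s'')
          then obtain as' c' bs' where "ts = as' @ c' # bs'"
            "s'' = s\<lparr>wvar := (wvar s)(''y'' := root c')\<rparr>"
            "as' \<noteq> [] \<longrightarrow> P (rarr s ''ky'' (root c'))"
            "bs' \<noteq> [] \<longrightarrow> \<not> P (rarr s ''ky'' (root (hd bs')))"
            and m: "m \<le> 15 + 18 * length bs" by blast
          moreover have "bcost ?b + n + m \<le> 15 + 18 * length (b # bs)"
            using cost m 4(1) by simp
          ultimately show ?case by blast
        qed
      qed
    qed
  qed
  show ?thesis
  proof (rule runs_mono[OF main[OF assms(4) _ assms(6), of s]])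
    show "s = s\<lparr>wvar := (wvar s)(''y'' := root c)\<rparr>" by (simp add: assms(5)[symmetric])
    have le: "15 + 18 * length bs \<le> 15 + 18 * length ts" using assms(4) by simp
    fix n s'
    assume "\<exists>as c bsa. ts = as @ c # bsa \<and>
       s' = s\<lparr>wvar := (wvar s)(''y'' := root c)\<rparr> \<and>
       (as \<noteq> [] \<longrightarrow> P (rarr s ''ky'' (root c))) \<and>
       (bsa \<noteq> [] \<longrightarrow> \<not> P (rarr s ''ky'' (root (hd bsa)))) \<and> n \<le> 15 + 18 * length bs"
    then obtain as' c' bs' where *: "ts = as' @ c' # bs'"
      "s' = s\<lparr>wvar := (wvar s)(''y'' := root c')\<rparr>"
      "as' \<noteq> [] \<longrightarrow> P (rarr s ''ky'' (root c'))"
      "bs' \<noteq> [] \<longrightarrow> \<not> P (rarr s ''ky'' (root (hd bs')))" "n \<le> 15 + 18 * length bs" by blast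
    from *(5) le have "n \<le> 15 + 18 * length ts" by (rule order_trans)
    with * show "?Q n s'" by blast
  qed
qed

text \<open>The threshold between accepted and rejected leaves falls inside the chosen child
  \<open>l\<close>: if it came earlier, \<open>hd l\<close> would be rejected, and if it came later,
  \<open>hd bs\<close> would be accepted. The head of \<open>us\<close> is exempt from
  \<open>p\<close>, as it is the leftmost leaf in sight. That \<open>us'\<close> is nonempty lets
  the same argument be repeated one level down.\<close>

lemma split_position:
  assumes "as @ l @ bs = us @ vs" "l \<noteq> []" "us \<noteq> []"
    and "\<forall>u \<in> set (tl us). p u" "\<forall>v \<in> set vs. \<not> p v"
    and "as \<noteq> [] \<longrightarrow> p (hd l)" "bs \<noteq> [] \<longrightarrow> \<not> p (hd bs)"
  obtains us' vs' where "us = as @ us'" "l = us' @ vs'" "vs = vs' @ bs" "us' \<noteq> []"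
proof -
  have "length as < length us"
  proof (rule ccontr)
    assume "\<not> length as < length us"
    then obtain w where w: "as = us @ w" "vs = w @ l @ bs"
      using assms(1) by (auto simp: append_eq_append_conv2)
    then have "hd l \<in> set vs" "as \<noteq> []" using assms(2,3) by auto
    then show False using assms(5,6) by blast
  qed
  then obtain us' where us: "us = as @ us'" "us' \<noteq> []"
    using assms(1) by (auto simp: append_eq_append_conv2)
  with assms(1) have eq: "l @ bs = us' @ vs" by simp
  have "length us' \<le> length l"
  proof (rule ccontr)
    assume *: "\<not> length us' \<le> length l"
    with eq obtain w where w: "us' = l @ w" "w \<noteq> []" "bs = w @ vs"
      by (auto simp: append_eq_append_conv2)
    then have "hd bs \<in> set (tl us)" using us assms(2) by (cases as; cases l) auto
    then show False using assms(4,7) w by auto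
  qed
  with eq obtain vs' where "l = us' @ vs'" "vs = vs' @ bs" by (auto simp: append_eq_append_conv2)
  with us show ?thesis using that by blast
qed


section \<open>Frames and families of siblings\<close>

text \<open>\<open>U\<close> and \<open>V\<close> bound the old nodes whose child count and sibling
  pointer may change. The first-child pointers and the keys of old nodes stay fixed: new nodes are
  always placed behind an existing sibling, so a first child remains first.\<close>

definition tree_frame :: "state \<Rightarrow> state \<Rightarrow> nat set \<Rightarrow> nat set \<Rightarrow> bool" where
  "tree_frame s s' U V \<longleftrightarrow> wvar s ''fr'' \<le> wvar s' ''fr'' \<and>
    (\<forall>a < wvar s ''fr''. warr s' ''dn'' a = warr s ''dn'' a \<and> rarr s' ''ky'' a = rarr s ''ky'' a \<and>
       (a \<notin> U \<longrightarrow> warr s' ''ct'' a = warr s ''ct'' a) \<and>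
       (a \<notin> V \<longrightarrow> warr s' ''nx'' a = warr s ''nx'' a))"

lemma tree_frame_trans:
  assumes "tree_frame s s' U V" "tree_frame s' s'' U' V'"
    and "\<forall>a < wvar s ''fr''. (a \<in> U \<union> U' \<longrightarrow> a \<in> U'') \<and> (a \<in> V \<union> V' \<longrightarrow> a \<in> V'')"
  shows "tree_frame s s'' U'' V''"
  using assms unfolding tree_frame_def by (auto dest: less_le_trans)

lemma set_nodes_kids: "c \<in> set (kids t) \<Longrightarrow> set (nodes c) \<subseteq> set (nodes t)"
  by (cases t) auto

lemma root_notin_kids:
  "distinct (nodes t) \<Longrightarrow> c \<in> set (kids t) \<Longrightarrow> root t \<notin> set (nodes c)"
  by (cases t) auto

lemma represents_frame:
  assumes "tree_frame s s' U V" "represents s t" "distinct (nodes t)"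
    and "\<forall>a \<in> set (nodes t). a < wvar s ''fr''"
    and "set (nodes t) \<inter> U = {}" "set (nodes t) \<inter> V \<subseteq> {root t}"
  shows "represents s' t"
proof (rule represents_cong[OF _ _ _ _ assms(2)])
  fix c a assume "c \<in> set (kids t)" "a \<in> set (nodes c)"
  then have "a \<in> set (nodes t)" "a \<noteq> root t"
    using set_nodes_kids[of c t] root_notin_kids[OF assms(3)] by auto
  then show "warr s' ''nx'' a = warr s ''nx'' a"
    using assms unfolding tree_frame_def by blast
qed (use assms in \<open>auto simp: tree_frame_def\<close>)

text \<open>The children of \<open>x\<close> with no condition on their number, so that one notion
  describes a root with one child, a node that has just gained a child and an ordinary inner node.
  Positive addresses keep 0 free as the null pointer.\<close>

definition family :: "state \<Rightarrow> nat \<Rightarrow> nat \<Rightarrow> tree list \<Rightarrow> bool" where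
  "family s h x ts \<longleftrightarrow> represents s (Node x ts) \<and> distinct (nodes (Node x ts)) \<and>
    (\<forall>a \<in> set (nodes (Node x ts)). 0 < a \<and> a < wvar s ''fr'') \<and> (\<forall>t \<in> set ts. balanced h t)"

definition located :: "state \<Rightarrow> (real \<Rightarrow> bool) \<Rightarrow> tree list \<Rightarrow> tree \<Rightarrow> tree list \<Rightarrow> bool" where
  "located s P as c bs \<longleftrightarrow> wvar s ''y'' = root c \<and>
    (as \<noteq> [] \<longrightarrow> P (rarr s ''ky'' (root c))) \<and> (bs \<noteq> [] \<longrightarrow> \<not> P (rarr s ''ky'' (root (hd bs))))"

section \<open>Splitting a full node\<close>

lemma effect_link:
  assumes "wvar s ''y'' \<noteq> wvar s ''fr''"
  shows "wvar (effect link s) = (wvar s)(''z'' := wvar s ''fr'', ''fr'' := Suc (wvar s ''fr''))"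
    and "rvar (effect link s) = rvar s" and "rarr (effect link s) = rarr s"
    and "warr (effect link s) = (warr s)
      (''nx'' := (warr s ''nx'')(wvar s ''fr'' := warr s ''nx'' (wvar s ''y''), wvar s ''y'' := wvar s ''fr''),
       ''ct'' := (warr s ''ct'')(wvar s ''x'' := Suc (warr s ''ct'' (wvar s ''x''))))"
  using assms by (auto simp: link_def)

text \<open>Symbolic execution in closed form. The inequalities exclude aliasing among the parent
  \<open>x\<close>, the full node \<open>y\<close>, the fresh node \<open>z\<close> and the second
  child \<open>d\<close> of \<open>y\<close>, whose sibling pointer is cut.\<close>

lemma effect_split_body:
  fixes s tst
  defines "y \<equiv> wvar s ''y''" and "x \<equiv> wvar s ''x''" and "z \<equiv> wvar s ''fr''"
  defines "d \<equiv> warr s ''nx'' (warr s ''dn'' y)"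
  defines "s' \<equiv> effect (split_body tst) s"
  assumes tst: "is_test tst P (rvar s)"
    and neq: "y < z" "warr s ''dn'' y < z" "d < z" "warr s ''nx'' d < z" "d \<noteq> y" "warr s ''dn'' y \<noteq> y"
      "x < z" "x \<noteq> y"
  shows "warr s' ''nx'' = (warr s ''nx'')(z := warr s ''nx'' y, y := z, d := 0)"
    and "warr s' ''dn'' = (warr s ''dn'')(z := warr s ''nx'' d)"
    and "warr s' ''ct'' = (warr s ''ct'')(x := Suc (warr s ''ct'' x), z := 2, y := 2)"
    and "rarr s' ''ky'' = (rarr s ''ky'')(z := rarr s ''ky'' (warr s ''nx'' d))"
    and "wvar s' ''x'' = x" and "wvar s' ''fr'' = Suc z"
    and "wvar s' ''y'' = (if P (rarr s ''ky'' (warr s ''nx'' d)) then z else y)"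
    and "rvar s' = rvar s"
proof -
  have test: "rvar u = rvar s \<Longrightarrow> bval (tst e) u = P (rarr u ''ky'' (wval e u))" for u e
    using tst unfolding is_test_def by blast
  have yz: "wvar s ''y'' \<noteq> wvar s ''fr''" using neq y_def z_def by simp
  note link = effect_link[OF yz]
  note defs = y_def x_def z_def d_def
  show "warr s' ''nx'' = (warr s ''nx'')(z := warr s ''nx'' y, y := z, d := 0)"
    "warr s' ''dn'' = (warr s ''dn'')(z := warr s ''nx'' d)"
    "warr s' ''ct'' = (warr s ''ct'')(x := Suc (warr s ''ct'' x), z := 2, y := 2)"
    "rarr s' ''ky'' = (rarr s ''ky'')(z := rarr s ''ky'' (warr s ''nx'' d))"
    "wvar s' ''x'' = x" "wvar s' ''fr'' = Suc z"
    "wvar s' ''y'' = (if P (rarr s ''ky'' (warr s ''nx'' d)) then z else y)"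
    "rvar s' = rvar s"
    using neq unfolding s'_def split_body_def defs by (simp_all add: link test)
qed

lemma distinct_roots: "distinct (concat (map nodes ts)) \<Longrightarrow> distinct (map root ts)"
proof (induction ts)
  case (Cons t ts)
  have "root t \<noteq> root u" if "u \<in> set ts" for u
  proof
    assume "root t = root u"
    then have "root t \<in> set (nodes t) \<inter> set (nodes u)" by (metis IntI root_in_nodes)
    then show False using Cons.prems that by (auto simp del: root_in_nodes)
  qed
  then show ?case using Cons by auto
qed simp

text \<open>The four children are divided in the middle. The new right half takes its key from the
  third child, and this is the key of its first leaf because the third child was not a first child.
  Whether the located child becomes the left or the right half is decided by a last test, hence the
  existential form.\<close>

lemma split_body_family:
  fixes tst s
  defines "s' \<equiv> effect (split_body tst) s"
  assumes tst: "is_test tst P (rvar s)" and fam: "family s (Suc h) x (as @ c # bs)"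
    and loc: "located s P as c bs" and x: "wvar s ''x'' = x" and full: "length (kids c) = 4"
  obtains as' c' bs' where "family s' (Suc h) x (as' @ c' # bs')" "located s' P as' c' bs'"
    "length (as' @ c' # bs') = Suc (length (as @ c # bs))" "length (kids c') = 2"
    "concat (map leaves (as' @ c' # bs')) = concat (map leaves (as @ c # bs))"
    "set (nodes (Node x (as' @ c' # bs'))) \<subseteq> insert (wvar s ''fr'') (set (nodes (Node x (as @ c # bs))))"
    "tree_frame s s' {x, root c} (\<Union>t \<in> set (as @ c # bs). set (nodes t))"
    "wvar s' ''x'' = x" "rvar s' = rvar s" "wvar s' ''fr'' = Suc (wvar s ''fr'')"
proof -
  obtain y c1 c2 c3 c4 where c: "c = Node y [c1, c2, c3, c4]"
    using full by (cases c) (auto simp: numeral_eq_Suc length_Suc_conv)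
  define z where "z = wvar s ''fr''"
  have y: "wvar s ''y'' = y" using loc c by (simp add: located_def)
  have rep: "represents s (Node x (as @ c # bs))" and dist: "distinct (nodes (Node x (as @ c # bs)))"
    and bound: "\<And>a. a \<in> set (nodes (Node x (as @ c # bs))) \<Longrightarrow> 0 < a \<and> a < z"
    and bal: "\<forall>t \<in> set (as @ c # bs). balanced (Suc h) t"
    using fam by (auto simp: family_def z_def)
  have repc: "represents s c" using rep by simp
  have dn: "warr s ''dn'' y = root c1" and nx1: "warr s ''nx'' (root c1) = root c2"
    and nx2: "warr s ''nx'' (root c2) = root c3"
    using repc c by auto
  have sub: "set (nodes t) \<subseteq> set (nodes (Node x (as @ c # bs)))"
    if "t \<in> set as \<union> set bs \<union> {c, c1, c2, c3, c4}" for t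
    using that c by auto
  have disj: "set (nodes t) \<inter> set (nodes c) = {}" "x \<notin> set (nodes t)"
    if "t \<in> set as \<union> set bs" for t
    using that dist by auto
  have xc: "x \<notin> set (nodes c)" using dist by simp
  have distc: "distinct (nodes c)" using dist by simp
  have in_c: "root c1 \<in> set (nodes c)" "root c2 \<in> set (nodes c)" "root c3 \<in> set (nodes c)"
    "root c4 \<in> set (nodes c)" "y \<in> set (nodes c)"
    using c by auto
  have yne: "y \<notin> set (nodes c1)" "y \<notin> set (nodes c2)" "y \<notin> set (nodes c3)" "y \<notin> set (nodes c4)"
    using distc c by auto
  have lt: "a < z" if "a \<in> set (nodes c)" for a using bound sub[of c] that by auto
  have xz: "x < z" using bound by simp
  have ne: "root c2 \<noteq> y" "root c1 \<noteq> y" "x \<noteq> y"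
    using yne root_in_nodes[of c1] root_in_nodes[of c2] xc in_c by (auto simp del: root_in_nodes)
  note eff = effect_split_body[OF tst, folded s'_def, unfolded y x dn nx1 nx2, folded z_def,
      OF lt[OF in_c(5)] lt[OF in_c(1)] lt[OF in_c(2)] lt[OF in_c(3)] ne(1,2) xz ne(3)]
  have ky3: "rarr s ''ky'' (root c3) = rarr s ''ky'' (hd (leaves c3))"
    and ky2: "rarr s ''ky'' (root c2) = rarr s ''ky'' (hd (leaves c2))"
    and ky4: "rarr s ''ky'' (root c4) = rarr s ''ky'' (hd (leaves c4))"
    using repc c by auto
  define cl cr where "cl = Node y [c1, c2]" and "cr = Node z [c3, c4]"
  define U where "U = {x, y}"
  \<comment> \<open>The old sibling pointers affected: that of the full node is redirected to the
    new half, that of its second child is cut.\<close>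
  define V where "V = {y, root c2}"
  have frame: "tree_frame s s' U V"
    unfolding tree_frame_def U_def V_def using eff by (simp flip: z_def)
  have rep_out: "represents s' t" if t: "t \<in> set as \<union> set bs" for t
  proof (rule represents_frame[OF frame])
    show "represents s t" "distinct (nodes t)" using t rep dist by (auto dest: in_set_conv_decomp[THEN iffD1])
    show "\<forall>a\<in>set (nodes t). a < wvar s ''fr''" using bound sub[of t] t by (auto simp flip: z_def)
    show "set (nodes t) \<inter> U = {}" "set (nodes t) \<inter> V \<subseteq> {root t}"
      using disj[OF t] in_c unfolding U_def V_def by auto
  qed
  have rep_in: "represents s' t" if t: "t \<in> {c1, c2, c3, c4}" for t
  proof (rule represents_frame[OF frame])
    show "represents s t" "distinct (nodes t)" using t repc distc c by auto
    show "\<forall>a\<in>set (nodes t). a < wvar s ''fr''" using bound sub[of t] t by (auto simp flip: z_def)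
    have "t = c2 \<or> root c2 \<notin> set (nodes t)"
      using t distc c root_in_nodes[of c2] by (auto simp del: root_in_nodes)
    then show "set (nodes t) \<inter> V \<subseteq> {root t}" using t yne unfolding V_def by auto
    show "set (nodes t) \<inter> U = {}" using t yne xc c unfolding U_def by auto
  qed
  have rcl: "represents s' cl" and rcr: "represents s' cr"
  proof -
    have kyz: "rarr s' ''ky'' a = rarr s ''ky'' a" if "a \<in> set (nodes c)" for a
      using lt[OF that] eff by simp
    have in_c': "hd (leaves c2) \<in> set (nodes c)" "hd (leaves c4) \<in> set (nodes c)" using c by auto
    have "root c1 \<noteq> root c2" "root c3 \<noteq> root c2" "root c4 \<noteq> root c2"
      "root c3 \<noteq> y" "root c4 \<noteq> y"
      using distc c root_in_nodes[of c1] root_in_nodes[of c2] root_in_nodes[of c3] root_in_nodes[of c4]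
      by (auto simp del: root_in_nodes)
    then show "represents s' cl" "represents s' cr"
      using rep_in eff repc c ne xz lt[OF in_c(1)] lt[OF in_c(2)] lt[OF in_c(3)] lt[OF in_c(4)] lt[OF in_c(5)]
        kyz in_c in_c' ky2 ky4
      unfolding cl_def cr_def by auto
  qed
  have zr: "a \<noteq> z" "a \<noteq> y" "a \<noteq> root c2" if "t \<in> set as \<union> set bs" "a \<in> set (nodes t)" for t a
    using disj[OF that(1)] that in_c bound sub[of t] by auto
  have ch: "chain (warr s ''nx'') (map root as @ y # map root bs) 0" using rep c by simp
  have chn: "chain (warr s' ''nx'') (map root as @ y # z # map root bs) 0"
  proof (rule chain_insert[OF ch])
    show "distinct (map root as @ y # map root bs)"
      using distinct_roots[of "as @ c # bs"] dist c by auto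
    show "z \<notin> set (map root as @ y # map root bs)"
      using zr(1)[OF _ root_in_nodes] lt[OF in_c(5)] by force
    show "warr s' ''nx'' y = z" "warr s' ''nx'' z = warr s ''nx'' y"
      using eff ne lt[OF in_c(5)] lt[OF in_c(2)] by auto
    show "warr s' ''nx'' a = warr s ''nx'' a" if a: "a \<in> set (map root as) \<union> set (map root bs)" for a
    proof -
      obtain t where "t \<in> set as \<union> set bs" "a = root t" using a by auto
      then show ?thesis using zr[of t a] eff by simp
    qed
  qed
  have kyo: "rarr s' ''ky'' a = rarr s ''ky'' a" if "a < z" for a using eff that by simp
  have kyr: "rarr s' ''ky'' (root t) = rarr s' ''ky'' (hd (leaves t))"
    if t: "t \<in> set (tl (as @ cl # cr # bs))" for t
  proof -
    consider "t = cr" | "t = cl" "as \<noteq> []" | "t \<in> set (tl (as @ c # bs))" "t \<in> set as \<union> set bs"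
      using t by (cases as) auto
    then show ?thesis
    proof cases
      case 1
      have "hd (leaves c3) < z" by (rule lt) (use c in auto)
      then show ?thesis using 1 eff ky3 kyo by (simp add: cr_def)
    next
      case 2
      then have "c \<in> set (tl (as @ c # bs))" by (cases as) auto
      then have "rarr s ''ky'' (root c) = rarr s ''ky'' (hd (leaves c))" using rep by simp
      moreover have "hd (leaves c) < z" "root c < z" using lt by auto
      ultimately show ?thesis using 2 kyo c by (simp add: cl_def hd_append)
    next
      case 3
      then have "rarr s ''ky'' (root t) = rarr s ''ky'' (hd (leaves t))" using rep by simp
      moreover have "hd (leaves t) < z" "root t < z"
        using bound sub[of t] 3(2) hd_leaves_in_nodes[of t] root_in_nodes[of t] by blast+
      ultimately show ?thesis using kyo by simp
    qed
  qed
  have rep': "represents s' (Node x (as @ cl # cr # bs))"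
  proof -
    have "hd (map root (as @ cl # cr # bs) @ [0]) = hd (map root (as @ c # bs) @ [0])"
      using c by (cases as) (auto simp: cl_def)
    moreover have "warr s' ''dn'' x = hd (map root (as @ c # bs) @ [0])"
      "warr s' ''ct'' x = length (as @ cl # cr # bs)"
      using eff(2,3) rep xz ne by auto
    moreover have "chain (warr s' ''nx'') (map root (as @ cl # cr # bs)) 0"
      using chn by (simp add: cl_def cr_def)
    moreover have "\<forall>t \<in> set (as @ cl # cr # bs). represents s' t" using rcl rcr rep_out by auto
    ultimately show ?thesis unfolding represents.simps using kyr by metis
  qed
  have zn: "z \<notin> set (nodes (Node x (as @ c # bs)))" using bound by blast
  have fam': "family s' (Suc h) x (as @ cl # cr # bs)"
  proof -
    have "distinct (nodes (Node x (as @ cl # cr # bs)))"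
      using dist zn unfolding cl_def cr_def c by auto
    moreover have "balanced (Suc h) cl" "balanced (Suc h) cr" using bal c unfolding cl_def cr_def by auto
    moreover have "0 < z" using xz by simp
    moreover have "set (nodes (Node x (as @ cl # cr # bs))) \<subseteq> insert z (set (nodes (Node x (as @ c # bs))))"
      unfolding cl_def cr_def c by auto
    moreover have "0 < a \<and> a < Suc z" if "a \<in> insert z (set (nodes (Node x (as @ c # bs))))" for a
      using that bound \<open>0 < z\<close> by (auto simp del: nodes.simps intro: less_SucI)
    moreover have "\<forall>t \<in> set (as @ cl # cr # bs). balanced (Suc h) t" using bal calculation(2,3) by auto
    ultimately show ?thesis using rep' unfolding family_def eff(6) by blast
  qed
  have bsky: "rarr s' ''ky'' (root (hd bs)) = rarr s ''ky'' (root (hd bs))" if "bs \<noteq> []"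
  proof (rule kyo)
    from that have "root (hd bs) \<in> set (nodes (Node x (as @ c # bs)))"
      using sub[of "hd bs"] root_in_nodes[of "hd bs"] by (auto simp del: root_in_nodes nodes.simps)
    then show "root (hd bs) < z" using bound by blast
  qed
  have rk: "rarr s' ''ky'' y = rarr s ''ky'' y" using kyo lt[OF in_c(5)] by simp
  \<comment> \<open>The key of \<open>c3\<close> is the key of the right half, so testing it tells
    which half contains the insertion point.\<close>
  have loc': "located s' P as cl (cr # bs)" if "\<not> P (rarr s ''ky'' (root c3))"
    using that loc eff rk c unfolding located_def by (auto simp: cl_def cr_def)
  have loc'': "located s' P (as @ [cl]) cr bs" if "P (rarr s ''ky'' (root c3))"
    using that loc eff bsky unfolding located_def by (auto simp: cl_def cr_def)
  have frame': "tree_frame s s' {x, root c} (\<Union>t \<in> set (as @ c # bs). set (nodes t))"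
    using frame in_c unfolding tree_frame_def U_def V_def c by auto
  have leaves: "concat (map leaves (as @ cl # cr # bs)) = concat (map leaves (as @ c # bs))"
    unfolding cl_def cr_def c by simp
  have nodes: "set (nodes (Node x (as @ cl # cr # bs)))
      \<subseteq> insert (wvar s ''fr'') (set (nodes (Node x (as @ c # bs))))"
    unfolding cl_def cr_def c z_def by auto
  have len: "length (kids cl) = 2" "length (kids cr) = 2" by (simp_all add: cl_def cr_def)
  show ?thesis
  proof (cases "P (rarr s ''ky'' (root c3))")
    case True
    show ?thesis by (rule that[of "as @ [cl]" cr bs])
      (use fam' loc''[OF True] leaves nodes frame' eff len in \<open>simp_all add: z_def\<close>)
  next
    case False
    show ?thesis by (rule that[of as cl "cr # bs"])
      (use fam' loc'[OF False] leaves nodes frame' eff len in \<open>simp_all add: z_def\<close>)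
  qed
qed

lemma family_cong:
  assumes "wvar s' ''fr'' = wvar s ''fr''" "warr s' = warr s" "rarr s' = rarr s"
  shows "family s' h x ts = family s h x ts"
proof -
  have "represents s t \<Longrightarrow> represents s' t" for t by (rule represents_cong) (use assms in auto)
  moreover have "represents s' t \<Longrightarrow> represents s t" for t by (rule represents_cong) (use assms in auto)
  ultimately show ?thesis unfolding family_def assms(1) by blast
qed

text \<open>A bridge from node keys to leaf keys: a child other than the first has the key of its
  first leaf, and \<open>located\<close> compares the key of the chosen child only if
  \<open>as\<close> is nonempty.\<close>

lemma located_leaves:
  assumes "family s h x (as @ c # bs)" "located s P as c bs"
    and "concat (map leaves (as @ c # bs)) = us @ vs" "us \<noteq> []"
    and "\<forall>u \<in> set (tl us). P (rarr s ''ky'' u)" "\<forall>v \<in> set vs. \<not> P (rarr s ''ky'' v)"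
  obtains us' vs' where "us = concat (map leaves as) @ us'" "leaves c = us' @ vs'"
    "vs = vs' @ concat (map leaves bs)" "us' \<noteq> []"
proof (rule split_position[of "concat (map leaves as)" "leaves c" "concat (map leaves bs)" us vs
      "\<lambda>u. P (rarr s ''ky'' u)"])
  have ky: "rarr s ''ky'' (root t) = rarr s ''ky'' (hd (leaves t))" if "t \<in> set (tl (as @ c # bs))" for t
    using assms(1) that by (auto simp: family_def)
  show "concat (map leaves as) \<noteq> [] \<longrightarrow> P (rarr s ''ky'' (hd (leaves c)))"
    using assms(2) ky[of c] by (cases as) (auto simp: located_def)
  show "concat (map leaves bs) \<noteq> [] \<longrightarrow> \<not> P (rarr s ''ky'' (hd (concat (map leaves bs))))"
    using assms(2) ky[of "hd bs"] by (cases as; cases bs) (auto simp: located_def)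
qed (use assms that in auto)

lemma runs_scan:
  assumes tst: "is_test tst P (rvar s)" and fam: "family s h x ts" and "ts \<noteq> []" "wvar s ''x'' = x"
  shows "runs (scan tst) s (\<lambda>n s'. \<exists>as c bs. ts = as @ c # bs \<and> family s' h x ts \<and>
    located s' P as c bs \<and> s' = s\<lparr>wvar := (wvar s)(''y'' := root c)\<rparr> \<and> n \<le> 18 + 18 * length ts)"
  unfolding scan_def
proof (rule runs_Seq, rule runs_loop_free, simp, goal_cases)
  case (1 n)
  define s1 where "s1 = effect (WAssign ''y'' (WArr ''dn'' (WVar ''x''))) s"
  obtain t us where ts: "ts = t # us" using assms(3) by (cases ts) auto
  have rep: "represents s (Node x ts)"
    and bd: "\<forall>a \<in> set (nodes (Node x ts)). 0 < a \<and> a < wvar s ''fr''"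
    using fam by (auto simp: family_def)
  have s1: "s1 = s\<lparr>wvar := (wvar s)(''y'' := root t)\<rparr>"
    using rep ts assms(4) by (simp add: s1_def)
  have "0 \<notin> set (map root ts)"
  proof
    assume "0 \<in> set (map root ts)"
    then obtain u where u: "u \<in> set ts" "root u = 0" by auto
    then have "root u \<in> set (nodes (Node x ts))" using root_in_nodes[of u] by (auto simp del: root_in_nodes)
    with u bd show False by fastforce
  qed
  then show ?case unfolding s1_def[symmetric]
  proof (intro runs_mono[OF runs_scan_loop[where ts = ts and as = "[]" and c = t and bs = us and P = P]], goal_cases)
    case 1 then show ?case using tst s1 by simp
  next
    case 2 then show ?case using rep s1 by simp
  next
    case (7 m s')
    then obtain as c bs where *: "ts = as @ c # bs" "s' = s1\<lparr>wvar := (wvar s1)(''y'' := root c)\<rparr>"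
      "as \<noteq> [] \<longrightarrow> P (rarr s1 ''ky'' (root c))" "bs \<noteq> [] \<longrightarrow> \<not> P (rarr s1 ''ky'' (root (hd bs)))"
      "m \<le> 15 + 18 * length ts" by blast
    have s': "s' = s\<lparr>wvar := (wvar s)(''y'' := root c)\<rparr>" using *(2) s1 by simp
    have "family s' h x ts" using fam family_cong[of s' s] s' by simp
    moreover have "located s' P as c bs" using *(3,4) s1 s' by (simp add: located_def)
    moreover have "n + m \<le> 18 + 18 * length ts" using *(5) \<open>n \<le> max_cost _\<close> by simp
    ultimately show ?case using *(1) s' by blast
  qed (use ts s1 in auto)
qed

text \<open>What the level above must know about work below \<open>x\<close>: new nodes are fresh,
  the old part changed only inside the subtree, and at most one child was added. The sibling pointer
  of \<open>x\<close> itself is not among those that may change, since it belongs to the list one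
  level up.\<close>

definition grows :: "state \<Rightarrow> state \<Rightarrow> nat \<Rightarrow> tree list \<Rightarrow> tree list \<Rightarrow> bool" where
  "grows s s' x ts ts' \<longleftrightarrow>
    set (nodes (Node x ts')) \<subseteq> set (nodes (Node x ts)) \<union> {wvar s ''fr''..<wvar s' ''fr''} \<and>
    tree_frame s s' (set (nodes (Node x ts))) (\<Union>t \<in> set ts. set (nodes t)) \<and>
    length ts \<le> length ts' \<and> length ts' \<le> Suc (length ts) \<and> rvar s' = rvar s"

lemma runs_split:
  assumes tst: "is_test tst P (rvar s)" and fam: "family s h x (as @ c # bs)"
    and loc: "located s P as c bs" and x: "wvar s ''x'' = x"
  shows "runs (split tst) s (\<lambda>n s'. \<exists>as' c' bs'. family s' h x (as' @ c' # bs') \<and>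
    located s' P as' c' bs' \<and> length (kids c') \<le> 3 \<and> (h > 0 \<longrightarrow> kids c' \<noteq> []) \<and>
    concat (map leaves (as' @ c' # bs')) = concat (map leaves (as @ c # bs)) \<and>
    grows s s' x (as @ c # bs) (as' @ c' # bs') \<and> wvar s' ''x'' = x \<and> n \<le> 60)"
    (is "runs _ _ ?Q")
proof -
  have lf: "loop_free (split tst)" by (simp add: split_def split_body_def link_def)
  have cost: "max_cost (split tst) \<le> 60"
    using is_testD(2)[OF tst, of "WVar ''z''"] by (simp add: split_def split_body_def link_def)
  have ct: "warr s ''ct'' (wvar s ''y'') = length (kids c)"
    using fam loc by (cases c) (auto simp: family_def located_def)
  have bal: "balanced h c" using fam by (simp add: family_def)
  show ?thesis
  proof (rule runs_loop_free[OF lf], goal_cases)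
    case (1 n)
    then have n: "n \<le> 60" using cost by simp
    show ?case
    proof (cases "length (kids c) = 4")
      case True
      then obtain g where h: "h = Suc g" using bal by (cases c; cases h) auto
      have e: "effect (split tst) s = effect (split_body tst) s" using True ct by (simp add: split_def)
      obtain as' c' bs' where *: "family (effect (split_body tst) s) (Suc g) x (as' @ c' # bs')"
        "located (effect (split_body tst) s) P as' c' bs'"
        "length (as' @ c' # bs') = Suc (length (as @ c # bs))" "length (kids c') = 2"
        "concat (map leaves (as' @ c' # bs')) = concat (map leaves (as @ c # bs))"
        "set (nodes (Node x (as' @ c' # bs'))) \<subseteq> insert (wvar s ''fr'') (set (nodes (Node x (as @ c # bs))))"
        "tree_frame s (effect (split_body tst) s) {x, root c} (\<Union>t \<in> set (as @ c # bs). set (nodes t))"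
        "wvar (effect (split_body tst) s) ''x'' = x" "rvar (effect (split_body tst) s) = rvar s"
        "wvar (effect (split_body tst) s) ''fr'' = Suc (wvar s ''fr'')"
        using split_body_family[OF tst fam[unfolded h] loc x True] by blast
      have "tree_frame s (effect (split_body tst) s) (set (nodes (Node x (as @ c # bs))))
          (\<Union>t \<in> set (as @ c # bs). set (nodes t))"
        using *(7) root_in_nodes[of c] unfolding tree_frame_def by auto
      then have "grows s (effect (split_body tst) s) x (as @ c # bs) (as' @ c' # bs')"
        using *(3,6,9,10) unfolding grows_def by (auto simp del: nodes.simps)
      then show ?thesis using *(1,2,4,5,8) n unfolding e h
        by (intro exI[of _ as'] exI[of _ c'] exI[of _ bs']) (auto simp del: map_append concat_append)
    next
      case False
      then have "effect (split tst) s = s" using ct by (simp add: split_def)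
      moreover have "length (kids c) \<le> 3" "h > 0 \<longrightarrow> kids c \<noteq> []"
        using False bal by (cases c; cases h; force)+
      moreover have "grows s s x (as @ c # bs) (as @ c # bs)"
        by (simp add: grows_def tree_frame_def)
      ultimately show ?thesis using fam loc x n by auto
    qed
  qed
qed

lemma add_leaf_family:
  fixes key s
  defines "s' \<equiv> effect (add_leaf key) s" and "z \<equiv> wvar s ''fr''"
  assumes fam: "family s 0 x (as @ c # bs)" and y: "wvar s ''y'' = root c" and x: "wvar s ''x'' = x"
    and key: "key = RVar v"
  shows "family s' 0 x (as @ c # Node z [] # bs)" "grows s s' x (as @ c # bs) (as @ c # Node z [] # bs)"
    "wvar s' ''z'' = z" "rarr s' ''ky'' z = rvar s v" "wvar s' ''y'' = root c" "z < wvar s' ''fr''"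
proof -
  have rep: "represents s (Node x (as @ c # bs))" and dist: "distinct (nodes (Node x (as @ c # bs)))"
    and bound: "\<And>a. a \<in> set (nodes (Node x (as @ c # bs))) \<Longrightarrow> 0 < a \<and> a < z"
    and bal: "\<forall>t \<in> set (as @ c # bs). balanced 0 t"
    using fam by (auto simp: family_def z_def)
  have leaf: "t = Node (root t) []" if "t \<in> set (as @ c # bs)" for t
  proof -
    have "balanced 0 t" using bal that by blast
    then show ?thesis by (cases t) simp
  qed
  have lt: "root t < z" "root t \<noteq> x" if "t \<in> set (as @ c # bs)" for t
  proof -
    have "root t \<in> set (nodes (Node x (as @ c # bs)))"
      using that root_in_nodes[of t] by (auto simp del: root_in_nodes)
    then show "root t < z" using bound by blast
    show "root t \<noteq> x" using dist that root_in_nodes[of t] by (auto simp del: root_in_nodes)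
  qed
  have xz: "x < z" "x \<noteq> z" using bound by auto
  have yz: "wvar s ''y'' \<noteq> wvar s ''fr''" using lt(1)[of c] y z_def by simp
  have eff: "warr s' ''nx'' = (warr s ''nx'')(z := warr s ''nx'' (root c), root c := z)"
    "warr s' ''dn'' = (warr s ''dn'')(z := 0)"
    "warr s' ''ct'' = (warr s ''ct'')(x := Suc (warr s ''ct'' x), z := 0)"
    "rarr s' ''ky'' = (rarr s ''ky'')(z := rvar s v)"
    "wvar s' ''z'' = z" "wvar s' ''y'' = root c" "wvar s' ''fr'' = Suc z" "rvar s' = rvar s"
    unfolding s'_def add_leaf_def z_def
    using y x by (simp_all add: effect_link[OF yz] key)
  have frame: "tree_frame s s' {x} {root c}"
    unfolding tree_frame_def using eff by (simp flip: z_def)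
  have rep_t: "represents s' t" if t: "t \<in> set (as @ c # bs)" for t
  proof -
    define r where "r = root t"
    have tr: "t = Node r []" using leaf[OF t] r_def by simp
    have "represents s (Node r [])" using rep t unfolding tr represents.simps(1)[of s x] by blast
    moreover have "r < z" "r \<noteq> x" using lt[OF t] r_def by auto
    ultimately show ?thesis using eff unfolding tr by simp
  qed
  have droots: "distinct (map root (as @ c # bs))" using distinct_roots[of "as @ c # bs"] dist by simp
  have "chain (warr s ''nx'') (map root as @ root c # map root bs) 0" using rep by simp
  then have ch: "chain (warr s' ''nx'') (map root as @ root c # z # map root bs) 0"
  proof (rule chain_insert)
    show "distinct (map root as @ root c # map root bs)" using droots by simp
    show "z \<notin> set (map root as @ root c # map root bs)" using lt(1) by force
    show "warr s' ''nx'' a = warr s ''nx'' a" if "a \<in> set (map root as) \<union> set (map root bs)" for a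
    proof -
      have "a \<in> set (map root (as @ c # bs))" using that by auto
      then have "a < z" using lt(1) by (metis image_iff list.set_map)
      moreover have "a \<noteq> root c" using that droots by auto
      ultimately show ?thesis using eff(1) by simp
    qed
    show "warr s' ''nx'' (root c) = z" using eff(1) by simp
    show "warr s' ''nx'' z = warr s ''nx'' (root c)" using eff(1) lt(1)[of c] by simp
  qed
  have "represents s' (Node x (as @ c # Node z [] # bs))"
  proof -
    have "hd (map root (as @ c # Node z [] # bs) @ [0]) = hd (map root (as @ c # bs) @ [0])"
      by (cases as) auto
    moreover have "warr s' ''dn'' x = hd (map root (as @ c # bs) @ [0])"
      "warr s' ''ct'' x = length (as @ c # Node z [] # bs)"
      using eff(2,3) rep xz by auto
    moreover have "chain (warr s' ''nx'') (map root (as @ c # Node z [] # bs)) 0" using ch by simp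
    moreover have "represents s' (Node z [])" using eff xz by simp
    moreover have "rarr s' ''ky'' (root t) = rarr s' ''ky'' (hd (leaves t))"
      if "t \<in> set (as @ c # Node z [] # bs)" for t
    proof -
      have "t = Node (root t) []" using that leaf by auto
      then show ?thesis by (metis leaves.simps list.sel(1))
    qed
    then have "\<forall>t \<in> set (tl (as @ c # Node z [] # bs)). rarr s' ''ky'' (root t) = rarr s' ''ky'' (hd (leaves t))"
      by (metis list.sel(2) list.set_sel(2))
    ultimately show ?thesis unfolding represents.simps using rep_t by auto
  qed
  moreover have zn: "z \<notin> set (nodes (Node x (as @ c # bs)))" using bound by blast
  then have "distinct (nodes (Node x (as @ c # Node z [] # bs)))" using dist by auto
  moreover have nodes: "set (nodes (Node x (as @ c # Node z [] # bs))) = insert z (set (nodes (Node x (as @ c # bs))))"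
    by auto
  moreover have "0 < a \<and> a < Suc z" if "a \<in> insert z (set (nodes (Node x (as @ c # bs))))" for a
    using that bound xz by (auto simp del: nodes.simps intro: less_SucI)
  moreover have "\<forall>t \<in> set (as @ c # Node z [] # bs). balanced 0 t" using bal by auto
  ultimately show "family s' 0 x (as @ c # Node z [] # bs)" unfolding family_def eff(7) by blast
  have "tree_frame s s' (set (nodes (Node x (as @ c # bs)))) (\<Union>t \<in> set (as @ c # bs). set (nodes t))"
    using frame root_in_nodes[of c] unfolding tree_frame_def by auto
  then show "grows s s' x (as @ c # bs) (as @ c # Node z [] # bs)"
    unfolding grows_def nodes eff z_def[symmetric] by auto
  show "wvar s' ''z'' = z" "rarr s' ''ky'' z = rvar s v" "wvar s' ''y'' = root c" "z < wvar s' ''fr''"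
    using eff by simp_all
qed


section \<open>The descent, by induction on the height\<close>

text \<open>Lifts a change below the child \<open>c\<close> to its parent. The stored key of
  \<open>c\<close> is that of its first leaf, so this leaf has to stay the first one; it does, since
  insertion always happens behind an existing leaf.\<close>

lemma grows_child:
  assumes g1: "grows s s1 x ts (as @ c # bs)" and g2: "grows s1 s2 (root c) (kids c) us"
    and fam1: "family s1 (Suc h) x (as @ c # bs)" and fam2: "family s2 h (root c) us"
    and len: "2 \<le> length (kids c)" "length (kids c) \<le> 3"
    and hd: "hd (concat (map leaves us)) = hd (leaves c)"
  shows "family s2 (Suc h) x (as @ Node (root c) us # bs)" "grows s s2 x ts (as @ Node (root c) us # bs)"
proof -
  define c' where "c' = Node (root c) us"
  have c: "Node (root c) (kids c) = c" by simp
  have rep: "represents s1 (Node x (as @ c # bs))" and dist: "distinct (nodes (Node x (as @ c # bs)))"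
    and bound: "\<And>a. a \<in> set (nodes (Node x (as @ c # bs))) \<Longrightarrow> 0 < a \<and> a < wvar s1 ''fr''"
    and bal: "\<forall>t \<in> set (as @ c # bs). balanced (Suc h) t"
    using fam1 by (auto simp: family_def)
  have frame: "tree_frame s1 s2 (set (nodes c)) (\<Union>t \<in> set (kids c). set (nodes t))"
    and nodes: "set (nodes c') \<subseteq> set (nodes c) \<union> {wvar s1 ''fr''..<wvar s2 ''fr''}"
    and lens: "length (kids c) \<le> length us" "length us \<le> Suc (length (kids c))"
    and rv: "rvar s2 = rvar s1"
    using g2 unfolding grows_def c c'_def by auto
  have kc: "(\<Union>t \<in> set (kids c). set (nodes t)) \<subseteq> set (nodes c) - {root c}"
    using set_nodes_kids[of _ c] root_notin_kids[of c] dist by auto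
  have rep2: "represents s2 c'" and dist2: "distinct (nodes c')"
    and bound2: "\<And>a. a \<in> set (nodes c') \<Longrightarrow> 0 < a \<and> a < wvar s2 ''fr''"
    and bal2: "\<forall>t \<in> set us. balanced h t"
    using fam2 by (auto simp: family_def c'_def simp del: nodes.simps)
  have fr: "wvar s1 ''fr'' \<le> wvar s2 ''fr''" using frame by (simp add: tree_frame_def)
  have disj: "set (nodes t) \<inter> set (nodes c) = {}" if "t \<in> set as \<union> set bs" for t
    using that dist by auto
  have in_x: "set (nodes t) \<subseteq> set (nodes (Node x (as @ c # bs)))" if "t \<in> set (as @ c # bs)" for t
    using that by auto
  have xc: "x \<notin> set (nodes c)" using dist by simp
  have xb: "x < wvar s1 ''fr''" using bound by simp
  have rep_t: "represents s2 t" if t: "t \<in> set as \<union> set bs" for t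
  proof (rule represents_frame[OF frame])
    show "represents s1 t" using rep t unfolding represents.simps(1)[of s1 x] by auto
    show "distinct (nodes t)" using dist t by (auto dest: split_list)
    show "\<forall>a \<in> set (nodes t). a < wvar s1 ''fr''" using bound in_x[of t] t by (auto simp del: nodes.simps)
    show "set (nodes t) \<inter> set (nodes c) = {}" using disj[OF t] .
    then show "set (nodes t) \<inter> (\<Union>t \<in> set (kids c). set (nodes t)) \<subseteq> {root t}" using kc by blast
  qed
  have same: "rarr s2 ''ky'' a = rarr s1 ''ky'' a" if "a \<in> set (nodes (Node x (as @ c # bs)))" for a
    using frame bound[OF that] by (simp add: tree_frame_def)
  have roots: "map root (as @ c' # bs) = map root (as @ c # bs)" by (simp add: c'_def)
  have nxr: "warr s2 ''nx'' a = warr s1 ''nx'' a" if "a \<in> set (map root (as @ c # bs))" for a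
  proof -
    obtain t where t: "t \<in> set (as @ c # bs)" "a = root t" using \<open>a \<in> _\<close> by auto
    then have a: "a \<in> set (nodes t)" using root_in_nodes by simp
    then have "a < wvar s1 ''fr''" using bound in_x[OF t(1)] by blast
    moreover have "a \<notin> (\<Union>t \<in> set (kids c). set (nodes t))"
    proof (cases "t = c")
      case False
      then have "t \<in> set as \<union> set bs" using t by auto
      from disj[OF this] a kc show ?thesis by blast
    qed (use t kc in blast)
    ultimately show ?thesis using frame by (simp add: tree_frame_def)
  qed
  have us: "us \<noteq> []" using lens len by auto
  have kyr: "rarr s2 ''ky'' (root t) = rarr s2 ''ky'' (hd (leaves t))" if t: "t \<in> set (tl (as @ c' # bs))" for t
  proof -
    have *: "rarr s2 ''ky'' (root t) = rarr s2 ''ky'' (hd (leaves t))" if "t \<in> set (tl (as @ c # bs))" for t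
    proof -
      have "t \<in> set (as @ c # bs)" using that by (metis list.sel(2) list.set_sel(2))
      then have "root t \<in> set (nodes (Node x (as @ c # bs)))" "hd (leaves t) \<in> set (nodes (Node x (as @ c # bs)))"
        using in_x[of t] root_in_nodes[of t] hd_leaves_in_nodes[of t] by blast+
      then show ?thesis using that rep same unfolding represents.simps(1)[of s1 x] by simp
    qed
    consider "t = c'" "c \<in> set (tl (as @ c # bs))" | "t \<in> set (tl (as @ c # bs))"
      using t by (cases as) auto
    then show ?thesis using * hd us by cases (auto simp: c'_def)
  qed
  have "represents s2 (Node x (as @ c' # bs))"
  proof -
    have "warr s2 ''dn'' x = hd (map root (as @ c' # bs) @ [0])"
      using frame xb rep unfolding roots represents.simps(1)[of s1 x] by (simp add: tree_frame_def)
    moreover have "warr s2 ''ct'' x = length (as @ c' # bs)"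
      using frame xb xc rep by (simp add: tree_frame_def)
    moreover have "chain (warr s2 ''nx'') (map root (as @ c' # bs)) 0"
      using rep chain_cong[of "map root (as @ c # bs)" "warr s2 ''nx''" "warr s1 ''nx''" 0, OF nxr] unfolding roots represents.simps(1)[of s1 x] by blast
    moreover have "\<forall>t \<in> set (as @ c' # bs). represents s2 t" using rep_t rep2 by auto
    ultimately show ?thesis unfolding represents.simps(1)[of s2 x] using kyr by blast
  qed
  moreover have new: "set (nodes (Node x (as @ c' # bs)))
      \<subseteq> set (nodes (Node x (as @ c # bs))) \<union> {wvar s1 ''fr''..<wvar s2 ''fr''}"
    using nodes by auto
  moreover have "distinct (nodes (Node x (as @ c' # bs)))"
  proof -
    have out: "a \<notin> set (nodes c')" if "a \<in> set (nodes (Node x (as @ bs)))" for a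
    proof
      assume "a \<in> set (nodes c')"
      moreover have "a < wvar s1 ''fr''" "a \<notin> set (nodes c)" using that bound dist by auto
      ultimately show False using nodes by auto
    qed
    then show ?thesis using dist dist2 by auto
  qed
  moreover have "0 < a \<and> a < wvar s2 ''fr''" if "a \<in> set (nodes (Node x (as @ c' # bs)))" for a
  proof -
    from subsetD[OF new that] consider "a \<in> set (nodes (Node x (as @ c # bs)))"
      | "wvar s1 ''fr'' \<le> a" "a < wvar s2 ''fr''" by (auto simp del: nodes.simps)
    then show ?thesis
    proof cases
      case 1
      then show ?thesis using bound[OF 1] fr by simp
    qed (use xb in simp)
  qed
  moreover have "\<forall>t \<in> set (as @ c' # bs). balanced (Suc h) t"
    using bal bal2 lens len by (auto simp: c'_def)
  ultimately show "family s2 (Suc h) x (as @ Node (root c) us # bs)"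
    unfolding family_def c'_def by blast
  have fr0: "wvar s ''fr'' \<le> wvar s1 ''fr''"
    and nodes1: "set (nodes (Node x (as @ c # bs))) \<subseteq> set (nodes (Node x ts)) \<union> {wvar s ''fr''..<wvar s1 ''fr''}"
    and f1: "tree_frame s s1 (set (nodes (Node x ts))) (\<Union>t \<in> set ts. set (nodes t))"
    using g1 by (auto simp: grows_def tree_frame_def simp del: nodes.simps)
  have "tree_frame s s2 (set (nodes (Node x ts))) (\<Union>t \<in> set ts. set (nodes t))"
  proof (rule tree_frame_trans[OF f1 frame], intro allI impI)
    fix a assume a: "a < wvar s ''fr''"
    have "a \<in> (\<Union>t \<in> set ts. set (nodes t))" if "a \<in> set (nodes c)"
    proof -
      have "a \<in> set (nodes (Node x ts))" using that in_x[of c] nodes1 a by auto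
      moreover have "a \<noteq> x" using xc that by auto
      ultimately show ?thesis by simp
    qed
    then show "(a \<in> set (nodes (Node x ts)) \<union> set (nodes c) \<longrightarrow> a \<in> set (nodes (Node x ts))) \<and>
      (a \<in> (\<Union>t \<in> set ts. set (nodes t)) \<union> (\<Union>t \<in> set (kids c). set (nodes t)) \<longrightarrow>
       a \<in> (\<Union>t \<in> set ts. set (nodes t)))"
      using kc by auto
  qed
  moreover have "set (nodes (Node x (as @ c' # bs))) \<subseteq> set (nodes (Node x ts)) \<union> {wvar s ''fr''..<wvar s2 ''fr''}"
  proof
    fix a assume "a \<in> set (nodes (Node x (as @ c' # bs)))"
    from subsetD[OF new this] consider "a \<in> set (nodes (Node x (as @ c # bs)))"
      | "wvar s1 ''fr'' \<le> a" "a < wvar s2 ''fr''" by (auto simp del: nodes.simps)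
    then show "a \<in> set (nodes (Node x ts)) \<union> {wvar s ''fr''..<wvar s2 ''fr''}"
    proof cases
      case 1
      then show ?thesis using subsetD[OF nodes1 1] fr by (auto simp del: nodes.simps)
    qed (use fr0 in simp)
  qed
  ultimately show "grows s s2 x ts (as @ Node (root c) us # bs)"
    using g1 rv unfolding grows_def c'_def by auto
qed

text \<open>Unrolls a loop that heads a sequence, so that the induction in
  \<open>runs_descend\<close> can treat the loop together with the program following it.\<close>

lemma runs_Seq_While_True:
  assumes "bval b s" "runs c s (\<lambda>n s1. runs (Seq (While b c) d) s1 (\<lambda>m. Q (bcost b + n + m)))"
  shows "runs (Seq (While b c) d) s Q"
proof -
  obtain n s1 k s' where *: "exec c s n s1" "exec (Seq (While b c) d) s1 k s'" "Q (bcost b + n + k) s'"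
    using assms(2) unfolding runs_def by blast
  from *(2) obtain m l s2 where **: "exec (While b c) s1 m s2" "exec d s2 l s'" "k = m + l"
    by (auto elim: exec_SeqE)
  have "exec (Seq (While b c) d) s (bcost b + n + m + l) s'"
    using exec.Seq[OF exec.WhileTrue[OF assms(1) *(1) **(1)] **(2)] .
  with *(3) **(3) show ?thesis unfolding runs_def by (metis add.assoc)
qed

lemma grows_cong:
  assumes "wvar s1 ''fr'' = wvar s ''fr''" "warr s1 = warr s" "rarr s1 = rarr s" "rvar s1 = rvar s"
    and "wvar s2' ''fr'' = wvar s2 ''fr''" "warr s2' = warr s2" "rarr s2' = rarr s2" "rvar s2' = rvar s2"
  shows "grows s1 s2 x ts us \<Longrightarrow> grows s s2' x ts us"
  using assms unfolding grows_def tree_frame_def by simp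

lemma family_child:
  assumes "family s (Suc h) x (as @ c # bs)"
  shows "family s h (root c) (kids c)"
proof -
  have c: "Node (root c) (kids c) = c" by simp
  have "balanced (Suc h) c" using assms by (simp add: family_def)
  then have "\<forall>t \<in> set (kids c). balanced h t" by (cases c) auto
  then show ?thesis using assms unfolding family_def c by (auto simp del: nodes.simps) auto
qed

text \<open>The final scan and the leaf insertion are part of the program on which the induction
  runs. The induction hypothesis then returns the subtree with the new leaf already in it, and no
  path from the root has to be described. The head of \<open>us\<close> is the first leaf below
  \<open>x\<close>, whose key the search never reads.\<close>

lemma runs_descend:
  assumes "is_test tst P (rvar s)" "family s h x ts" "ts \<noteq> []" "length ts \<le> 3" "wvar s ''x'' = x"
    and "concat (map leaves ts) = us @ vs" "us \<noteq> []"
    and "\<forall>u \<in> set (tl us). P (rarr s ''ky'' u)" "\<forall>w \<in> set vs. \<not> P (rarr s ''ky'' w)"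
  shows "runs (Seq (descend tst) (Seq (scan tst) (add_leaf (RVar v)))) s
    (\<lambda>n s'. \<exists>ts'. family s' h x ts' \<and> grows s s' x ts ts' \<and>
      concat (map leaves ts') = us @ wvar s' ''z'' # vs \<and> wvar s' ''y'' = last us \<and>
      wvar s ''fr'' \<le> wvar s' ''z'' \<and> wvar s' ''z'' < wvar s' ''fr'' \<and>
      rarr s' ''ky'' (wvar s' ''z'') = rvar s v \<and> n \<le> 200 * (h + 1))"
  using assms
proof (induction h arbitrary: s x ts us vs)
  case 0
  have rep: "represents s (Node x ts)" using 0 by (simp add: family_def)
  have "warr s ''dn'' (warr s ''dn'' x) = 0"
  proof -
    obtain t us where ts: "ts = t # us" using 0 by (cases ts) auto
    have "balanced 0 t" "represents s t" using ts 0 rep by (auto simp: family_def)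
    then show ?thesis using ts rep by (cases t) auto
  qed
  then have cond: "\<not> bval (Not (WEq (WArr ''dn'' (WArr ''dn'' (WVar ''x''))) (WConst 0))) s"
    using 0 by simp
  have cost: "max_cost (add_leaf (RVar v)) \<le> 60" "loop_free (add_leaf (RVar v))"
    by (simp_all add: add_leaf_def link_def)
  show ?case unfolding descend_def
  proof (rule runs_Seq, rule runs_While_False[OF cond], rule runs_Seq,
      rule runs_mono[OF runs_scan[OF 0(1,2,3,5)]], rule runs_loop_free[OF cost(2)], goal_cases)
    case (1 n s1 m)
    then obtain as c bs where ts: "ts = as @ c # bs" and fam: "family s1 0 x ts"
      and loc: "located s1 P as c bs" and s1: "s1 = s\<lparr>wvar := (wvar s)(''y'' := root c)\<rparr>"
      and n: "n \<le> 18 + 18 * length ts" by blast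
    have "concat (map leaves (as @ c # bs)) = us @ vs" using 0 ts by simp
    then obtain us' vs' where us: "us = concat (map leaves as) @ us'" "leaves c = us' @ vs'"
      "vs = vs' @ concat (map leaves bs)" "us' \<noteq> []"
      by (rule located_leaves[OF fam[unfolded ts] loc]) (use 0 s1 in auto)
    \<comment> \<open>At height 0 the child found is itself a leaf, so the threshold lies directly
      behind it.\<close>
    have "balanced 0 c" using fam ts by (simp add: family_def)
    then have "leaves c = [root c]" by (cases c) simp
    with us have us': "us' = [root c]" "vs' = []" by (cases us'; auto)+
    have y: "wvar s1 ''y'' = root c" "wvar s1 ''x'' = x" using s1 0 by auto
    note leaf = add_leaf_family[OF fam[unfolded ts] y, of "RVar v" v]
    have "grows s (effect (add_leaf (RVar v)) s1) x ts (as @ c # Node (wvar s1 ''fr'') [] # bs)"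
      by (rule grows_cong[OF _ _ _ _ _ _ _ _ leaf(2)[folded ts]]) (use s1 in auto)
    then show ?case using leaf us us' 1 n 0(4) cost(1) s1
      by (intro exI[of _ "as @ c # Node (wvar s1 ''fr'') [] # bs"]) auto
  qed
next
  case (Suc h)
  have rep: "represents s (Node x ts)" using Suc by (simp add: family_def)
  have bd: "\<And>a. a \<in> set (nodes (Node x ts)) \<Longrightarrow> 0 < a \<and> a < wvar s ''fr''"
    using Suc.prems(2) by (auto simp: family_def)
  have "warr s ''dn'' (warr s ''dn'' x) \<noteq> 0"
  proof -
    obtain t us where ts: "ts = t # us" using Suc by (cases ts) auto
    have "balanced (Suc h) t" "represents s t" using ts Suc.prems rep by (auto simp: family_def)
    then obtain t1 r where t1: "kids t = t1 # r" by (cases t; cases "kids t") auto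
    then have "warr s ''dn'' (root t) = root t1" using \<open>represents s t\<close> by (cases t) auto
    moreover have "root t1 \<in> set (nodes (Node x ts))"
      using ts t1 root_in_nodes[of t1] by (cases t) (auto simp del: root_in_nodes)
    ultimately show ?thesis using ts rep bd by fastforce
  qed
  then have cond: "bval (Not (WEq (WArr ''dn'' (WArr ''dn'' (WVar ''x''))) (WConst 0))) s"
    using Suc by simp
  show ?case unfolding descend_def
  proof (rule runs_Seq_While_True[OF cond], rule runs_Seq, rule runs_mono[OF runs_scan[OF Suc.prems(1,2,3,5)]],
      rule runs_Seq, goal_cases)
    case (1 n s1)
    then obtain as c bs where ts: "ts = as @ c # bs" and fam: "family s1 (Suc h) x ts"
      and loc: "located s1 P as c bs" and s1: "s1 = s\<lparr>wvar := (wvar s)(''y'' := root c)\<rparr>"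
      and n: "n \<le> 18 + 18 * length ts" by blast
    have tst1: "is_test tst P (rvar s1)" and x1: "wvar s1 ''x'' = x" using Suc s1 by auto
    show ?case
    proof (rule runs_mono[OF runs_split[OF tst1 fam[unfolded ts] loc x1]], rule runs_loop_free, simp, goal_cases)
      case (1 m s2 k)
      then obtain as' c' bs' where fam2: "family s2 (Suc h) x (as' @ c' # bs')"
        and loc2: "located s2 P as' c' bs'" and len: "length (kids c') \<le> 3" "kids c' \<noteq> []"
        and leaves2: "concat (map leaves (as' @ c' # bs')) = concat (map leaves (as @ c # bs))"
        and g: "grows s1 s2 x (as @ c # bs) (as' @ c' # bs')" and x2: "wvar s2 ''x'' = x" and m: "m \<le> 60"
        by blast
      define s3 where "s3 = effect (WAssign ''x'' (WVar ''y'')) s2"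
      have s3: "s3 = s2\<lparr>wvar := (wvar s2)(''x'' := root c')\<rparr>" using loc2 by (simp add: s3_def located_def)
      have g3: "grows s s3 x ts (as' @ c' # bs')"
        by (rule grows_cong[OF _ _ _ _ _ _ _ _ g[folded ts]]) (use s1 s3 in auto)
      have fam3: "family s3 (Suc h) x (as' @ c' # bs')" using fam2 family_cong[of s3 s2] s3 by simp
      have ky: "rarr s2 ''ky'' u = rarr s ''ky'' u" if "u \<in> set (us @ vs)" for u
      proof -
        have "u \<in> set (concat (map leaves ts))" using that Suc.prems(6) by simp
        then have "u \<in> set (nodes (Node x ts))" using leaves_subset_nodes by fastforce
        then have "u < wvar s1 ''fr''" using bd s1 by simp
        then show ?thesis using g s1 by (simp add: grows_def tree_frame_def)
      qed
      have "concat (map leaves (as' @ c' # bs')) = us @ vs" using Suc.prems(6) leaves2 ts by simp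
      then obtain us' vs' where us: "us = concat (map leaves as') @ us'" "leaves c' = us' @ vs'"
        "vs = vs' @ concat (map leaves bs')" "us' \<noteq> []"
      proof (rule located_leaves[OF fam2 loc2])
        show "us \<noteq> []" by fact
        show "\<forall>u \<in> set (tl us). P (rarr s2 ''ky'' u)" "\<forall>v \<in> set vs. \<not> P (rarr s2 ''ky'' v)"
          using Suc.prems(8,9) ky list.set_sel(2)[OF Suc.prems(7)] by auto
      qed blast
      have lc: "concat (map leaves (kids c')) = us' @ vs'" using us(2) len by (cases c') auto
      have tlus: "set (tl us') \<subseteq> set (tl us)" "set vs' \<subseteq> set vs"
        using us by (auto simp: tl_append split: list.splits dest: list.set_sel(2)[OF us(4)])
      have r3: "rvar s3 = rvar s" using g3 by (simp add: grows_def)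
      have bal: "2 \<le> length (kids c')"
      proof -
        have "balanced (Suc h) c'" using fam2 by (simp add: family_def)
        then show ?thesis by (cases c') auto
      qed
      have "runs (Seq (descend tst) (Seq (scan tst) (add_leaf (RVar v)))) s3
        (\<lambda>n s'. \<exists>ts'. family s' h (root c') ts' \<and> grows s3 s' (root c') (kids c') ts' \<and>
          concat (map leaves ts') = us' @ wvar s' ''z'' # vs' \<and> wvar s' ''y'' = last us' \<and>
          wvar s3 ''fr'' \<le> wvar s' ''z'' \<and> wvar s' ''z'' < wvar s' ''fr'' \<and>
          rarr s' ''ky'' (wvar s' ''z'') = rvar s3 v \<and> n \<le> 200 * (h + 1))"
      proof (rule Suc.IH)
        show "is_test tst P (rvar s3)" using Suc.prems(1) r3 by simp
        show "family s3 h (root c') (kids c')" using family_child[OF fam3] .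
        show "wvar s3 ''x'' = root c'" using s3 by simp
        show "\<forall>u \<in> set (tl us'). P (rarr s3 ''ky'' u)"
        proof
          fix u assume "u \<in> set (tl us')"
          then have "u \<in> set (tl us)" using tlus by auto
          then show "P (rarr s3 ''ky'' u)"
            using Suc.prems(8) ky[of u] s3 list.set_sel(2)[OF Suc.prems(7)] by auto
        qed
        show "\<forall>u \<in> set vs'. \<not> P (rarr s3 ''ky'' u)"
        proof
          fix u assume "u \<in> set vs'"
          then have "u \<in> set vs" using tlus by auto
          then show "\<not> P (rarr s3 ''ky'' u)" using Suc.prems(9) ky[of u] s3 by auto
        qed
      qed (use len lc us in auto)
      then show ?case unfolding s3_def[symmetric] descend_def[symmetric]
      proof (rule runs_mono, goal_cases)
        case step: (1 l s')
        then obtain ts' where ts': "family s' h (root c') ts'" "grows s3 s' (root c') (kids c') ts'"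
          "concat (map leaves ts') = us' @ wvar s' ''z'' # vs'" "wvar s' ''y'' = last us'"
          "wvar s3 ''fr'' \<le> wvar s' ''z''" "wvar s' ''z'' < wvar s' ''fr''"
          "rarr s' ''ky'' (wvar s' ''z'') = rvar s3 v" "l \<le> 200 * (h + 1)" by blast
        have hd: "hd (concat (map leaves ts')) = hd (leaves c')" using ts'(3) us by (simp add: hd_append)
        note child = grows_child[OF g3 ts'(2) fam3 ts'(1) bal len(1) hd]
        have ne: "ts' \<noteq> []" using ts'(3) by auto
        have "concat (map leaves (as' @ Node (root c') ts' # bs')) = us @ wvar s' ''z'' # vs"
          using ts'(3) us ne by simp
        moreover have "wvar s' ''y'' = last us" using ts'(4) us by simp
        moreover have "wvar s ''fr'' \<le> wvar s' ''z''"
          using g3 ts'(5) by (simp add: grows_def tree_frame_def)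
        \<comment> \<open>One level costs 6 for the loop test, at most 72 for scanning at most three
          children, 60 for the split and 2 for the step down.\<close>
        moreover have "bcost (Not (WEq (WArr ''dn'' (WArr ''dn'' (WVar ''x''))) (WConst 0))) + (n + (m + k)) + l
            \<le> 200 * (Suc h + 1)"
          using n m 1(3) ts'(8) Suc.prems(4) by simp
        ultimately show ?case using child ts'(6,7) r3 by auto
      qed
    qed
  qed
qed

section \<open>The sorted list of endpoints\<close>

text \<open>A full root merely becomes the only child of a new root; the first split of the descent
  then divides it. In either case the root is left with at most three children, as
  \<open>runs_descend\<close> requires.\<close>

definition grow_root :: com where
  "grow_root = If (WEq (WArr ''ct'' (WVar ''top'')) (WConst 4))
    (Seq (WAssign ''z'' (WVar ''fr'')) (Seq (WAssign ''fr'' (WSucc (WVar ''fr'')))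
    (Seq (WStore ''dn'' (WVar ''z'') (WVar ''top'')) (Seq (WStore ''ct'' (WVar ''z'') (WConst 1))
    (Seq (WStore ''nx'' (WVar ''top'') (WConst 0)) (WAssign ''top'' (WVar ''z''))))))) Skip"

text \<open>The successor of \<open>y\<close> is read for its back pointer before the forward
  pointer of \<open>y\<close> is overwritten. If \<open>y\<close> is last, the back pointer is
  written at the null address, which no leaf occupies.\<close>

definition attach :: "nat \<Rightarrow> com" where
  "attach side = Seq (WStore ''bn'' (WVar ''z'') (WArr ''bn'' (WVar ''y'')))
    (Seq (WStore ''bp'' (WVar ''z'') (WVar ''y''))
    (Seq (WStore ''bp'' (WArr ''bn'' (WVar ''y'')) (WVar ''z''))
    (Seq (WStore ''bn'' (WVar ''y'') (WVar ''z''))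
    (Seq (WStore ''iv'' (WVar ''z'') (WVar ''n''))
     (WStore ''sd'' (WVar ''z'') (WConst side))))))"

definition insert_leaf :: "(wexp \<Rightarrow> bexp) \<Rightarrow> vname \<Rightarrow> nat \<Rightarrow> com" where
  "insert_leaf tst v side = Seq grow_root (Seq (WAssign ''x'' (WVar ''top''))
    (Seq (Seq (descend tst) (Seq (scan tst) (add_leaf (RVar v)))) (attach side)))"

text \<open>
  Leaf 1 is a sentinel preceding all keys.  Besides the search tree, the leaves carry a doubly
  linked list (\<open>bn\<close>, \<open>bp\<close>) that crosses the families of the tree.
\<close>

definition index :: "state \<Rightarrow> nat \<Rightarrow> nat list \<Rightarrow> bool" where
  "index s h es \<longleftrightarrow>
    (\<exists>ts. family s h (wvar s ''top'') ts \<and> ts \<noteq> [] \<and> length ts \<le> 4 \<and> concat (map leaves ts) = 1 # es) \<and>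
    chain (warr s ''bn'') (1 # es) 0 \<and> chain (warr s ''bp'') (rev es) 1"

lemma distinct_leaves: "distinct (nodes t) \<Longrightarrow> distinct (leaves t)"
proof (induction t)
  case (Node a ts)
  have "distinct (concat (map nodes ts)) \<Longrightarrow> (\<And>t. t \<in> set ts \<Longrightarrow> distinct (nodes t) \<Longrightarrow> distinct (leaves t)) \<Longrightarrow>
    distinct (concat (map leaves ts))" for ts
  proof (induction ts)
    case (Cons t ts)
    have "set (leaves t) \<inter> (\<Union>u \<in> set ts. set (leaves u)) \<subseteq> set (nodes t) \<inter> (\<Union>u \<in> set ts. set (nodes u))"
      using leaves_subset_nodes by blast
    with Cons show ?case by auto
  qed simp
  with Node show ?case by auto
qed

lemma family_leaves:
  assumes "family s h x ts" "ts \<noteq> []"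
  shows "distinct (concat (map leaves ts))"
    "a \<in> set (concat (map leaves ts)) \<Longrightarrow> 0 < a \<and> a < wvar s ''fr'' \<and> a \<in> set (nodes (Node x ts))"
    "2 ^ h \<le> length (concat (map leaves ts))"
proof -
  have "distinct (leaves (Node x ts))" using assms distinct_leaves[of "Node x ts"] by (simp add: family_def)
  then show "distinct (concat (map leaves ts))" using assms by simp
  show "0 < a \<and> a < wvar s ''fr'' \<and> a \<in> set (nodes (Node x ts))" if "a \<in> set (concat (map leaves ts))"
    using that assms leaves_subset_nodes[of "Node x ts"] by (auto simp: family_def simp del: nodes.simps)
  obtain t us where "ts = t # us" using assms(2) by (cases ts) auto
  then show "2 ^ h \<le> length (concat (map leaves ts))"
    using assms(1) length_leaves[of h t] by (simp add: family_def)
qed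

lemma index_leaves:
  assumes "index s h es"
  shows "distinct (1 # es)" "a \<in> set (1 # es) \<Longrightarrow> 0 < a \<and> a < wvar s ''fr''" "2 ^ h \<le> Suc (length es)"
  using assms family_leaves unfolding index_def by (fastforce, metis, metis length_Cons)

lemma index_cong:
  assumes "wvar s' ''fr'' = wvar s ''fr''" "wvar s' ''top'' = wvar s ''top''" "rarr s' ''ky'' = rarr s ''ky''"
    and "\<And>a. a \<in> {''nx'', ''dn'', ''ct'', ''bn'', ''bp''} \<Longrightarrow> warr s' a = warr s a"
  shows "index s h es \<Longrightarrow> index s' h es"
proof -
  have "represents s t \<Longrightarrow> represents s' t" for t by (rule represents_cong) (use assms in auto)
  then have "family s h x ts \<Longrightarrow> family s' h x ts" for x ts unfolding family_def assms(1) by blast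
  then show "index s h es \<Longrightarrow> index s' h es" using assms unfolding index_def by auto
qed

lemma runs_grow_root:
  assumes "index s h es"
  shows "runs grow_root s (\<lambda>n s'. \<exists>h' ts. h' \<le> Suc h \<and> family s' h' (wvar s' ''top'') ts \<and> ts \<noteq> [] \<and>
    length ts \<le> 3 \<and> concat (map leaves ts) = 1 # es \<and> wvar s ''fr'' \<le> wvar s' ''fr'' \<and>
    (\<forall>a < wvar s ''fr''. rarr s' ''ky'' a = rarr s ''ky'' a) \<and> n \<le> 40)"
proof (rule runs_loop_free)
  show "loop_free grow_root" by (simp add: grow_root_def)
  fix n assume "n \<le> max_cost grow_root"
  then have n: "n \<le> 40" by (simp add: grow_root_def)
  define x s' z where "x = wvar s ''top''" and "s' = effect grow_root s" and "z = wvar s ''fr''"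
  obtain ts where fam: "family s h x ts" and ts: "ts \<noteq> []" "length ts \<le> 4" "concat (map leaves ts) = 1 # es"
    using assms unfolding index_def x_def by blast
  have rep: "represents s (Node x ts)" and dist: "distinct (nodes (Node x ts))"
    and bound: "\<And>a. a \<in> set (nodes (Node x ts)) \<Longrightarrow> 0 < a \<and> a < z"
    and bal: "\<forall>t \<in> set ts. balanced h t"
    using fam by (auto simp: family_def z_def)
  have ct: "warr s ''ct'' x = length ts" using rep by simp
  show "\<exists>h' ts. h' \<le> Suc h \<and> family s' h' (wvar s' ''top'') ts \<and> ts \<noteq> [] \<and>
    length ts \<le> 3 \<and> concat (map leaves ts) = 1 # es \<and> wvar s ''fr'' \<le> wvar s' ''fr'' \<and>
    (\<forall>a < wvar s ''fr''. rarr s' ''ky'' a = rarr s ''ky'' a) \<and> n \<le> 40"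
  proof (cases "length ts = 4")
    case False
    then have "s' = s" using ct by (simp add: s'_def grow_root_def x_def)
    then show ?thesis using False ts fam n x_def by (intro exI[of _ h] exI[of _ ts]) auto
  next
    case True
    have xz: "x < z" using bound by simp
    then have eff: "wvar s' ''top'' = z" "wvar s' ''fr'' = Suc z" "rarr s' = rarr s"
      "warr s' ''nx'' = (warr s ''nx'')(x := 0)" "warr s' ''dn'' = (warr s ''dn'')(z := x)"
      "warr s' ''ct'' = (warr s ''ct'')(z := 1)"
      using True ct by (auto simp: s'_def grow_root_def x_def z_def)
    have lt: "a < z" if "a \<in> set (nodes (Node x ts))" for a using bound that by blast
    have "represents s' (Node x ts)"
    proof (rule represents_cong[OF _ _ _ _ rep])
      fix c a assume "c \<in> set (kids (Node x ts))" "a \<in> set (nodes c)"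
      then have "a \<noteq> x" using dist by auto
      then show "warr s' ''nx'' a = warr s ''nx'' a" using eff by simp
    qed (use eff lt in \<open>auto simp del: nodes.simps\<close>)
    then have "represents s' (Node z [Node x ts])" using eff by simp
    moreover have "distinct (nodes (Node z [Node x ts]))" using dist lt by (fastforce simp del: nodes.simps(1)[of x] simp: nodes.simps(1)[of z])
    moreover have "0 < a \<and> a < Suc z" if "a \<in> set (nodes (Node z [Node x ts]))" for a
    proof -
      have "a = z \<or> a \<in> set (nodes (Node x ts))" using that by auto
      then show ?thesis using bound xz by (auto simp del: nodes.simps intro: less_SucI)
    qed
    ultimately have "family s' (Suc h) z [Node x ts]"
      using bal True unfolding family_def eff by simp
    then show ?thesis using eff ts n by (intro exI[of _ "Suc h"] exI[of _ "[Node x ts]"]) (auto simp: z_def)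
  qed
qed

lemma descend_changes:
  "wvars (Seq (descend tst) (Seq (scan tst) (add_leaf (RVar v)))) = {''x'', ''y'', ''z'', ''d'', ''fr''}"
  "warrs (Seq (descend tst) (Seq (scan tst) (add_leaf (RVar v)))) = {''nx'', ''dn'', ''ct''}"
  by (simp_all add: descend_def scan_def split_def split_body_def add_leaf_def link_def insert_commute)

text \<open>The sentinel in front of \<open>us\<close> plays the leaf whose key is never read, so a
  position exists even if all endpoints are rejected. The predecessor \<open>y\<close> delivered by
  the descent is also the place for relinking the doubly linked list.\<close>

lemma runs_insert_leaf:
  assumes ix: "index s h (us @ vs)" and tst: "is_test tst P (rvar s)"
    and us: "\<forall>u \<in> set us. P (rarr s ''ky'' u)" and vs: "\<forall>w \<in> set vs. \<not> P (rarr s ''ky'' w)"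
  shows "runs (insert_leaf tst v side) s (\<lambda>n s'. \<exists>h'. index s' h' (us @ wvar s' ''z'' # vs) \<and>
    wvar s ''fr'' \<le> wvar s' ''z'' \<and> (\<forall>a < wvar s ''fr''. rarr s' ''ky'' a = rarr s ''ky'' a) \<and>
    rarr s' ''ky'' (wvar s' ''z'') = rvar s v \<and>
    warr s' ''iv'' = (warr s ''iv'')(wvar s' ''z'' := wvar s ''n'') \<and>
    warr s' ''sd'' = (warr s ''sd'')(wvar s' ''z'' := side) \<and> n \<le> 200 * h + 500)"
  unfolding insert_leaf_def
proof (rule runs_Seq, rule runs_mono[OF runs_grow_root[OF ix]], rule runs_Seq, rule runs_loop_free, simp,
    rule runs_Seq, goal_cases)
  case (1 n s1 m)
  then obtain h' ts where h': "h' \<le> Suc h" and fam: "family s1 h' (wvar s1 ''top'') ts" "ts \<noteq> []"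
    "length ts \<le> 3" "concat (map leaves ts) = 1 # (us @ vs)" and fr1: "wvar s ''fr'' \<le> wvar s1 ''fr''"
    and ky1: "\<forall>a < wvar s ''fr''. rarr s1 ''ky'' a = rarr s ''ky'' a" and n: "n \<le> 40" by blast
  have u1: "unchanged grow_root s s1" using 1(1) by (rule exec_unchanged)
  define s2 where "s2 = effect (WAssign ''x'' (WVar ''top'')) s1"
  have s2: "s2 = s1\<lparr>wvar := (wvar s1)(''x'' := wvar s1 ''top'')\<rparr>" by (simp add: s2_def)
  have fam2: "family s2 h' (wvar s1 ''top'') ts" using fam(1) family_cong[of s2 s1] s2 by simp
  have rv2: "rvar s2 = rvar s" using u1 s2 by (auto simp: unchanged_def grow_root_def)
  have lt: "a < wvar s ''fr''" if "a \<in> set (1 # us @ vs)" for a using index_leaves(2)[OF ix that] by simp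
  have ky2: "rarr s2 ''ky'' a = rarr s ''ky'' a" if "a < wvar s ''fr''" for a using ky1 s2 that by simp
  have d: "runs (Seq (descend tst) (Seq (scan tst) (add_leaf (RVar v)))) s2
    (\<lambda>n s'. \<exists>ts'. family s' h' (wvar s1 ''top'') ts' \<and> grows s2 s' (wvar s1 ''top'') ts ts' \<and>
      concat (map leaves ts') = (1 # us) @ wvar s' ''z'' # vs \<and> wvar s' ''y'' = last (1 # us) \<and>
      wvar s2 ''fr'' \<le> wvar s' ''z'' \<and> wvar s' ''z'' < wvar s' ''fr'' \<and>
      rarr s' ''ky'' (wvar s' ''z'') = rvar s2 v \<and> n \<le> 200 * (h' + 1))"
  proof (rule runs_descend)
    show "is_test tst P (rvar s2)" using tst rv2 by simp
    show "\<forall>u \<in> set (tl (1 # us)). P (rarr s2 ''ky'' u)" "\<forall>w \<in> set vs. \<not> P (rarr s2 ''ky'' w)"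
      using us vs lt ky2 by auto
  qed (use fam fam2 s2 in auto)
  show ?case unfolding s2_def[symmetric]
  proof (rule runs_mono[OF d], rule runs_loop_free, simp add: attach_def, goal_cases)
    case (1 k s3 l)
    then obtain ts' where fam3: "family s3 h' (wvar s1 ''top'') ts'"
      and g: "grows s2 s3 (wvar s1 ''top'') ts ts'"
      and lv: "concat (map leaves ts') = (1 # us) @ wvar s3 ''z'' # vs"
      and y: "wvar s3 ''y'' = last (1 # us)" and z: "wvar s2 ''fr'' \<le> wvar s3 ''z''"
      and kz: "rarr s3 ''ky'' (wvar s3 ''z'') = rvar s2 v" and k: "k \<le> 200 * (h' + 1)" by blast
    have u3: "unchanged (Seq (descend tst) (Seq (scan tst) (add_leaf (RVar v)))) s2 s3"
      using 1(1) by (rule exec_unchanged)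
    have arr3: "warr s3 a = warr s a" if "a \<in> {''bn'', ''bp'', ''iv'', ''sd''}" for a
    proof -
      have "warr s3 a = warr s2 a"
        by (rule unchangedD(3)[OF u3]) (unfold descend_changes, use that in auto)
      moreover have "warr s1 a = warr s a"
        by (rule unchangedD(3)[OF u1]) (use that in \<open>auto simp: grow_root_def\<close>)
      ultimately show ?thesis using s2 by simp
    qed
    have n3: "wvar s3 ''n'' = wvar s ''n''" "wvar s3 ''top'' = wvar s1 ''top''"
    proof -
      have "wvar s3 ''n'' = wvar s2 ''n''" "wvar s3 ''top'' = wvar s2 ''top''"
        by (rule unchangedD(1)[OF u3], unfold descend_changes, simp)+
      moreover have "wvar s1 ''n'' = wvar s ''n''"
        by (rule unchangedD(1)[OF u1]) (simp add: grow_root_def)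
      ultimately show "wvar s3 ''n'' = wvar s ''n''" "wvar s3 ''top'' = wvar s1 ''top''" using s2 by simp_all
    qed
    define z where "z = wvar s3 ''z''"
    define y where "y = last (1 # us)"
    define s4 where "s4 = effect (attach side) s3"
    have zz: "wvar s ''fr'' \<le> z" using \<open>wvar s2 ''fr'' \<le> wvar s3 ''z''\<close> fr1 s2 by (simp add: z_def)
    have yin: "y \<in> set (1 # us @ vs)" unfolding y_def by auto
    have "y < z" using lt[OF yin] zz by simp
    have bn: "chain (warr s ''bn'') (1 # us @ vs) 0" and bp: "chain (warr s ''bp'') (rev (us @ vs)) 1"
      using ix by (auto simp: index_def)
    have split: "1 # us = butlast (1 # us) @ [y]" unfolding y_def by simp
    then have bn': "chain (warr s ''bn'') (butlast (1 # us) @ y # vs) 0"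
      using bn by (metis append.assoc append_Cons append_Nil)
    then have bny: "warr s ''bn'' y = hd (vs @ [0])" by (simp add: chain_append)
    have s4: "wvar s4 = wvar s3" "rarr s4 = rarr s3" "rvar s4 = rvar s3"
      "warr s4 ''bn'' = (warr s ''bn'')(z := hd (vs @ [0]), y := z)"
      "warr s4 ''bp'' = (warr s ''bp'')(z := y, hd (vs @ [0]) := z)"
      "warr s4 ''iv'' = (warr s ''iv'')(z := wvar s ''n'')"
      "warr s4 ''sd'' = (warr s ''sd'')(z := side)"
      "\<And>a. a \<in> {''nx'', ''dn'', ''ct''} \<Longrightarrow> warr s4 a = warr s3 a"
    proof -
      have a: "warr s3 ''bn'' = warr s ''bn''" "warr s3 ''bp'' = warr s ''bp''"
        "warr s3 ''iv'' = warr s ''iv''" "warr s3 ''sd'' = warr s ''sd''"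
        using arr3 by blast+
      have yz: "wvar s3 ''y'' = y" "wvar s3 ''z'' = z" "y \<noteq> z"
        using \<open>wvar s3 ''y'' = last (1 # us)\<close> \<open>y < z\<close> by (simp_all add: y_def z_def)
      show "wvar s4 = wvar s3" "rarr s4 = rarr s3" "rvar s4 = rvar s3"
        "warr s4 ''bn'' = (warr s ''bn'')(z := hd (vs @ [0]), y := z)"
        "warr s4 ''bp'' = (warr s ''bp'')(z := y, hd (vs @ [0]) := z)"
        "warr s4 ''iv'' = (warr s ''iv'')(z := wvar s ''n'')"
        "warr s4 ''sd'' = (warr s ''sd'')(z := side)"
        unfolding s4_def attach_def by (simp_all add: a yz bny n3)
      show "warr s4 a = warr s3 a" if "a \<in> {''nx'', ''dn'', ''ct''}" for a
        using that unfolding s4_def attach_def by auto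
    qed
    have "family s4 h' (wvar s1 ''top'') ts'"
    proof -
      have "represents s3 t \<Longrightarrow> represents s4 t" for t by (rule represents_cong) (use s4 in auto)
      then show ?thesis using fam3 s4 unfolding family_def by auto
    qed
    moreover have "ts' \<noteq> []" "length ts' \<le> 4" using g fam lv by (auto simp: grows_def)
    moreover have "concat (map leaves ts') = 1 # us @ z # vs" using lv by (simp add: z_def)
    moreover have "chain (warr s4 ''bn'') (1 # us @ z # vs) 0"
    proof -
      have dist: "distinct (1 # us @ vs)" using index_leaves(1)[OF ix] .
      have "chain (warr s4 ''bn'') (butlast (1 # us) @ y # z # vs) 0"
      proof (rule chain_insert[OF bn'])
        show d: "distinct (butlast (1 # us) @ y # vs)"
          using dist split by (metis append.assoc append_Cons append_Nil)
        show "z \<notin> set (butlast (1 # us) @ y # vs)"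
          using lt zz split by (metis append.assoc append_Cons append_Nil leD)
        then show "warr s4 ''bn'' a = warr s ''bn'' a" if "a \<in> set (butlast (1 # us)) \<union> set vs" for a
          using that s4 d by auto
      qed (use s4 bny \<open>y < z\<close> in auto)
      then show ?thesis using split by (metis append.assoc append_Cons append_Nil)
    qed
    moreover have "chain (warr s4 ''bp'') (rev (us @ z # vs)) 1"
    proof -
      have dist: "distinct (us @ vs)" using index_leaves(1)[OF ix] by simp
      have zn: "z \<notin> set (us @ vs)" "0 \<notin> set (us @ vs)"
        using lt[of z] zz index_leaves(2)[OF ix, of 0] by auto
      have yhd: "y = hd (rev us @ [1])" unfolding y_def by (cases us rule: rev_cases) auto
      have c: "chain (warr s ''bp'') (rev vs) y" "chain (warr s ''bp'') (rev us) 1"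
        using bp yhd by (auto simp: chain_append)
      have c1: "chain (warr s4 ''bp'') (rev us) 1"
      proof (subst chain_cong[of _ _ "warr s ''bp''"])
        fix a assume a: "a \<in> set (rev us)"
        have "hd (vs @ [0]) \<in> insert 0 (set vs)" by (cases vs) auto
        then have "a \<noteq> z" "a \<noteq> hd (vs @ [0])" using a zn dist by auto
        then show "warr s4 ''bp'' a = warr s ''bp'' a" using s4 by simp
      qed (rule c(2))
      have c2: "chain (warr s4 ''bp'') (rev vs) z"
      proof (cases vs)
        case (Cons w ws)
        have "chain (warr s4 ''bp'') (rev ws) w = chain (warr s ''bp'') (rev ws) w"
          by (rule chain_cong) (use Cons s4 zn dist in auto)
        then show ?thesis using c(1) Cons s4 zn by (simp add: chain_append)
      qed simp
      have "hd (vs @ [0]) \<noteq> z" using zn \<open>y < z\<close> by (cases vs) auto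
      then have "warr s4 ''bp'' z = y" using s4 by simp
      then show ?thesis using c1 c2 yhd by (simp add: chain_append)
    qed
    ultimately have "index s4 h' (us @ z # vs)"
      unfolding index_def using s4 n3 by auto
    moreover have "\<forall>a < wvar s ''fr''. rarr s4 ''ky'' a = rarr s ''ky'' a"
      using g ky1 s4 s2 fr1 by (auto simp: grows_def tree_frame_def)
    \<comment> \<open>The descent costs 200 per level of a tree of height at most
      \<open>h + 1\<close>, and 200 at the bottom; the remaining 100 cover growing the root and
      relinking.\<close>
    moreover have "n + (m + (k + l)) \<le> 200 * h + 500"
      using n \<open>m \<le> _\<close> k h' 1(3) by (simp add: attach_def)
    moreover have "z = wvar s4 ''z''" using s4 by (simp add: z_def)
    moreover have "rarr s4 ''ky'' z = rvar s v" using kz rv2 s4 by (simp add: z_def)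
    ultimately show ?case unfolding s4_def[symmetric] using zz s4(6,7) by auto
  qed
qed

section \<open>Combinatorics of the KT-SLS coloring\<close>

definition config_of :: "interval list \<Rightarrow> config" where
  "config_of Is = foldl kt_sls_step [] Is"

lemma config_of_snoc:
  "config_of (Is @ [I]) = config_of Is @ [(I, new_level (config_of Is) I, new_offset (config_of Is) I)]"
  by (simp add: config_of_def kt_sls_step_def)

lemma kt_sls_snoc:
  "kt_sls (Is @ [I]) = kt_sls Is @ [(new_level (config_of Is) I, new_offset (config_of Is) I)]"
  using config_of_snoc[of Is I] by (simp add: kt_sls_def config_of_def)

lemma length_kt_sls [simp]: "length (kt_sls Is) = length Is"
proof (induction Is rule: rev_induct)
  case Nil then show ?case by (simp add: kt_sls_def)
qed (simp add: kt_sls_snoc)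

lemma config_of_zip: "config_of Is = zip Is (kt_sls Is)"
proof (induction Is rule: rev_induct)
  case Nil then show ?case by (simp add: config_of_def)
next
  case (snoc I Is)
  then show ?case by (simp add: config_of_snoc kt_sls_snoc)
qed

abbreviation level_of :: "interval list \<Rightarrow> nat \<Rightarrow> nat" where
  "level_of Is j \<equiv> fst (kt_sls Is ! j)"

abbreviation offset_of :: "interval list \<Rightarrow> nat \<Rightarrow> nat" where
  "offset_of Is j \<equiv> snd (kt_sls Is ! j)"

lemma Ball_config_of:
  "(\<forall>x \<in> set (config_of Is). Q x) \<longleftrightarrow> (\<forall>j < length Is. Q (Is ! j, level_of Is j, offset_of Is j))"
proof -
  have "set (config_of Is) = (\<lambda>j. (Is ! j, level_of Is j, offset_of Is j)) ` {..<length Is}"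
    by (auto simp: config_of_zip set_zip)
  then show ?thesis by auto
qed

section \<open>Heights and private points\<close>

definition blocked :: "interval list \<Rightarrow> real \<Rightarrow> nat \<Rightarrow> bool" where
  "blocked Is t h \<longleftrightarrow> (\<exists>j < length Is. t \<in> points (Is ! j) \<and> level_of Is j = h)"

lemma height_config_of: "height (config_of Is) t = (LEAST h. \<not> blocked Is t h)"
  unfolding height_def Ball_config_of blocked_def case_prod_beta
  by (intro arg_cong[where f = Least] ext) auto

text \<open>Pigeonhole on the levels. This bounds all heights, so that the least free level exists
  and the maximum in \<open>new_level\<close> ranges over a finite set, although an interval may
  have infinitely many points.\<close>

lemma ex_not_blocked: "\<exists>h \<le> length Is. \<not> blocked Is t h"
proof (rule ccontr)
  assume "\<not> ?thesis"
  then have "{..length Is} \<subseteq> level_of Is ` {..<length Is}" by (auto simp: blocked_def image_iff)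
  then have "card {..length Is} \<le> card {..<length Is}"
    by (meson card_image_le card_mono finite_imageI finite_lessThan order_trans)
  then show False by simp
qed

lemma height_not_blocked: "\<not> blocked Is t (height (config_of Is) t)"
  unfolding height_config_of using LeastI_ex[of "\<lambda>h. \<not> blocked Is t h"] ex_not_blocked by blast

lemma less_height_blocked: "h < height (config_of Is) t \<Longrightarrow> blocked Is t h"
  unfolding height_config_of by (metis not_less_Least)

lemma height_le: "\<not> blocked Is t h \<Longrightarrow> height (config_of Is) t \<le> h"
  unfolding height_config_of by (rule Least_le)

lemma less_height: "(\<And>h. h \<le> k \<Longrightarrow> blocked Is t h) \<Longrightarrow> k < height (config_of Is) t"
  using height_not_blocked linorder_not_less by blast

lemma finite_heights: "finite (height (config_of Is) ` X)"
proof (rule finite_subset)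
  show "height (config_of Is) ` X \<subseteq> {..length Is}"
    using ex_not_blocked height_le by (meson atMost_iff image_subsetI order_trans)
qed simp

lemma height_le_new_level: "t \<in> points I \<Longrightarrow> height (config_of Is) t \<le> new_level (config_of Is) I"
  unfolding new_level_def by (rule Max_ge) (auto simp: finite_heights)

lemma new_level_attained:
  assumes "is_interval_pair I"
  obtains t where "t \<in> points I" "height (config_of Is) t = new_level (config_of Is) I"
proof -
  have "points I \<noteq> {}" using assms by (auto simp: points_def is_interval_pair_def)
  then have "new_level (config_of Is) I \<in> height (config_of Is) ` points I"
    unfolding new_level_def by (intro Max_in) (auto simp: finite_heights)
  then show ?thesis using that by auto
qed

lemma nth_kt_sls_snoc:
  "j < length Is \<Longrightarrow> kt_sls (Is @ [I]) ! j = kt_sls Is ! j"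
  "kt_sls (Is @ [I]) ! length Is = (new_level (config_of Is) I, new_offset (config_of Is) I)"
  by (simp_all add: kt_sls_snoc nth_append)

lemma blocked_snoc:
  "blocked (Is @ [I]) t h \<longleftrightarrow> blocked Is t h \<or> t \<in> points I \<and> new_level (config_of Is) I = h"
proof -
  have ex: "(\<exists>j < Suc n. Q j) \<longleftrightarrow> (\<exists>j < n. Q j) \<or> Q n" for n and Q :: "nat \<Rightarrow> bool"
    using less_Suc_eq by blast
  show ?thesis
    by (simp add: blocked_def ex nth_kt_sls_snoc nth_append cong: conj_cong)
qed

text \<open>
  A point that blocked all lower levels when the interval arrived.  A later interval of the same
  level cannot contain it, as its height has become too large.
\<close>

definition private_point :: "interval list \<Rightarrow> nat \<Rightarrow> real \<Rightarrow> bool" where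
  "private_point Is j t \<longleftrightarrow> t \<in> points (Is ! j) \<and> (\<forall>h < level_of Is j. blocked Is t h) \<and>
    (\<forall>i < length Is. i \<noteq> j \<and> level_of Is i = level_of Is j \<longrightarrow> t \<notin> points (Is ! i))"

lemma ex_private_point:
  assumes "\<forall>I \<in> set Is. is_interval_pair I" "j < length Is"
  shows "\<exists>t. private_point Is j t"
  using assms
proof (induction Is arbitrary: j rule: rev_induct)
  case (snoc I Is)
  let ?L = "new_level (config_of Is) I"
  show ?case
  proof (cases "j < length Is")
    case True
    then obtain t where t: "private_point Is j t" using snoc by auto
    have "\<not> (t \<in> points I \<and> ?L = level_of Is j)"
    proof
      assume a: "t \<in> points I \<and> ?L = level_of Is j"
      \<comment> \<open>The interval \<open>j\<close> blocks its own level at \<open>t\<close>, and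
        all lower levels are blocked by privacy; so the height at \<open>t\<close> exceeds the level
        of \<open>j\<close>.\<close>
      have "blocked Is t h" if "h \<le> level_of Is j" for h
        using t that True by (cases "h = level_of Is j") (auto simp: private_point_def blocked_def)
      then have "level_of Is j < height (config_of Is) t" by (rule less_height)
      then show False using height_le_new_level[of t I Is] a by simp
    qed
    then have "private_point (Is @ [I]) j t" using t True
      by (auto simp: private_point_def nth_kt_sls_snoc nth_append blocked_snoc less_Suc_eq)
    then show ?thesis by blast
  next
    case False
    then have j: "j = length Is" using snoc.prems by simp
    \<comment> \<open>A point of maximal height serves the new interval: all levels below its height
      are blocked there, and its height itself is not.\<close>
    obtain t where t: "t \<in> points I" "height (config_of Is) t = ?L"
      using new_level_attained snoc.prems by (metis in_set_conv_decomp)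
    have "\<not> blocked Is t ?L" using height_not_blocked[of Is t] t by simp
    then have "private_point (Is @ [I]) j t"
      using t less_height_blocked[of _ Is t] unfolding j private_point_def blocked_snoc
      by (auto simp: nth_kt_sls_snoc nth_append less_Suc_eq blocked_def)
    then show ?thesis by blast
  qed
qed simp

text \<open>Two intersecting intervals have an interval as their union. It contains everything
  between their private points, whereas the private point of \<open>j\<close> lies in neither of
  them.\<close>

lemma private_points_not_between:
  assumes t: "private_point Is i ti" "private_point Is j tj" "private_point Is k tk"
    and "i < length Is" "j < length Is" "k < length Is" "intersects (Is ! i) (Is ! k)"
    and "level_of Is i = level_of Is j" "level_of Is j = level_of Is k"
    and "i \<noteq> j" "j \<noteq> k"
  shows "\<not> (ti < tj \<and> tj < tk)" "\<not> (tk < tj \<and> tj < ti)"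
proof -
  obtain p where p: "p \<in> points (Is ! i)" "p \<in> points (Is ! k)" using assms by (auto simp: intersects_def)
  have "tj \<notin> points (Is ! i)" "tj \<notin> points (Is ! k)" using assms by (auto simp: private_point_def)
  then show "\<not> (ti < tj \<and> tj < tk)" "\<not> (tk < tj \<and> tj < ti)"
    using p t by (auto simp: private_point_def points_def)
qed

text \<open>If two neighbors of the level of \<open>I\<close> had their private points on the same
  side of that of \<open>I\<close>, the nearer point would lie between the other two, against
  \<open>private_points_not_between\<close>. So each side contributes at most one neighbor, and two
  of the three offsets at most are taken. Private points are chosen after the arrival of
  \<open>I\<close>, so that they also avoid \<open>I\<close>.\<close>

lemma ex_free_offset:
  assumes "\<forall>I \<in> set (Is @ [I]). is_interval_pair I"
  shows "\<exists>k \<in> {1, 2, 3}. \<forall>j < length Is. intersects I (Is ! j) \<and>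
    level_of Is j = new_level (config_of Is) I \<longrightarrow> offset_of Is j \<noteq> k"
proof -
  define n where "n = length Is"
  define Js where "Js = Is @ [I]"
  define N where "N = {j. j < n \<and> intersects I (Is ! j) \<and> level_of Is j = new_level (config_of Is) I}"
  have "\<forall>j. \<exists>t. j < length Js \<longrightarrow> private_point Js j t" using ex_private_point assms Js_def by blast
  then obtain p where p: "\<And>j. j < length Js \<Longrightarrow> private_point Js j (p j)" by metis
  have N: "j < length Js" "j \<noteq> n" "level_of Js j = level_of Js n" "intersects (Js ! j) (Js ! n)" if "j \<in> N" for j
    using that by (auto simp: N_def Js_def n_def nth_append nth_kt_sls_snoc intersects_def)
  have n: "n < length Js" by (simp add: Js_def n_def)
  have sides: "i = j" if ij: "i \<in> N" "j \<in> N" and side: "p i < p n \<and> p j < p n \<or> p n < p i \<and> p n < p j" for i j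
  proof (rule ccontr)
    assume ne: "i \<noteq> j"
    have "p i \<noteq> p j"
    proof
      assume "p i = p j"
      then show False using p[of i] p[of j] N[OF ij(1)] N[OF ij(2)] ne by (auto simp: private_point_def)
    qed
    note Ni = N[OF ij(1)] and Nj = N[OF ij(2)]
    have "\<not> (p i < p j \<and> p j < p n)" "\<not> (p n < p j \<and> p j < p i)"
      using private_points_not_between[OF p[OF Ni(1)] p[OF Nj(1)] p[OF n] Ni(1) Nj(1) n Ni(4) _ Nj(3) ne Nj(2)]
        Ni(3) Nj(3) by auto
    moreover have "\<not> (p j < p i \<and> p i < p n)" "\<not> (p n < p i \<and> p i < p j)"
      using private_points_not_between[OF p[OF Nj(1)] p[OF Ni(1)] p[OF n] Nj(1) Ni(1) n Nj(4) _ Ni(3) ne[symmetric] Ni(2)]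
        Ni(3) Nj(3) by auto
    ultimately show False using \<open>p i \<noteq> p j\<close> side by linarith
  qed
  have "p j \<noteq> p n" if "j \<in> N" for j
    using p[of j] p[of n] N[OF that] n by (auto simp: private_point_def)
  then have "N \<subseteq> {j \<in> N. p j < p n} \<union> {j \<in> N. p n < p j}" by fastforce
  moreover have "card {j \<in> N. p j < p n} \<le> 1" "card {j \<in> N. p n < p j} \<le> 1"
    using sides by (auto simp: card_le_Suc0_iff_eq N_def)
  moreover have "finite N" by (simp add: N_def)
  ultimately have "card N \<le> card ({j \<in> N. p j < p n} \<union> {j \<in> N. p n < p j})"
    "card {j \<in> N. p j < p n} + card {j \<in> N. p n < p j} \<le> 2"
    by (intro card_mono, simp_all)
  then have "card N \<le> 2"
    using card_Un_le[of "{j \<in> N. p j < p n}" "{j \<in> N. p n < p j}"] by linarith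
  moreover have "card (offset_of Is ` N) \<le> card N" using \<open>finite N\<close> by (rule card_image_le)
  ultimately have "card (offset_of Is ` N) \<le> 2" by simp
  moreover have "card {1, 2, 3 :: nat} = 3" by simp
  ultimately have "\<not> {1, 2, 3} \<subseteq> offset_of Is ` N"
    using card_mono[OF finite_imageI[OF \<open>finite N\<close>], of "{1, 2, 3}" "offset_of Is"] by linarith
  then obtain k where "k \<in> {1, 2, 3}" "k \<notin> offset_of Is ` N" by blast
  then show ?thesis unfolding N_def n_def by (intro bexI[of _ k]) blast+
qed

section \<open>Properness and the number of colors\<close>

lemma new_offset:
  assumes "\<forall>I \<in> set (Is @ [I]). is_interval_pair I"
  shows "new_offset (config_of Is) I \<in> {1, 2, 3}"
    and "\<And>j. j < length Is \<Longrightarrow> intersects I (Is ! j) \<Longrightarrow> level_of Is j = new_level (config_of Is) I \<Longrightarrow>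
      offset_of Is j \<noteq> new_offset (config_of Is) I"
proof -
  have eq: "new_offset (config_of Is) I = (LEAST k. k \<in> {1, 2, 3} \<and> (\<forall>j < length Is.
      intersects I (Is ! j) \<and> level_of Is j = new_level (config_of Is) I \<longrightarrow> offset_of Is j \<noteq> k))"
    unfolding new_offset_def Ball_config_of case_prod_beta by simp
  have "\<exists>k. k \<in> {1, 2, 3} \<and> (\<forall>j < length Is.
      intersects I (Is ! j) \<and> level_of Is j = new_level (config_of Is) I \<longrightarrow> offset_of Is j \<noteq> k)"
    using ex_free_offset[OF assms] by blast
  from LeastI_ex[OF this, folded eq]
  show "new_offset (config_of Is) I \<in> {1, 2, 3}"
    and "\<And>j. j < length Is \<Longrightarrow> intersects I (Is ! j) \<Longrightarrow> level_of Is j = new_level (config_of Is) I \<Longrightarrow>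
      offset_of Is j \<noteq> new_offset (config_of Is) I"
    by blast+
qed

lemma kt_sls_proper:
  assumes "\<forall>I \<in> set Is. is_interval_pair I" "i < length Is" "j < length Is" "i \<noteq> j"
    "intersects (Is ! i) (Is ! j)"
  shows "kt_sls Is ! i \<noteq> kt_sls Is ! j"
  using assms
proof (induction Is arbitrary: i j rule: rev_induct)
  case (snoc I Is)
  have sym: "intersects J K \<longleftrightarrow> intersects K J" for J K
    by (simp add: intersects_def Int_commute)
  have new: "kt_sls (Is @ [I]) ! j \<noteq> kt_sls (Is @ [I]) ! length Is" if "j < length Is" "intersects I (Is ! j)" for j
    using new_offset(2)[OF snoc.prems(1) that] that by (auto simp: nth_kt_sls_snoc prod_eq_iff)
  consider "i < length Is" "j < length Is" | "i < length Is" "j = length Is" | "j < length Is" "i = length Is"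
    using snoc.prems(2-4) by (auto simp: less_Suc_eq)
  then show ?case
  proof cases
    case 1
    then show ?thesis
      using snoc.IH[of i j] snoc.prems by (simp add: nth_kt_sls_snoc nth_append)
  next
    case 2
    then have "intersects I (Is ! i)" using snoc.prems(5) sym[of I] by (simp add: nth_append)
    then show ?thesis using new[OF 2(1)] 2 by simp
  next
    case 3
    then have "intersects I (Is ! j)" using snoc.prems(5) by (simp add: nth_append)
    then show ?thesis using new[OF 3(1)] 3 by simp
  qed
qed simp

text \<open>An interval of level 0 has height 0 at all its points, so it meets no earlier interval
  of level 0 and gets the smallest offset. This is where 3 \<omega> drops to 3 \<omega> - 2.\<close>

lemma level_0_offset:
  assumes "\<forall>I \<in> set Is. is_interval_pair I" "j < length Is" "level_of Is j = 0"
  shows "offset_of Is j = 1"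
  using assms
proof (induction Is arbitrary: j rule: rev_induct)
  case (snoc I Is)
  show ?case
  proof (cases "j < length Is")
    case True
    then show ?thesis using snoc.IH[of j] snoc.prems by (simp add: nth_kt_sls_snoc)
  next
    case False
    then have j: "j = length Is" using snoc.prems by simp
    then have L: "new_level (config_of Is) I = 0" using snoc.prems by (simp add: nth_kt_sls_snoc)
    have nz: "\<not> (intersects I (Is ! i) \<and> level_of Is i = 0)" if "i < length Is" for i
    proof
      assume a: "intersects I (Is ! i) \<and> level_of Is i = 0"
      then obtain t where "t \<in> points I" "t \<in> points (Is ! i)" by (auto simp: intersects_def)
      then show False using height_le_new_level[of t I Is] height_not_blocked[of Is t] L a that
        unfolding blocked_def by fastforce
    qed
    have "new_offset (config_of Is) I = (LEAST k. k \<in> {1, 2, 3 :: nat})"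
    proof -
      have "(\<forall>i < length Is. intersects I (Is ! i) \<and> level_of Is i = 0 \<longrightarrow> offset_of Is i \<noteq> k) = True" for k
        using nz by blast
      then show ?thesis unfolding new_offset_def Ball_config_of L case_prod_beta by simp
    qed
    also have "\<dots> = 1" by (rule Least_equality) auto
    finally show ?thesis unfolding j by (simp add: nth_kt_sls_snoc)
  qed
qed simp

lemma offset_range:
  assumes "\<forall>I \<in> set Is. is_interval_pair I" "j < length Is"
  shows "offset_of Is j \<in> {1, 2, 3}"
  using assms
proof (induction Is arbitrary: j rule: rev_induct)
  case (snoc I Is)
  show ?case
  proof (cases "j < length Is")
    case True
    then have "offset_of Is j \<in> {1, 2, 3}" using snoc.IH[of j] snoc.prems(1) by simp
    then show ?thesis using True by (simp add: nth_kt_sls_snoc)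
  next
    case False
    then have "j = length Is" using snoc.prems by simp
    then show ?thesis using new_offset(1)[OF snoc.prems(1)] by (simp add: nth_kt_sls_snoc)
  qed
qed simp

text \<open>A common point makes the intervals pairwise intersecting. Lower bounds on the clique
  number are always obtained from a single point here.\<close>

lemma card_le_clique_number:
  assumes "K \<subseteq> {..<length Is}" "t \<in> (\<Inter>i \<in> K. points (Is ! i))"
  shows "card K \<le> clique_number Is"
  unfolding clique_number_def
proof (rule Max_ge)
  show "finite {card K |K. K \<subseteq> ivl_vertices Is \<and> clique K (ivl_edges Is)}"
    by (rule finite_subset[of _ "card ` Pow (ivl_vertices Is)"]) (auto simp: ivl_vertices_def)
  have "clique K (ivl_edges Is)"
    using assms by (fastforce simp: clique_def ivl_edges_def ivl_vertices_def intersects_def)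
  then show "card K \<in> {card K |K. K \<subseteq> ivl_vertices Is \<and> clique K (ivl_edges Is)}"
    using assms(1) by (auto simp: ivl_vertices_def)
qed

lemma level_less_clique_number:
  assumes "\<forall>I \<in> set Is. is_interval_pair I" "j < length Is"
  shows "level_of Is j < clique_number Is"
proof -
  obtain t where t: "private_point Is j t" using ex_private_point[OF assms] by blast
  have "\<forall>h. \<exists>i. h \<le> level_of Is j \<longrightarrow> i < length Is \<and> t \<in> points (Is ! i) \<and> level_of Is i = h"
  proof
    fix h
    show "\<exists>i. h \<le> level_of Is j \<longrightarrow> i < length Is \<and> t \<in> points (Is ! i) \<and> level_of Is i = h"
      using t assms(2) by (cases "h = level_of Is j") (auto simp: private_point_def blocked_def)
  qed
  then obtain f where f: "\<And>h. h \<le> level_of Is j \<Longrightarrow> f h < length Is \<and> t \<in> points (Is ! f h) \<and> level_of Is (f h) = h"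
    by metis
  have "inj_on f {..level_of Is j}" using f by (metis atMost_iff inj_onI)
  then have "card (f ` {..level_of Is j}) = Suc (level_of Is j)" by (simp add: card_image)
  moreover have "card (f ` {..level_of Is j}) \<le> clique_number Is"
    by (rule card_le_clique_number[where t = t]) (use f in auto)
  ultimately show ?thesis by simp
qed

lemma card_colors:
  assumes "\<forall>I \<in> set Is. is_interval_pair I" "Is \<noteq> []"
  shows "card ((!) (kt_sls Is) ` {..<length Is}) \<le> 3 * clique_number Is - 2"
proof -
  define w where "w = clique_number Is"
  have w: "0 < w" using level_less_clique_number[OF assms(1), of 0] assms(2) by (simp add: w_def)
  \<comment> \<open>One color on level 0 and three on each of the levels 1 to \<open>w - 1\<close>
    give \<open>1 + 3 (w - 1)\<close> colors.\<close>
  have sub: "(!) (kt_sls Is) ` {..<length Is} \<subseteq> insert (0, 1) ({1..<w} \<times> {1, 2, 3})"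
  proof
    fix c assume "c \<in> (!) (kt_sls Is) ` {..<length Is}"
    then obtain j where j: "j < length Is" "c = kt_sls Is ! j" by auto
    have *: "fst c < w" "snd c \<in> {1, 2, 3}" "fst c = 0 \<longrightarrow> snd c = 1"
      using level_0_offset[OF assms(1) j(1)] offset_range[OF assms(1) j(1)]
        level_less_clique_number[OF assms(1) j(1)] unfolding w_def j(2) by simp_all
    show "c \<in> insert (0, 1) ({1..<w} \<times> {1, 2, 3})"
    proof (cases "fst c = 0")
      case True
      then have "c = (0, 1)" using *(3) by (simp add: prod_eq_iff)
      then show ?thesis by simp
    next
      case False
      then have "c \<in> {1..<w} \<times> {1, 2, 3}" using *(1,2) by (simp add: mem_Times_iff)
      then show ?thesis by (rule insertI2)
    qed
  qed
  have "card (insert (0, 1) ({1..<w} \<times> {1, 2, 3 :: nat})) = Suc (card ({1..<w} \<times> {1, 2, 3 :: nat}))"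
    by (rule card_insert_disjoint) auto
  also have "\<dots> = 3 * w - 2" using w by (simp add: card_cartesian_product)
  finally have "card (insert (0, 1) ({1..<w} \<times> {1, 2, 3 :: nat})) = 3 * w - 2" .
  moreover have "card ((!) (kt_sls Is) ` {..<length Is}) \<le> card (insert (0, 1) ({1..<w} \<times> {1, 2, 3 :: nat}))"
    by (rule card_mono[OF _ sub]) simp_all
  ultimately show ?thesis unfolding w_def by simp
qed

section \<open>Endpoint events\<close>

lemma edge_iff:
  "{i, j} \<in> ivl_edges Is \<longleftrightarrow> i < length Is \<and> j < length Is \<and> i \<noteq> j \<and> intersects (Is ! i) (Is ! j)"
proof -
  have sym: "intersects J K \<longleftrightarrow> intersects K J" for J K
    by (simp add: intersects_def Int_commute)
  show ?thesis
    unfolding ivl_edges_def ivl_vertices_def mem_Collect_eq lessThan_iff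
    using sym by (metis doubleton_eq_iff)
qed

section \<open>Neighbors and degrees under arrivals\<close>

definition neighbors :: "interval list \<Rightarrow> interval \<Rightarrow> nat set" where
  "neighbors Is I = {i. i < length Is \<and> intersects (Is ! i) I}"

lemma degree_eq: "j < length Is \<Longrightarrow> degree Is j = card (neighbors Is (Is ! j) - {j})"
  unfolding degree_def neighbors_def by (rule arg_cong[where f = card])
    (auto simp: edge_iff[of j] intersects_def Int_commute)

lemma finite_neighbors [simp]: "finite (neighbors Is I)"
  by (simp add: neighbors_def)

lemma degree_snoc:
  assumes "j < length Is"
  shows "degree (Is @ [I]) j = degree Is j + (if j \<in> neighbors Is I then 1 else 0)"
proof -
  have "neighbors (Is @ [I]) (Is ! j) - {j} =
      (neighbors Is (Is ! j) - {j}) \<union> (if j \<in> neighbors Is I then {length Is} else {})"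
    using assms by (auto simp: neighbors_def nth_append less_Suc_eq intersects_def Int_commute)
  moreover have "length Is \<notin> neighbors Is (Is ! j)" by (simp add: neighbors_def)
  ultimately show ?thesis using assms by (simp add: degree_eq nth_append)
qed

lemma degree_new: "degree (Is @ [I]) (length Is) = card (neighbors Is I)"
proof -
  have "neighbors (Is @ [I]) I - {length Is} = neighbors Is I"
    by (auto simp: neighbors_def nth_append less_Suc_eq)
  then show ?thesis by (simp add: degree_eq)
qed

lemma degree_le_max_degree: "j < length Is \<Longrightarrow> degree Is j \<le> max_degree Is"
  unfolding max_degree_def by (rule Max_ge) (auto simp: ivl_vertices_def)

lemma degree_take_le:
  assumes "j < i" "i \<le> length Is"
  shows "degree (take i Is) j \<le> degree Is j"
proof -
  have "neighbors (take i Is) (take i Is ! j) - {j} \<subseteq> neighbors Is (Is ! j) - {j}"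
    using assms by (auto simp: neighbors_def)
  then show ?thesis using assms by (simp add: degree_eq card_mono)
qed

text \<open>Degrees only grow with further arrivals. Bounds proved at the time of an insertion can
  therefore be stated with the final maximum degree.\<close>

lemma max_degree_take_le:
  assumes "0 < i" "i \<le> length Is"
  shows "max_degree (take i Is) \<le> max_degree Is"
proof -
  have "degree (take i Is) j \<le> max_degree Is" if "j < i" for j
    using degree_take_le[OF that assms(2)] degree_le_max_degree[of j Is] assms that by simp
  then show ?thesis using assms unfolding max_degree_def[of "take i Is"]
    by (intro Max.boundedI) (auto simp: ivl_vertices_def)
qed

text \<open>
  The events \<open>(j, 0)\<close> and \<open>(j, 1)\<close> are the left and the right endpoint of interval \<open>j\<close>.  At a
  common coordinate left endpoints come first, because the intervals are closed.
\<close>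

definition event_key :: "interval list \<Rightarrow> nat \<times> nat \<Rightarrow> real" where
  "event_key Is e = (if snd e = 0 then fst (Is ! fst e) else snd (Is ! fst e))"

text \<open>A preorder only: events of the same side at the same coordinate may be listed in either
  order, so an insertion can place a new event without looking at such ties.\<close>

definition before :: "interval list \<Rightarrow> nat \<times> nat \<Rightarrow> nat \<times> nat \<Rightarrow> bool" where
  "before Is a b \<longleftrightarrow> event_key Is a < event_key Is b \<or> event_key Is a = event_key Is b \<and> snd a \<le> snd b"

definition schedule :: "interval list \<Rightarrow> (nat \<times> nat) list \<Rightarrow> bool" where
  "schedule Is evs \<longleftrightarrow> distinct evs \<and> set evs = {..<length Is} \<times> {0, 1} \<and> sorted_wrt (before Is) evs"

lemma before_key_le: "before Is a b \<Longrightarrow> event_key Is a \<le> event_key Is b"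
  by (auto simp: before_def)

text \<open>Applied to \<open>x < fst I\<close> and \<open>x \<le> snd I\<close>, the predicates of
  the two tree searches.\<close>

lemma sorted_split:
  assumes "sorted_wrt (before Is) evs" "\<And>x y. P y \<Longrightarrow> x \<le> y \<Longrightarrow> P x"
  shows "\<exists>us vs. evs = us @ vs \<and> (\<forall>u \<in> set us. P (event_key Is u)) \<and> (\<forall>w \<in> set vs. \<not> P (event_key Is w))"
  using assms(1)
proof (induction evs)
  case (Cons e evs)
  show ?case
  proof (cases "P (event_key Is e)")
    case True
    obtain us vs where *: "evs = us @ vs" "\<forall>u \<in> set us. P (event_key Is u)" "\<forall>w \<in> set vs. \<not> P (event_key Is w)"
      using Cons.IH Cons.prems by (metis sorted_wrt.simps(2))
    have "e # evs = (e # us) @ vs" "\<forall>u \<in> set (e # us). P (event_key Is u)" using * True by simp_all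
    with *(3) show ?thesis by blast
  next
    case False
    have "\<not> P (event_key Is w)" if "w \<in> set (e # evs)" for w
    proof -
      have "w = e \<or> before Is e w" using that Cons.prems by auto
      then have "event_key Is e \<le> event_key Is w" using before_key_le[of Is e w] by auto
      then show ?thesis using False assms(2) by blast
    qed
    then show ?thesis by (intro exI[of _ "[]"] exI[of _ "e # evs"]) simp
  qed
qed simp

lemma sorted_insert_left:
  assumes "schedule Is (us @ vs)"
    and us: "\<forall>u \<in> set us. event_key Is u < fst I" and vs: "\<forall>w \<in> set vs. \<not> event_key Is w < fst I"
  shows "sorted_wrt (before (Is @ [I])) (us @ (length Is, 0) # vs)"
proof -
  have set: "set (us @ vs) = {..<length Is} \<times> {0, 1}" "sorted_wrt (before Is) (us @ vs)"
    using assms(1) by (simp_all add: schedule_def)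
  have key: "event_key (Is @ [I]) e = event_key Is e" if "e \<in> set (us @ vs)" for e
    using that unfolding set(1) by (auto simp: event_key_def nth_append)
  have key_n: "event_key (Is @ [I]) (length Is, 0) = fst I" by (simp add: event_key_def)
  have sorted: "sorted_wrt (before (Is @ [I])) (us @ vs)"
  proof (rule sorted_wrt_mono_rel[OF _ set(2)])
    fix a b assume "a \<in> set (us @ vs)" "b \<in> set (us @ vs)" "before Is a b"
    then show "before (Is @ [I]) a b" using key by (simp add: before_def)
  qed
  have "before (Is @ [I]) a (length Is, 0)" if "a \<in> set us" for a
    using us key[of a] key_n that by (simp add: before_def)
  moreover have "before (Is @ [I]) (length Is, 0) a" if "a \<in> set vs" for a
    using vs key[of a] key_n that by (auto simp: before_def)
  ultimately show ?thesis using sorted by (auto simp: sorted_wrt_append)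
qed

text \<open>Since \<open>I\<close> is valid, its left endpoint is accepted by the search for the
  right one, which therefore ends up behind it. \<open>B\<close> is the stretch to be swept.\<close>

lemma schedule_insert:
  assumes valid: "fst I \<le> snd I" and sch: "schedule Is (us @ vs)" and "n = length Is"
    and us: "\<forall>u \<in> set us. event_key Is u < fst I" and vs: "\<forall>w \<in> set vs. \<not> event_key Is w < fst I"
    and eq: "us @ (n, 0) # vs = us' @ vs'"
    and us': "\<forall>u \<in> set us'. event_key (Is @ [I]) u \<le> snd I"
    and vs': "\<forall>w \<in> set vs'. \<not> event_key (Is @ [I]) w \<le> snd I"
  obtains B where "us' = us @ (n, 0) # B" "vs = B @ vs'"
    "schedule (Is @ [I]) (us @ (n, 0) # B @ (n, 1) # vs')"
proof -
  have set: "set (us @ vs) = {..<n} \<times> {0, 1}" "distinct (us @ vs)"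
    using sch assms(3) by (simp_all add: schedule_def)
  have key_n: "event_key (Is @ [I]) (n, 0) = fst I" "event_key (Is @ [I]) (n, 1) = snd I"
    by (simp_all add: event_key_def assms(3))
  have "(n, 0) \<notin> set vs'" using vs' key_n(1) valid by auto
  then have "\<not> length us' \<le> length us"
  proof -
    have "(n, 0) \<in> set vs'" if "length us' \<le> length us"
    proof -
      have "vs' = drop (length us') (us @ (n, 0) # vs)" using eq by simp
      then show ?thesis using that by simp
    qed
    then show ?thesis using \<open>(n, 0) \<notin> set vs'\<close> by blast
  qed
  then obtain w where w: "us' = us @ w" "(n, 0) # vs = w @ vs'" "w \<noteq> []"
    using eq by (auto simp: append_eq_append_conv2)
  then obtain B where B: "us' = us @ (n, 0) # B" "vs = B @ vs'" by (cases w) auto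
  have sorted1: "sorted_wrt (before (Is @ [I])) (us @ (n, 0) # vs)"
    using sorted_insert_left[OF sch us vs] assms(3) by simp
  have snd_le: "snd a \<le> 1" if "a \<in> set (us @ vs)" for a using that unfolding set(1) by auto
  have s3: "before (Is @ [I]) a (n, 1)" if "a \<in> set us'" for a
  proof (cases "a = (n, 0)")
    case True
    then show ?thesis using key_n valid by (auto simp: before_def)
  next
    case False
    then have "a \<in> set (us @ vs)" using that B by auto
    then show ?thesis using us' that key_n(2) snd_le[of a] by (auto simp: before_def)
  qed
  have s4: "before (Is @ [I]) (n, 1) a" if "a \<in> set vs'" for a
    using vs' that key_n(2) by (auto simp: before_def)
  have "sorted_wrt (before (Is @ [I])) (us @ (n, 0) # B @ (n, 1) # vs')"
    using sorted1 s3 s4 unfolding B by (auto simp: sorted_wrt_append)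
  moreover have "distinct (us @ (n, 0) # B @ (n, 1) # vs')"
  proof -
    have "(n, 0) \<notin> set (us @ vs)" "(n, 1) \<notin> set (us @ vs)" unfolding set(1) by auto
    then show ?thesis using set(2) unfolding B by auto
  qed
  moreover have "set (us @ (n, 0) # B @ (n, 1) # vs') = {..<length (Is @ [I])} \<times> {0, 1}"
  proof -
    have "set (us @ (n, 0) # B @ (n, 1) # vs') = insert (n, 0) (insert (n, 1) (set (us @ vs)))"
      unfolding B by auto
    also have "\<dots> = {..<Suc n} \<times> {0, 1}" unfolding set(1) by (auto simp: less_Suc_eq)
    finally show ?thesis using assms(3) by simp
  qed
  ultimately show ?thesis using that B unfolding schedule_def by blast
qed

section \<open>One arrival in terms of events\<close>

text \<open>The situation after both endpoints of \<open>I\<close> have been listed and before its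
  color is computed: \<open>Is\<close> are the earlier intervals, and \<open>A\<close>,
  \<open>B\<close>, \<open>C\<close> their events in front of, between and behind the endpoints of
  \<open>I\<close>.\<close>

locale arrival =
  fixes Is :: "interval list" and I :: interval and A B C :: "(nat \<times> nat) list"
  assumes valid: "\<forall>J \<in> set (Is @ [I]). is_interval_pair J"
    and sched: "schedule (Is @ [I]) (A @ (length Is, 0) # B @ (length Is, 1) # C)"
begin

abbreviation "n \<equiv> length Is"

text \<open>Intervals opened and not yet closed when the sweep has passed \<open>Q\<close>. It is
  applied to prefixes of \<open>A @ B\<close>, that is, with the events of \<open>I\<close> left
  out.\<close>

definition active :: "(nat \<times> nat) list \<Rightarrow> nat set" where
  "active Q = {i. i < n \<and> (i, 0) \<in> set Q \<and> (i, 1) \<notin> set Q}"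

lemma valid_nth: "i < n \<Longrightarrow> fst (Is ! i) \<le> snd (Is ! i)"
  using valid by (simp add: is_interval_pair_def)

lemma distinct_events: "distinct (A @ (n, 0) # B @ (n, 1) # C)"
  and set_events: "set (A @ (n, 0) # B @ (n, 1) # C) = {..<Suc n} \<times> {0, 1}"
  and sorted_events: "sorted_wrt (before (Is @ [I])) (A @ (n, 0) # B @ (n, 1) # C)"
proof -
  have len: "length (Is @ [I]) = Suc n" by simp
  show "distinct (A @ (n, 0) # B @ (n, 1) # C)" using sched unfolding schedule_def by blast
  show "set (A @ (n, 0) # B @ (n, 1) # C) = {..<Suc n} \<times> {0, 1}"
    using sched unfolding schedule_def len by blast
  show "sorted_wrt (before (Is @ [I])) (A @ (n, 0) # B @ (n, 1) # C)"
    using sched unfolding schedule_def by blast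
qed

lemma keys [simp]:
  "i < n \<Longrightarrow> event_key (Is @ [I]) (i, 0) = fst (Is ! i)"
  "i < n \<Longrightarrow> event_key (Is @ [I]) (i, Suc 0) = snd (Is ! i)"
  "event_key (Is @ [I]) (n, 0) = fst I" "event_key (Is @ [I]) (n, Suc 0) = snd I"
  by (simp_all add: event_key_def nth_append)

lemma index_less: "(i, d) \<in> set A \<union> set B \<union> set C \<Longrightarrow> i < n"
proof -
  assume a: "(i, d) \<in> set A \<union> set B \<union> set C"
  then have "(i, d) \<in> set (A @ (n, 0) # B @ (n, 1) # C)" by auto
  then have "i < Suc n" "d = 0 \<or> d = 1" unfolding set_events by simp_all
  moreover have "(n, 0) \<notin> set A \<union> set B \<union> set C" "(n, 1) \<notin> set A \<union> set B \<union> set C"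
    using distinct_events by simp_all
  ultimately show "i < n" using a by (metis less_Suc_eq)
qed

lemma event_cases:
  assumes "i < n" "d \<in> {0, 1}"
  shows "(i, d) \<in> set A \<or> (i, d) \<in> set B \<or> (i, d) \<in> set C"
proof -
  have "(i, d) \<in> set (A @ (n, 0) # B @ (n, 1) # C)" unfolding set_events using assms by auto
  then show ?thesis using assms by auto
qed

lemma beforeI:
  assumes "A @ (n, 0) # B @ (n, 1) # C = xs @ a # ys @ b # zs"
  shows "before (Is @ [I]) a b"
  using sorted_events unfolding assms by (simp add: sorted_wrt_append)

lemma before_A: "a \<in> set A \<Longrightarrow> before (Is @ [I]) a (n, 0)"
  and before_B: "b \<in> set B \<Longrightarrow> before (Is @ [I]) (n, 0) b \<and> before (Is @ [I]) b (n, 1)"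
  and before_C: "c \<in> set C \<Longrightarrow> before (Is @ [I]) (n, 0) c \<and> before (Is @ [I]) (n, 1) c"
  using sorted_events by (simp_all add: sorted_wrt_append)

lemma A_left: "(i, 0) \<in> set A \<Longrightarrow> fst (Is ! i) \<le> fst I"
  using before_A[of "(i, 0)"] index_less[of i 0] by (auto simp: before_def)

text \<open>Strict because of the order at equal coordinates: a right endpoint at
  \<open>fst I\<close> is listed behind the left endpoint of \<open>I\<close>.\<close>

lemma A_right: "(i, 1) \<in> set A \<Longrightarrow> snd (Is ! i) < fst I"
  using before_A[of "(i, 1)"] index_less[of i 1] by (auto simp: before_def)

lemma not_A_right: "i < n \<Longrightarrow> (i, 1) \<notin> set A \<Longrightarrow> fst I \<le> snd (Is ! i)"
  using before_B[of "(i, 1)"] before_C[of "(i, 1)"] event_cases[of i 1] by (auto simp: before_def)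

lemma B_left: "(i, 0) \<in> set B \<Longrightarrow> fst I \<le> fst (Is ! i) \<and> fst (Is ! i) \<le> snd I"
  using before_B[of "(i, 0)"] index_less[of i 0] by (auto simp: before_def)

lemma C_left: "(i, 0) \<in> set C \<Longrightarrow> snd I < fst (Is ! i)"
  using before_C[of "(i, 0)"] index_less[of i 0] by (auto simp: before_def)

lemma left_before_right:
  assumes "A @ (n, 0) # B @ (n, 1) # C = xs @ (i, 1) # ys" "i < n"
  shows "(i, 0) \<in> set xs"
proof (rule ccontr)
  assume "(i, 0) \<notin> set xs"
  moreover have "(i, 0) \<in> set (xs @ (i, 1) # ys)" using event_cases[OF assms(2), of 0] unfolding assms(1)[symmetric] by auto
  ultimately have "(i, 0) \<in> set ys" by auto
  then obtain us vs where "ys = us @ (i, 0) # vs" by (meson split_list)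
  then have "before (Is @ [I]) (i, 1) (i, 0)" using beforeI[of xs "(i, 1)" us "(i, 0)" vs] assms by simp
  then show False using valid_nth[OF assms(2)] assms(2) by (auto simp: before_def)
qed

lemma neighbors_eq: "neighbors Is I = {i. i < n \<and> ((i, 0) \<in> set A \<or> (i, 0) \<in> set B) \<and> (i, 1) \<notin> set A}"
proof -
  have "intersects (Is ! i) I \<longleftrightarrow> ((i, 0) \<in> set A \<or> (i, 0) \<in> set B) \<and> (i, 1) \<notin> set A" if "i < n" for i
  proof -
    have v: "fst I \<le> snd I" using valid by (simp add: is_interval_pair_def)
    have "intersects (Is ! i) I \<longleftrightarrow> fst (Is ! i) \<le> snd I \<and> fst I \<le> snd (Is ! i)"
      using v valid_nth[OF that] by (auto simp: intersects_def points_def Int_atLeastAtMost)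
    moreover have "fst (Is ! i) \<le> snd I \<longleftrightarrow> (i, 0) \<in> set A \<or> (i, 0) \<in> set B"
      using A_left B_left C_left[of i] event_cases[OF that, of 0] v by fastforce
    moreover have "fst I \<le> snd (Is ! i) \<longleftrightarrow> (i, 1) \<notin> set A"
      using A_right[of i] not_A_right[OF that] by fastforce
    ultimately show ?thesis by blast
  qed
  then show ?thesis by (auto simp: neighbors_def)
qed

text \<open>Levels become occupied only when an interval opens, and at that moment its left endpoint
  is common to all active intervals. This is the point that keeps the candidate level from
  overshooting.\<close>

lemma active_step:
  assumes B: "B = B1 @ (j, 0) # B2" and i: "i \<in> active (A @ B1 @ [(j, 0)])"
  shows "fst (Is ! j) \<in> points (Is ! i)"
proof -
  have j: "j < n" using index_less[of j 0] B by simp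
  have i': "i < n" "(i, 0) \<in> set (A @ B1 @ [(j, 0)])" "(i, 1) \<notin> set (A @ B1 @ [(j, 0)])"
    using i by (auto simp: active_def)
  have all: "A @ (n, 0) # B @ (n, 1) # C = (A @ (n, 0) # B1) @ (j, 0) # (B2 @ (n, 1) # C)"
    using B by simp
  have "i = j \<or> before (Is @ [I]) (i, 0) (j, 0)"
    using i'(2) sorted_events unfolding all by (auto simp: sorted_wrt_append)
  then have "fst (Is ! i) \<le> fst (Is ! j)" using i' j by (auto simp: before_def)
  moreover have "(i, 1) \<in> set (B2 @ (n, 1) # C)" using event_cases[OF i'(1), of 1] i'(3) B by auto
  then have "before (Is @ [I]) (j, 0) (i, 1)"
    using sorted_events unfolding all by (auto simp: sorted_wrt_append)
  then have "fst (Is ! j) \<le> snd (Is ! i)" using i' j by (auto simp: before_def)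
  ultimately show ?thesis by (simp add: points_def)
qed

lemma active_insert:
  assumes B: "B = B1 @ (j, 0) # B2"
  shows "active (A @ B1 @ [(j, 0)]) = insert j (active (A @ B1))" "j \<notin> active (A @ B1)" "j \<in> neighbors Is I"
    "(j, 1) \<notin> set (A @ B1)"
proof -
  have j: "j < n" using index_less[of j 0] B by simp
  have n0: "(j, 0) \<notin> set (A @ B1)" using distinct_events B by auto
  show n1: "(j, 1) \<notin> set (A @ B1)"
  proof
    assume "(j, 1) \<in> set (A @ B1)"
    then have "(j, 1) \<in> set (A @ (n, 0) # B1)" by auto
    then obtain us vs where us: "A @ (n, 0) # B1 = us @ (j, 1) # vs" by (meson split_list)
    then have "(j, 0) \<in> set us"
      using left_before_right[of us j "vs @ (j, 0) # B2 @ (n, 1) # C"] j B us by simp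
    moreover have "set us \<subseteq> set (A @ (n, 0) # B1)" unfolding us by auto
    ultimately show False using n0 j by auto
  qed
  show "active (A @ B1 @ [(j, 0)]) = insert j (active (A @ B1))"
    using j n1 by (auto simp: active_def)
  show "j \<notin> active (A @ B1)" using n0 by (simp add: active_def)
  show "j \<in> neighbors Is I" using j n1 B unfolding neighbors_eq by auto
qed

lemma active_delete:
  assumes B: "B = B1 @ (j, 1) # B2"
  shows "active (A @ B1 @ [(j, 1)]) = active (A @ B1) - {j}" "j \<in> active (A @ B1)"
proof -
  have j: "j < n" using index_less[of j 1] B by simp
  show "active (A @ B1 @ [(j, 1)]) = active (A @ B1) - {j}" by (auto simp: active_def)
  have "(j, 0) \<in> set (A @ (n, 0) # B1)"
    using left_before_right[of "A @ (n, 0) # B1" j "B2 @ (n, 1) # C"] j B by simp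
  moreover have "(j, 1) \<notin> set (A @ B1)" using distinct_events B by auto
  ultimately show "j \<in> active (A @ B1)" using j by (auto simp: active_def)
qed

text \<open>Although a height is taken at a real point, it is determined at one of the finitely many
  positions of the sweep. This direction shows that the sweep overlooks no point of
  \<open>I\<close>.\<close>

lemma active_cover:
  assumes t: "t \<in> points I"
  obtains B1 B2 where "B = B1 @ B2" "\<And>i. i < n \<Longrightarrow> t \<in> points (Is ! i) \<Longrightarrow> i \<in> active (A @ B1)"
proof -
  \<comment> \<open>The prefix takes in left endpoints at \<open>t\<close> but not right endpoints
    at \<open>t\<close>, so that closed intervals ending or starting in \<open>t\<close> count as
    active.\<close>
  define p where "p e \<longleftrightarrow> event_key (Is @ [I]) e < t \<or> event_key (Is @ [I]) e = t \<and> snd e = 0" for e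
  have sB: "sorted_wrt (before (Is @ [I])) B" using sorted_events by (simp add: sorted_wrt_append)
  have p_before: "p a" if "before (Is @ [I]) a b" "p b" for a b
    using that by (auto simp: before_def p_def)
  have np: "\<not> p e" if "e \<in> set (dropWhile p B)" for e
    using that sB
  proof (induction B)
    case (Cons b B)
    show ?case
    proof (cases "p b")
      case True
      then show ?thesis using Cons by simp
    next
      case False
      then have "e = b \<or> before (Is @ [I]) b e" using Cons.prems by auto
      then show ?thesis using False p_before by blast
    qed
  qed simp
  show ?thesis
  proof (rule that[of "takeWhile p B" "dropWhile p B"])
    fix i assume i: "i < n" "t \<in> points (Is ! i)"
    have ti: "fst (Is ! i) \<le> t" "t \<le> snd (Is ! i)" "fst I \<le> t" "t \<le> snd I" using i t by (auto simp: points_def)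
    have "(i, 0) \<notin> set C" using C_left[of i] ti by auto
    moreover have "(i, 0) \<in> set (takeWhile p B)" if "(i, 0) \<in> set B"
    proof (rule ccontr)
      assume "(i, 0) \<notin> set (takeWhile p B)"
      then have "(i, 0) \<in> set (dropWhile p B)" using that by (metis Un_iff set_append takeWhile_dropWhile_id)
      then have "\<not> p (i, 0)" by (rule np)
      then show False using ti i by (simp add: p_def)
    qed
    ultimately have "(i, 0) \<in> set (A @ takeWhile p B)" using event_cases[OF i(1), of 0] by auto
    moreover have "(i, 1) \<notin> set A" using A_right[of i] ti by auto
    moreover have "(i, 1) \<notin> set (takeWhile p B)"
    proof
      assume "(i, 1) \<in> set (takeWhile p B)"
      then have "p (i, 1)" by (rule set_takeWhileD[THEN conjunct2])
      then show False using ti i by (simp add: p_def)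
    qed
    ultimately show "i \<in> active (A @ takeWhile p B)" using i by (simp add: active_def)
  qed simp
qed

text \<open>An event listed between the left endpoints of \<open>j\<close> and \<open>I\<close> has
  its coordinate between these two, hence inside interval \<open>j\<close>, which reaches
  \<open>fst I\<close>. So its owner is \<open>j\<close> or a neighbor of \<open>j\<close>, and each
  of them has two events.\<close>

lemma walk_length:
  assumes A: "A = A1 @ (j, 0) # A2" and "fst I \<le> snd (Is ! j)"
  shows "Suc (length A2) \<le> 2 * degree Is j + 2"
proof -
  have j: "j < n" using index_less[of j 0] A by simp
  have sub: "set ((j, 0) # A2) \<subseteq> insert j (neighbors Is (Is ! j) - {j}) \<times> {0, 1}"
  proof
    fix e assume e: "e \<in> set ((j, 0) # A2)"
    obtain i d where ed: "e = (i, d)" by (cases e)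
    have inA: "e \<in> set A" using e A by auto
    then have i: "i < n" using index_less ed by blast
    have "e \<in> {..<Suc n} \<times> {0, 1}" using inA set_events by auto
    then have d: "d \<in> {0, 1}" using ed by simp
    have "before (Is @ [I]) (j, 0) e \<or> e = (j, 0)" "before (Is @ [I]) e (n, 0)"
      using sorted_events e unfolding A by (auto simp: sorted_wrt_append)
    then have k: "fst (Is ! j) \<le> event_key (Is @ [I]) e" "event_key (Is @ [I]) e \<le> fst I"
      using j by (auto simp: before_def)
    have "event_key (Is @ [I]) e \<in> points (Is ! i)"
      using valid_nth[OF i] i d ed by (auto simp: points_def)
    moreover have "event_key (Is @ [I]) e \<in> points (Is ! j)"
      using k assms(2) by (simp add: points_def)
    ultimately have "i \<in> neighbors Is (Is ! j)" using i by (auto simp: neighbors_def intersects_def)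
    then show "e \<in> insert j (neighbors Is (Is ! j) - {j}) \<times> {0, 1}" using d ed by auto
  qed
  have "card (set ((j, 0) # A2)) = Suc (length A2)"
    using distinct_events A by (subst distinct_card) auto
  moreover have "card (set ((j, 0) # A2)) \<le> card (insert j (neighbors Is (Is ! j) - {j}) \<times> {0 :: nat, 1})"
    by (rule card_mono[OF _ sub]) simp
  moreover have "card (insert j (neighbors Is (Is ! j) - {j})) = Suc (degree Is j)"
    using degree_eq[OF j] by (subst card_insert_disjoint) auto
  then have "card (insert j (neighbors Is (Is ! j) - {j}) \<times> {0 :: nat, 1}) = 2 * degree Is j + 2"
    unfolding card_cartesian_product by simp
  ultimately show ?thesis by simp
qed

text \<open>The uniform bound \<open>W\<close> lets the program walk a fixed number of steps without
  knowing where the intervals it looks for begin.\<close>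

lemma walk_reaches:
  assumes "\<forall>j < n. 2 * degree Is j + 2 \<le> W" "(j, 0) \<in> set A" "fst I \<le> snd (Is ! j)"
  shows "(j, 0) \<in> set (take W (rev A))"
proof -
  obtain A1 A2 where A: "A = A1 @ (j, 0) # A2" using assms(2) by (meson split_list)
  have j: "j < n" using index_less[of j 0] A by simp
  have "Suc (length A2) \<le> W" using walk_length[OF A assms(3)] assms(1) j by fastforce
  then have eq: "take (Suc (length A2)) (take W (rev A)) = take (Suc (length A2)) (rev A)"
    by (simp add: min_absorb1)
  have "take (Suc (length A2)) (rev A) = rev A2 @ [(j, 0)]" unfolding A by simp
  then have "(j, 0) \<in> set (take (Suc (length A2)) (take W (rev A)))" unfolding eq by simp
  then show ?thesis by (rule in_set_takeD)
qed

text \<open>At a point of maximal height each lower level is occupied by an interval of its own,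
  which is a neighbor. This bounds how often the candidate level can be raised.\<close>

lemma new_level_le_card: "new_level (config_of Is) I \<le> card (neighbors Is I)"
proof -
  obtain t where t: "t \<in> points I" "height (config_of Is) t = new_level (config_of Is) I"
    using new_level_attained[of I Is] valid by auto
  have "{..<new_level (config_of Is) I} \<subseteq> level_of Is ` neighbors Is I"
  proof
    fix h assume "h \<in> {..<new_level (config_of Is) I}"
    then obtain i where "i < n" "t \<in> points (Is ! i)" "level_of Is i = h"
      using less_height_blocked[of h Is t] t by (auto simp: blocked_def)
    moreover from this have "i \<in> neighbors Is I" using t by (auto simp: neighbors_def intersects_def)
    ultimately show "h \<in> level_of Is ` neighbors Is I" by blast
  qed
  then have "card {..<new_level (config_of Is) I} \<le> card (neighbors Is I)"
    by (rule surj_card_le[rotated]) simp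
  then show ?thesis by simp
qed

text \<open>The safe direction for the candidate level: if all levels up to \<open>M\<close> are
  occupied at one common point of \<open>I\<close>, then raising \<open>M\<close> by one does not
  exceed the true level.\<close>

lemma less_new_level:
  assumes "\<And>l. l \<le> M \<Longrightarrow> \<exists>i \<in> S. level_of Is i = l" "S \<subseteq> {..<n}" "t \<in> (\<Inter>i \<in> S. points (Is ! i))" "t \<in> points I"
  shows "M < new_level (config_of Is) I"
proof -
  have "M < height (config_of Is) t"
    by (rule less_height) (use assms(1-3) in \<open>fastforce simp: blocked_def\<close>)
  then show ?thesis using height_le_new_level[OF assms(4), of Is] by simp
qed

text \<open>The converse direction: a level up to \<open>M\<close> free at every position of the
  sweep, possibly a different one each time, bounds the height at every point of
  \<open>I\<close>.\<close>

lemma new_level_le: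
  assumes "\<And>B1 B2. B = B1 @ B2 \<Longrightarrow> \<exists>l \<le> M. \<forall>i \<in> active (A @ B1). level_of Is i \<noteq> l"
  shows "new_level (config_of Is) I \<le> M"
proof -
  obtain t where t: "t \<in> points I" "height (config_of Is) t = new_level (config_of Is) I"
    using new_level_attained[of I Is] valid by auto
  obtain B1 B2 where B: "B = B1 @ B2" "\<And>i. i < n \<Longrightarrow> t \<in> points (Is ! i) \<Longrightarrow> i \<in> active (A @ B1)"
    using active_cover[OF t(1)] by blast
  obtain l where l: "l \<le> M" "\<forall>i \<in> active (A @ B1). level_of Is i \<noteq> l" using assms[OF B(1)] by blast
  then have "\<not> blocked Is t l" using B(2) by (auto simp: blocked_def)
  then show ?thesis using height_le[of Is t l] l t by simp
qed

end

section \<open>Computing the level of an interval\<close>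

text \<open>When \<open>m\<close> is 0 all levels up to \<open>M\<close> are occupied. After raising
  \<open>M\<close> only the new value can be free, so one counter decides whether \<open>m\<close>
  becomes 1 or stays 0.\<close>

definition settle :: com where
  "settle = While (WEq (WVar ''m'') (WConst 0)) (Seq (WAssign ''M'' (WSucc (WVar ''M'')))
    (If (WEq (WArr ''cnt'' (WVar ''M'')) (WConst 0)) (WAssign ''m'' (WConst 1)) Skip))"

text \<open>The counter is tested before it is incremented: a level stops being free with the first
  active interval on it. The array \<open>nb\<close> collects the neighbors for the cleanup after
  the sweep.\<close>

definition enlist :: com where
  "enlist = Seq (WStore ''nb'' (WVar ''k'') (WVar ''j'')) (Seq (WAssign ''k'' (WSucc (WVar ''k'')))
    (Seq (WAssign ''l'' (WArr ''level'' (WVar ''j'')))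
    (Seq (If (And (WEq (WArr ''cnt'' (WVar ''l'')) (WConst 0)) (Not (WLess (WVar ''M'') (WVar ''l''))))
       (WAssign ''m'' (WPred (WVar ''m''))) Skip)
     (WStore ''cnt'' (WVar ''l'') (WSucc (WArr ''cnt'' (WVar ''l'')))))))"

definition activate :: com where
  "activate = Seq enlist settle"

text \<open>A departure can only free levels, so \<open>m\<close> stays positive and
  \<open>M\<close> is kept. It is never lowered, being a maximum over all positions passed so
  far.\<close>

definition deactivate :: com where
  "deactivate = Seq (WAssign ''l'' (WArr ''level'' (WVar ''j'')))
    (Seq (WStore ''cnt'' (WVar ''l'') (WPred (WArr ''cnt'' (WVar ''l''))))
     (If (And (WEq (WArr ''cnt'' (WVar ''l'')) (WConst 0)) (Not (WLess (WVar ''M'') (WVar ''l''))))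
       (WAssign ''m'' (WSucc (WVar ''m''))) Skip))"

definition free_levels :: "(nat \<Rightarrow> nat) \<Rightarrow> nat set \<Rightarrow> nat \<Rightarrow> nat set" where
  "free_levels lev S M = {l. l \<le> M \<and> (\<forall>i \<in> S. lev i \<noteq> l)}"

definition counts :: "state \<Rightarrow> (nat \<Rightarrow> nat) \<Rightarrow> nat set \<Rightarrow> bool" where
  "counts s lev S \<longleftrightarrow> (\<forall>l. warr s ''cnt'' l = card {i \<in> S. lev i = l}) \<and>
    wvar s ''m'' = card (free_levels lev S (wvar s ''M''))"

definition listed :: "state \<Rightarrow> nat list \<Rightarrow> bool" where
  "listed s N \<longleftrightarrow> wvar s ''k'' = length N \<and> (\<forall>q < length N. warr s ''nb'' q = N ! q)"

lemma finite_free_levels [simp]: "finite (free_levels lev S M)"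
  by (rule finite_subset[of _ "{..M}"]) (auto simp: free_levels_def)

text \<open>By the last assumption, fully occupied initial segments of levels stop short of
  \<open>L\<close>, so the loop never raises \<open>M\<close> beyond \<open>L\<close>. Each pass is
  paid by the drop of \<open>20 (L - M)\<close>, which is why several calls together cost only a
  multiple of \<open>L\<close> plus a constant per call.\<close>

lemma runs_settle:
  assumes "finite S" "counts s lev S" "wvar s ''M'' \<le> L"
    and "\<And>M. (\<And>l. l \<le> M \<Longrightarrow> \<exists>i \<in> S. lev i = l) \<Longrightarrow> M < L"
  shows "runs settle s (\<lambda>n s'. counts s' lev S \<and> 0 < wvar s' ''m'' \<and> wvar s ''M'' \<le> wvar s' ''M'' \<and>
    wvar s' ''M'' \<le> L \<and> n + 20 * (L - wvar s' ''M'') \<le> 20 * (L - wvar s ''M'') + 5)"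
  using assms(2,3)
proof (induction "L - wvar s ''M''" arbitrary: s rule: less_induct)
  case less
  show ?case
  proof (cases "wvar s ''m'' = 0")
    case False
    then show ?thesis using less.prems unfolding settle_def by (intro runs_While_False) auto
  next
    case True
    then have cov: "\<exists>i \<in> S. lev i = l" if "l \<le> wvar s ''M''" for l
      using less.prems(1) that by (auto simp: counts_def free_levels_def)
    then have M_less: "wvar s ''M'' < L" by (rule assms(4))
    define b where "b = Seq (WAssign ''M'' (WSucc (WVar ''M'')))
      (If (WEq (WArr ''cnt'' (WVar ''M'')) (WConst 0)) (WAssign ''m'' (WConst 1)) Skip)"
    define s1 where "s1 = effect b s"
    define M1 where "M1 = Suc (wvar s ''M'')"
    have cnt: "warr s ''cnt'' l = card {i \<in> S. lev i = l}" for l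
      using less.prems(1) by (simp add: counts_def)
    have s1: "wvar s1 ''M'' = M1" "warr s1 = warr s"
      "wvar s1 ''m'' = (if warr s ''cnt'' M1 = 0 then 1 else 0)"
      using True by (auto simp: s1_def b_def M1_def)
    have "free_levels lev S M1 = (if warr s ''cnt'' M1 = 0 then {M1} else {})"
    proof -
      have "warr s ''cnt'' M1 = 0 \<longleftrightarrow> (\<forall>i \<in> S. lev i \<noteq> M1)" using assms(1) by (auto simp: cnt)
      then show ?thesis using cov by (auto simp: free_levels_def M1_def le_Suc_eq)
    qed
    then have c1: "counts s1 lev S" using s1 cnt by (simp add: counts_def)
    have cost: "max_cost b \<le> 14" by (simp add: b_def)
    show ?thesis unfolding settle_def b_def[symmetric]
    proof (rule runs_While_True, use True in simp, rule runs_loop_free, simp add: b_def, fold s1_def settle_def, goal_cases)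
      case (1 n)
      have "runs settle s1 (\<lambda>n s'. counts s' lev S \<and> 0 < wvar s' ''m'' \<and> wvar s1 ''M'' \<le> wvar s' ''M'' \<and>
        wvar s' ''M'' \<le> L \<and> n + 20 * (L - wvar s' ''M'') \<le> 20 * (L - wvar s1 ''M'') + 5)"
        by (rule less.hyps) (use M_less s1 c1 in \<open>auto simp: M1_def\<close>)
      then show ?case unfolding settle_def[unfolded b_def[symmetric]]
        by (rule runs_mono) (use 1 M_less s1 cost in \<open>auto simp: M1_def\<close>)
    qed
  qed
qed

lemma card_level_insert:
  assumes "finite S" "j \<notin> S"
  shows "card {i \<in> insert j S. lev i = l} = card {i \<in> S. lev i = l} + (if lev j = l then 1 else 0)"
proof -
  have "{i \<in> insert j S. lev i = l} = (if lev j = l then insert j {i \<in> S. lev i = l} else {i \<in> S. lev i = l})"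
    by auto
  then show ?thesis using assms by simp
qed

lemma effect_enlist:
  assumes "finite S" "counts s lev S" "j \<notin> S" "wvar s ''j'' = j" "warr s ''level'' j = lev j" "listed s N"
  defines "s' \<equiv> effect enlist s"
  shows "counts s' lev (insert j S)" "listed s' (N @ [j])" "wvar s' ''M'' = wvar s ''M''"
proof -
  define M where "M = wvar s ''M''"
  have cnt: "warr s ''cnt'' l = card {i \<in> S. lev i = l}" for l
    using assms(2) by (simp add: counts_def)
  have m: "wvar s ''m'' = card (free_levels lev S M)"
    using assms(2) by (simp add: counts_def M_def)
  have eff: "warr s' ''cnt'' = (warr s ''cnt'')(lev j := Suc (warr s ''cnt'' (lev j)))"
    "warr s' ''nb'' = (warr s ''nb'')(wvar s ''k'' := j)" "wvar s' ''k'' = Suc (wvar s ''k'')"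
    "wvar s' ''m'' = (if warr s ''cnt'' (lev j) = 0 \<and> lev j \<le> M then wvar s ''m'' - 1 else wvar s ''m'')"
    and M': "wvar s' ''M'' = M"
    using assms(4,5) by (auto simp: s'_def enlist_def M_def)
  show "wvar s' ''M'' = wvar s ''M''" using M' M_def by simp
  show "listed s' (N @ [j])" using assms(6) eff by (auto simp: listed_def nth_append less_Suc_eq)
  have "free_levels lev (insert j S) M = free_levels lev S M - {lev j}" by (auto simp: free_levels_def)
  moreover have "lev j \<in> free_levels lev S M \<longleftrightarrow> warr s ''cnt'' (lev j) = 0 \<and> lev j \<le> M"
    using assms(1) by (auto simp: free_levels_def cnt)
  ultimately have "wvar s' ''m'' = card (free_levels lev (insert j S) M)"
    using eff(4) m by (auto simp: card_Diff_singleton_if)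
  then show "counts s' lev (insert j S)"
    unfolding counts_def using eff(1) M' cnt card_level_insert[OF assms(1,3), of lev] by auto
qed

lemma runs_activate:
  assumes "finite S" "counts s lev S" "j \<notin> S" "wvar s ''j'' = j" "warr s ''level'' j = lev j" "listed s N"
    and "wvar s ''M'' \<le> L" "\<And>M. (\<And>l. l \<le> M \<Longrightarrow> \<exists>i \<in> insert j S. lev i = l) \<Longrightarrow> M < L"
  shows "runs activate s (\<lambda>n s'. counts s' lev (insert j S) \<and> listed s' (N @ [j]) \<and> 0 < wvar s' ''m'' \<and>
    wvar s ''M'' \<le> wvar s' ''M'' \<and> wvar s' ''M'' \<le> L \<and>
    n + 20 * (L - wvar s' ''M'') \<le> 20 * (L - wvar s ''M'') + 50)"
  unfolding activate_def
proof (rule runs_Seq, rule runs_loop_free, simp add: enlist_def, goal_cases)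
  case (1 n)
  note e = effect_enlist[OF assms(1-6)]
  have n: "n \<le> 45" using 1 by (simp add: enlist_def)
  show ?case
  proof (rule runs_mono[OF runs_settle[where S = "insert j S" and lev = lev and L = L]], goal_cases)
    case (5 m s')
    have "unchanged settle (effect enlist s) s'" using 5(1) by (rule exec_unchanged)
    then have "listed s' (N @ [j])" using e(2)
      by (simp add: listed_def unchangedD settle_def)
    then show ?case using 5 n e(3) by auto
  qed (use assms e in auto)
qed

lemma runs_deactivate:
  assumes "finite S" "counts s lev S" "j \<in> S" "wvar s ''j'' = j" "warr s ''level'' j = lev j"
  shows "runs deactivate s (\<lambda>n s'. counts s' lev (S - {j}) \<and> wvar s ''m'' \<le> wvar s' ''m'' \<and>
    wvar s' ''M'' = wvar s ''M'' \<and> n \<le> 50)"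
proof (rule runs_loop_free, simp add: deactivate_def, goal_cases)
  case (1 n)
  define s' where "s' = effect deactivate s"
  define M where "M = wvar s ''M''"
  have S: "S = insert j (S - {j})" using assms(3) by auto
  have cnt: "warr s ''cnt'' l = card {i \<in> S. lev i = l}" for l
    using assms(2) by (simp add: counts_def)
  have m: "wvar s ''m'' = card (free_levels lev S M)"
    using assms(2) by (simp add: counts_def M_def)
  have ins: "card {i \<in> S. lev i = l} = card {i \<in> S - {j}. lev i = l} + (if lev j = l then 1 else 0)" for l
    using card_level_insert[of "S - {j}" j lev l] assms(1,3) by (simp add: insert_absorb)
  have eff: "warr s' ''cnt'' = (warr s ''cnt'')(lev j := warr s ''cnt'' (lev j) - 1)"
    "wvar s' ''m'' = (if warr s ''cnt'' (lev j) - 1 = 0 \<and> lev j \<le> M then Suc (wvar s ''m'') else wvar s ''m'')"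
    "wvar s' ''M'' = M"
    using assms(4,5) by (auto simp: s'_def deactivate_def M_def)
  have cnt': "warr s' ''cnt'' l = card {i \<in> S - {j}. lev i = l}" for l
    using eff(1) cnt[of l] ins[of l] by auto
  have fr: "free_levels lev S M = free_levels lev (S - {j}) M - {lev j}"
    using assms(3) by (auto simp: free_levels_def)
  have "lev j \<in> free_levels lev (S - {j}) M \<longleftrightarrow> warr s ''cnt'' (lev j) - 1 = 0 \<and> lev j \<le> M"
    using assms(1) cnt'[of "lev j"] eff(1) by (auto simp: free_levels_def)
  moreover have "lev j \<in> free_levels lev (S - {j}) M \<Longrightarrow> 0 < card (free_levels lev (S - {j}) M)"
    by (auto simp: card_gt_0_iff)
  ultimately have "wvar s' ''m'' = card (free_levels lev (S - {j}) M)" "wvar s ''m'' \<le> wvar s' ''m''"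
    using eff(2) m fr by (auto simp: card_Diff_singleton_if)
  then show ?case unfolding s'_def[symmetric]
    using cnt' eff(3) 1 by (auto simp: counts_def M_def deactivate_def)
qed

lemma chain_drop: "chain f xs e \<Longrightarrow> i < length xs \<Longrightarrow> f (xs ! i) = hd (drop (Suc i) xs @ [e])"
  by (induction xs arbitrary: i) (auto simp: nth_Cons split: nat.split)

section \<open>Walking back and sweeping\<close>

text \<open>An interval starting in front of \<open>I\<close> contains the left endpoint of
  \<open>I\<close> exactly if its right endpoint, kept in \<open>R\<close>, is not below
  \<open>lo\<close>. In this way closed intervals are recognized although the walk meets them from
  the wrong side.\<close>

definition walk_body :: com where
  "walk_body = Seq (If (And (WEq (WArr ''sd'' (WVar ''y'')) (WConst 0))
      (Not (RLess (RArr ''R'' (WArr ''iv'' (WVar ''y''))) (RVar ''lo''))))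
      (Seq (WAssign ''j'' (WArr ''iv'' (WVar ''y''))) activate) Skip)
    (Seq (WAssign ''y'' (WArr ''bp'' (WVar ''y''))) (WAssign ''w'' (WPred (WVar ''w''))))"

definition walk :: com where
  "walk = Seq (WAssign ''y'' (WArr ''bp'' (WVar ''a''))) (Seq (WAssign ''w'' (WVar ''W''))
    (While (And (Not (WEq (WVar ''w'') (WConst 0))) (Not (WEq (WVar ''y'') (WConst 1)))) walk_body))"

definition sweep_body :: com where
  "sweep_body = Seq (WAssign ''j'' (WArr ''iv'' (WVar ''y'')))
    (Seq (If (WEq (WArr ''sd'' (WVar ''y'')) (WConst 0)) activate deactivate)
     (WAssign ''y'' (WArr ''bn'' (WVar ''y''))))"

definition sweep :: com where
  "sweep = Seq (WAssign ''y'' (WArr ''bn'' (WVar ''a'')))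
    (While (Not (WEq (WVar ''y'') (WVar ''b''))) sweep_body)"

lemma runs_unchanged: "runs c s Q \<Longrightarrow> runs c s (\<lambda>n s'. Q n s' \<and> unchanged c s s')"
  unfolding runs_def using exec_unchanged by blast

lemma activate_changes:
  "wvars activate = {''k'', ''l'', ''m'', ''M''}" "warrs activate = {''nb'', ''cnt''}"
  "rvars activate = {}" "rarrs activate = {}"
  "wvars deactivate = {''l'', ''m''}" "warrs deactivate = {''cnt''}"
  "rvars deactivate = {}" "rarrs deactivate = {}"
  by (auto simp: activate_def deactivate_def settle_def enlist_def)

abbreviation event_of :: "state \<Rightarrow> nat \<Rightarrow> nat \<times> nat" where
  "event_of s e \<equiv> (warr s ''iv'' e, warr s ''sd'' e)"

context arrival begin

abbreviation "lev \<equiv> level_of Is"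
abbreviation "L \<equiv> new_level (config_of Is) I"

text \<open>The part of \<open>active A\<close> found after walking over \<open>Q\<close>.
  Coordinates replace the condition on right events, since the walk runs backwards and
  \<open>Q\<close> is not a prefix of the events.\<close>

definition walked :: "(nat \<times> nat) list \<Rightarrow> nat set" where
  "walked Q = {i. i < n \<and> (i, 0) \<in> set Q \<and> fst I \<le> snd (Is ! i)}"

lemma finite_active [simp]: "finite (active Q)" and finite_walked [simp]: "finite (walked Q)"
  by (simp_all add: active_def walked_def)

text \<open>All intervals enlisted contain \<open>fst I\<close>; this point witnesses that
  \<open>M\<close> stays at most \<open>L\<close> even while only part of the active set is counted.
  Whether the step counter or the sentinel ends the walk, \<open>walk_reaches\<close> shows that the
  active set is complete.\<close>

lemma runs_walk:
  assumes As: "map (event_of s) As = A" and ch: "chain (warr s ''bp'') (wvar s ''a'' # rev As) 1" "1 \<notin> set As"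
    and R: "\<forall>i < n. rarr s ''R'' i = snd (Is ! i)" "\<forall>i < n. warr s ''level'' i = lev i" "rvar s ''lo'' = fst I"
    and W: "\<forall>j < n. 2 * degree Is j + 2 \<le> wvar s ''W''"
    and init: "counts s lev {}" "listed s []" "wvar s ''M'' = 0" "0 < wvar s ''m''"
  shows "runs walk s (\<lambda>n s'. \<exists>N. listed s' N \<and> distinct N \<and> set N = active A \<and> counts s' lev (active A) \<and>
    0 < wvar s' ''m'' \<and> wvar s' ''M'' \<le> L \<and> n + 20 * (L - wvar s' ''M'') \<le> 20 * L + 100 * wvar s ''W'' + 20)"
proof -
  define W where "W = wvar s ''W''"
  define s0 where "s0 = effect (Seq (WAssign ''y'' (WArr ''bp'' (WVar ''a''))) (WAssign ''w'' (WVar ''W''))) s"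
  have s0: "wvar s0 = (wvar s)(''y'' := hd (rev As @ [1]), ''w'' := W)" "warr s0 = warr s" "rarr s0 = rarr s"
    "rvar s0 = rvar s"
    using ch(1) by (auto simp: s0_def W_def)
  define xs where "xs = take W (rev As)"
  define ev where "ev = event_of s"
  have evA: "map ev As = A" using As ev_def by simp
  \<comment> \<open>\<open>y\<close> is read off the whole reversed list and not off
    \<open>post\<close>: the visited list is cut after \<open>W\<close> leaves, and behind the last
    of them \<open>y\<close> may point to a further leaf.\<close>
  define Inv where "Inv pre post u \<longleftrightarrow> wvar u ''y'' = hd (drop (length pre) (rev As) @ [1]) \<and>
    wvar u ''w'' = W - length pre \<and> counts u lev (walked (map ev pre)) \<and> 0 < wvar u ''m'' \<and> wvar u ''M'' \<le> L \<and>
    (\<exists>N. listed u N \<and> distinct N \<and> set N = walked (map ev pre))" for pre post :: "nat list" and u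
  have loop: "runs (While (And (Not (WEq (WVar ''w'') (WConst 0))) (Not (WEq (WVar ''y'') (WConst 1)))) walk_body) s0
    (\<lambda>n s'. Inv xs [] s' \<and> n + 20 * (L - wvar s' ''M'') \<le> 20 * (L - wvar s0 ''M'') +
      (80 + bcost (And (Not (WEq (WVar ''w'') (WConst 0))) (Not (WEq (WVar ''y'') (WConst 1))))) * length xs +
      bcost (And (Not (WEq (WVar ''w'') (WConst 0))) (Not (WEq (WVar ''y'') (WConst 1)))))"
  proof (rule runs_While_list, goal_cases)
    case (1 pre e post u)
    have inv: "wvar u ''y'' = hd (drop (length pre) (rev As) @ [1])" "wvar u ''w'' = W - length pre"
      "counts u lev (walked (map ev pre))" "0 < wvar u ''m''" "wvar u ''M'' \<le> L"
      using 1(2) by (auto simp: Inv_def)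
    obtain N where N: "listed u N" "distinct N" "set N = walked (map ev pre)" using 1(2) by (auto simp: Inv_def)
    have len: "length pre < length xs" using 1(1) by simp
    then have len': "length pre < W" "length pre < length (rev As)" by (simp_all add: xs_def)
    have e: "rev As ! length pre = e"
    proof -
      have "e = xs ! length pre" using 1(1) by simp
      then show ?thesis using len' by (simp add: xs_def)
    qed
    have y: "wvar u ''y'' = e" using inv(1) len' e by (simp add: hd_append hd_drop_conv_nth)
    have "rev As ! length pre \<in> set (rev As)" using len'(2) by (rule nth_mem)
    then have eA: "e \<in> set As" using e by simp
    have pre_sub: "set (map ev pre) \<subseteq> set A"
    proof -
      have "set pre \<subseteq> set xs" using 1(1) by auto
      moreover have "set xs \<subseteq> set (rev As)" unfolding xs_def by (rule set_take_subset)
      ultimately have "set pre \<subseteq> set As" by simp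
      then show ?thesis unfolding evA[symmetric] by auto
    qed
    have evA': "ev e \<in> set A" using eA unfolding evA[symmetric] by simp
    have const: "warr u ''sd'' = warr s ''sd''" "warr u ''iv'' = warr s ''iv''" "warr u ''bp'' = warr s ''bp''"
      "warr u ''level'' = warr s ''level''" "rarr u = rarr s" "rvar u = rvar s"
    proof -
      have w: "warr u v = warr s v" if "v \<notin> {''nb'', ''cnt''}" for v
        using unchangedD(3)[OF 1(3), of v] that s0 by (simp add: walk_body_def activate_changes)
      show "warr u ''sd'' = warr s ''sd''" "warr u ''iv'' = warr s ''iv''" "warr u ''bp'' = warr s ''bp''"
        "warr u ''level'' = warr s ''level''" by (simp_all add: w)
      have "rarr u v = rarr s v" "rvar u v = rvar s v" for v
        using unchangedD(2,4)[OF 1(3), of v] s0 by (simp_all add: walk_body_def activate_changes)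
      then show "rarr u = rarr s" "rvar u = rvar s" by auto
    qed
    obtain i d where id: "ev e = (i, d)" by (cases "ev e")
    then have iv: "warr s ''iv'' e = i" "warr s ''sd'' e = d" by (simp_all add: ev_def)
    have i: "i < n" using index_less[of i d] evA' id by simp
    have fresh: "(i, d) \<notin> set (map ev pre)"
    proof -
      have "distinct A" using distinct_events by simp
      then have "distinct (map ev As)" unfolding evA .
      then have "distinct (map ev (rev As))" unfolding rev_map[symmetric] by simp
      then have "distinct (map ev xs)" unfolding xs_def take_map[symmetric] by simp
      then show ?thesis unfolding 1(1) using id by auto
    qed
    have bp: "warr s ''bp'' e = hd (drop (Suc (length pre)) (rev As) @ [1])"
      using chain_drop[of "warr s ''bp''" "rev As" 1 "length pre"] ch(1) len' e by simp
    define tail where "tail = Seq (WAssign ''y'' (WArr ''bp'' (WVar ''y''))) (WAssign ''w'' (WPred (WVar ''w'')))"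
    have tail: "runs tail v (\<lambda>n v'. v' = v\<lparr>wvar := (wvar v)(''y'' := hd (drop (Suc (length pre)) (rev As) @ [1]),
        ''w'' := W - Suc (length pre))\<rparr> \<and> n \<le> 6)"
      if "wvar v ''y'' = e" "wvar v ''w'' = W - length pre" "warr v ''bp'' = warr s ''bp''" for v
      by (rule runs_loop_free) (use that bp in \<open>auto simp: tail_def\<close>)
    have cond: "bval (And (Not (WEq (WVar ''w'') (WConst 0))) (Not (WEq (WVar ''y'') (WConst 1)))) u"
      using y inv(2) len' eA ch(2) by auto
    have body: "runs walk_body u (\<lambda>n s'. Inv (pre @ [e]) post s' \<and>
      n + 20 * (L - wvar s' ''M'') \<le> 20 * (L - wvar u ''M'') + 80)"
    proof (cases "d = 0 \<and> fst I \<le> snd (Is ! i)")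
      case False
      then have w: "walked (map ev (pre @ [e])) = walked (map ev pre)"
        using id by (auto simp: walked_def)
      show ?thesis unfolding walk_body_def tail_def[symmetric]
      proof (rule runs_Seq, rule runs_If_loop_free_cond, goal_cases)
        case 1
        then show ?case using False y const iv R i by auto
      next
        case 2
        show ?case
        proof (rule runs_loop_free, simp, rule runs_mono[OF tail], goal_cases)
          case (4 n m s')
          then show ?case using inv N w by (auto simp: Inv_def counts_def listed_def)
        qed (use y inv const in auto)
      qed
    next
      case True
      then have w: "walked (map ev (pre @ [e])) = insert i (walked (map ev pre))"
        using id i by (auto simp: walked_def)
      have iw: "i \<notin> walked (map ev pre)" using fresh True by (simp add: walked_def)
      show ?thesis unfolding walk_body_def tail_def[symmetric]
      proof (rule runs_Seq, rule runs_If_loop_free_cond, goal_cases)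
        case 1
        define u1 where "u1 = effect (WAssign ''j'' (WArr ''iv'' (WVar ''y''))) u"
        have u1: "u1 = u\<lparr>wvar := (wvar u)(''j'' := i)\<rparr>" using y const iv by (simp add: u1_def)
        have act: "runs activate u1 (\<lambda>n s'. (counts s' lev (insert i (walked (map ev pre))) \<and> listed s' (N @ [i]) \<and>
          0 < wvar s' ''m'' \<and> wvar u1 ''M'' \<le> wvar s' ''M'' \<and> wvar s' ''M'' \<le> L \<and>
          n + 20 * (L - wvar s' ''M'') \<le> 20 * (L - wvar u1 ''M'') + 50) \<and> unchanged activate u1 s')"
        proof (rule runs_unchanged, rule runs_activate)
          show "counts u1 lev (walked (map ev pre))" "listed u1 N" using inv N u1 by (auto simp: counts_def listed_def)
          show "warr u1 ''level'' i = lev i" using u1 const R i by simp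
          fix M' assume cov: "\<And>l. l \<le> M' \<Longrightarrow> \<exists>i' \<in> insert i (walked (map ev pre)). lev i' = l"
          show "M' < L"
          proof (rule less_new_level[OF cov, where t = "fst I"])
            show "insert i (walked (map ev pre)) \<subseteq> {..<n}" using i by (auto simp: walked_def)
            have "fst (Is ! i') \<le> fst I" "fst I \<le> snd (Is ! i')" if "i' \<in> insert i (walked (map ev pre))" for i'
              using that A_left[of i'] pre_sub evA' id True by (auto simp: walked_def)
            then show "fst I \<in> (\<Inter>i \<in> insert i (walked (map ev pre)). points (Is ! i))" by (auto simp: points_def)
            show "fst I \<in> points I" using valid by (auto simp: points_def is_interval_pair_def)
          qed
        qed (use iw u1 inv in auto)
        show ?case
        proof (rule runs_Seq, rule runs_loop_free, simp, fold u1_def, rule runs_mono[OF act], goal_cases)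
          case (1 n1 n2 v)
          have uv: "wvar v ''y'' = e" "wvar v ''w'' = W - length pre" "warr v ''bp'' = warr s ''bp''"
            using unchangedD[of activate u1 v] 1 u1 y inv const by (auto simp: activate_changes)
          show ?case
          proof (rule runs_mono[OF tail[OF uv]], goal_cases)
            case (1 n3 v')
            have "counts v lev (insert i (walked (map ev pre)))" "listed v (N @ [i])" "0 < wvar v ''m''"
              "wvar v ''M'' \<le> L" "n2 + 20 * (L - wvar v ''M'') \<le> 20 * (L - wvar u1 ''M'') + 50"
              using \<open>_ \<and> unchanged activate u1 v\<close> by auto
            moreover have "distinct (N @ [i])" "set (N @ [i]) = walked (map ev (pre @ [e]))" using N iw w by auto
            ultimately show ?case using 1 w u1 \<open>n1 \<le> _\<close>
              by (auto simp: Inv_def counts_def listed_def intro!: exI[of _ "N @ [i]"])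
          qed
        qed
      next
        case 2
        then show ?case using True y const iv R i by auto
      qed
    qed
    show ?case using cond body by blast
  next
    case (2 u)
    \<comment> \<open>Either the counter has run down to 0, or the list is exhausted and
      \<open>y\<close> is the sentinel.\<close>
    have "length xs = W \<or> drop (length xs) (rev As) = []" by (auto simp: xs_def min_def)
    then show ?case using 2(1) by (auto simp: Inv_def)
  next
    case 3
    have "walked [] = {}" by (simp add: walked_def)
    then show ?case using init s0 by (auto simp: Inv_def counts_def listed_def)
  qed
  have final: "walked (map ev xs) = active A"
  proof -
    have eq: "map ev xs = take W (rev A)" unfolding xs_def evA[symmetric] by (simp add: take_map rev_map)
    have "(i, 1) \<notin> set A" if "i < n" "fst I \<le> snd (Is ! i)" for i using A_right[of i] that by auto
    then show ?thesis unfolding eq active_def walked_def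
      using walk_reaches[OF W[folded W_def]] not_A_right in_set_takeD[of _ W "rev A"] by auto
  qed
  have wk: "walk = Seq (WAssign ''y'' (WArr ''bp'' (WVar ''a''))) (Seq (WAssign ''w'' (WVar ''W''))
    (While (And (Not (WEq (WVar ''w'') (WConst 0))) (Not (WEq (WVar ''y'') (WConst 1)))) walk_body))"
    by (simp add: walk_def)
  show ?thesis unfolding wk
  proof (rule runs_Seq, rule runs_loop_free, simp, rule runs_Seq, rule runs_loop_free, simp, goal_cases)
    case (1 n1 n2)
    have eq: "effect (WAssign ''w'' (WVar ''W'')) (effect (WAssign ''y'' (WArr ''bp'' (WVar ''a''))) s) = s0"
      by (simp add: s0_def)
    show ?case unfolding eq
    proof (rule runs_mono[OF loop], goal_cases)
      case (1 n3 s')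
      have "length xs \<le> W" by (simp add: xs_def)
      moreover have "n3 + 20 * (L - wvar s' ''M'') \<le> 20 * L + 89 * length xs + 9"
        using 1 s0 init(3) by simp
      ultimately have "n1 + (n2 + n3) + 20 * (L - wvar s' ''M'') \<le> 20 * L + 100 * W + 20"
        using \<open>n1 \<le> _\<close> \<open>n2 \<le> _\<close> by simp
      then show ?case using 1 final unfolding Inv_def W_def by auto
    qed
  qed
qed

end

lemma ex_free_level:
  assumes "counts u lev S" "0 < wvar u ''m''"
  shows "\<exists>l \<le> wvar u ''M''. \<forall>i \<in> S. lev i \<noteq> l"
proof -
  have "free_levels lev S (wvar u ''M'') \<noteq> {}" using assms by (auto simp: counts_def)
  then show ?thesis by (auto simp: free_levels_def)
qed

context arrival begin

lemma active_AB: "active (A @ B) \<subseteq> neighbors Is I"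
  unfolding neighbors_eq active_def by auto

text \<open>An interval with an endpoint listed inside \<open>I\<close> meets \<open>I\<close>, and
  it has two endpoints.\<close>

lemma length_B: "length B \<le> 2 * card (neighbors Is I)"
proof -
  have "set B \<subseteq> neighbors Is I \<times> {0, 1}"
  proof
    fix e assume e: "e \<in> set B"
    obtain i d where ed: "e = (i, d)" by (cases e)
    have "e \<in> set (A @ (n, 0) # B @ (n, 1) # C)" using e by simp
    then have d: "d = 0 \<or> d = 1" unfolding set_events ed by simp
    obtain B1 B2 where B: "B = B1 @ (i, d) # B2" using e unfolding ed by (meson split_list)
    have "i \<in> neighbors Is I"
    proof (cases "d = 0")
      case True
      then show ?thesis using active_insert(3)[of B1 i B2] B by simp
    next
      case False
      then have B': "B = B1 @ (i, 1) # B2" using d B by simp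
      have "i \<in> active (A @ B1)" by (rule active_delete(2)[OF B'])
      then show ?thesis unfolding neighbors_eq active_def using B by auto
    qed
    then show "e \<in> neighbors Is I \<times> {0, 1}" using d ed by simp
  qed
  then have "card (set B) \<le> card (neighbors Is I \<times> {0 :: nat, 1})" by (rule card_mono[rotated]) simp
  moreover have "distinct B" using distinct_events by simp
  ultimately show ?thesis by (simp only: distinct_card card_cartesian_product) simp
qed

text \<open>The last part of the invariant remembers, for every position passed, a level up to
  \<open>M\<close> that is free there; these witnesses survive because \<open>M\<close> never
  decreases. At the end they yield \<open>L \<le> M\<close> by \<open>new_level_le\<close>, while
  \<open>M \<le> L\<close> is maintained with \<open>active_step\<close>.\<close>

lemma runs_sweep:
  assumes Bs: "map (event_of s) Bs = B" and ch: "warr s ''bn'' (wvar s ''a'') = hd (Bs @ [wvar s ''b''])"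
      "chain (warr s ''bn'') Bs (wvar s ''b'')" "wvar s ''b'' \<notin> set Bs"
    and level: "\<forall>i < n. warr s ''level'' i = lev i"
    and init: "counts s lev (active A)" "listed s N0" "distinct N0" "set N0 = active A" "0 < wvar s ''m''"
      "wvar s ''M'' \<le> L"
  shows "runs sweep s (\<lambda>n s'. \<exists>N. listed s' N \<and> distinct N \<and> set N = neighbors Is I \<and>
    counts s' lev (active (A @ B)) \<and> wvar s' ''M'' = L \<and> n \<le> 20 * (L - wvar s ''M'') + 100 * length B + 20)"
proof -
  define b where "b = wvar s ''b''"
  define s0 where "s0 = effect (WAssign ''y'' (WArr ''bn'' (WVar ''a''))) s"
  have s0: "s0 = s\<lparr>wvar := (wvar s)(''y'' := hd (Bs @ [b]))\<rparr>" using ch(1) by (simp add: s0_def b_def)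
  define ev where "ev = event_of s"
  have evB: "map ev Bs = B" using Bs ev_def by simp
  define Inv where "Inv pre post u \<longleftrightarrow> wvar u ''y'' = hd (post @ [b]) \<and> counts u lev (active (A @ map ev pre)) \<and>
    0 < wvar u ''m'' \<and> wvar u ''M'' \<le> L \<and>
    (\<exists>N. listed u N \<and> distinct N \<and> set N = active A \<union> {i. (i, 0) \<in> set (map ev pre)}) \<and>
    (\<forall>B1 B2. map ev pre = B1 @ B2 \<longrightarrow> (\<exists>l \<le> wvar u ''M''. \<forall>i \<in> active (A @ B1). lev i \<noteq> l))"
    for pre post :: "nat list" and u
  have cond_cost: "bcost (Not (WEq (WVar ''y'') (WVar ''b''))) = 4" by simp
  have loop: "runs (While (Not (WEq (WVar ''y'') (WVar ''b''))) sweep_body) s0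
    (\<lambda>n s'. Inv Bs [] s' \<and> n + 20 * (L - wvar s' ''M'') \<le> 20 * (L - wvar s0 ''M'') +
      (80 + bcost (Not (WEq (WVar ''y'') (WVar ''b'')))) * length Bs + bcost (Not (WEq (WVar ''y'') (WVar ''b''))))"
  proof (rule runs_While_list, goal_cases)
    case (1 pre e post u)
    define Q where "Q = map ev pre"
    have inv: "wvar u ''y'' = e" "counts u lev (active (A @ Q))" "0 < wvar u ''m''" "wvar u ''M'' \<le> L"
      using 1(2) by (auto simp: Inv_def Q_def)
    have free: "\<exists>l \<le> wvar u ''M''. \<forall>i \<in> active (A @ B1). lev i \<noteq> l" if "Q = B1 @ B2" for B1 B2
      using 1(2) that unfolding Inv_def Q_def by blast
    obtain N where N: "listed u N" "distinct N" "set N = active A \<union> {i. (i, 0) \<in> set Q}"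
      using 1(2) by (auto simp: Inv_def Q_def)
    obtain i d where id: "ev e = (i, d)" by (cases "ev e")
    then have iv: "warr s ''iv'' e = i" "warr s ''sd'' e = d" by (simp_all add: ev_def)
    have B: "B = Q @ (i, d) # map ev post" using evB 1(1) id by (simp add: Q_def)
    have i: "i < n" using index_less[of i d] B by simp
    have "(i, d) \<in> set (A @ (n, 0) # B @ (n, 1) # C)" using B by simp
    then have d: "d = 0 \<or> d = 1" unfolding set_events by simp
    have Q': "map ev (pre @ [e]) = Q @ [(i, d)]" using id by (simp add: Q_def)
    have const: "warr u ''sd'' = warr s ''sd''" "warr u ''iv'' = warr s ''iv''" "warr u ''bn'' = warr s ''bn''"
      "warr u ''level'' = warr s ''level''" "wvar u ''b'' = b"
    proof -
      have w: "warr u v = warr s v" if "v \<notin> {''nb'', ''cnt''}" for v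
        using unchangedD(3)[OF 1(3), of v] that s0 by (simp add: sweep_body_def activate_changes)
      show "warr u ''sd'' = warr s ''sd''" "warr u ''iv'' = warr s ''iv''" "warr u ''bn'' = warr s ''bn''"
        "warr u ''level'' = warr s ''level''" by (simp_all add: w)
      show "wvar u ''b'' = b"
        using unchangedD(1)[OF 1(3), of "''b''"] s0 by (simp add: sweep_body_def activate_changes b_def)
    qed
    have bn: "warr s ''bn'' e = hd (post @ [b])"
      using chain_drop[OF ch(2), of "length pre"] 1(1) by (simp add: b_def)
    have tail: "runs (WAssign ''y'' (WArr ''bn'' (WVar ''y''))) v
        (\<lambda>n v'. v' = v\<lparr>wvar := (wvar v)(''y'' := hd (post @ [b]))\<rparr> \<and> n \<le> 4)"
      if "wvar v ''y'' = e" "warr v ''bn'' = warr s ''bn''" for v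
      by (rule runs_loop_free) (use that bn in auto)
    have next_inv: "Inv (pre @ [e]) post v'"
      if "v' = v\<lparr>wvar := (wvar v)(''y'' := hd (post @ [b]))\<rparr>" "counts v lev (active (A @ Q @ [(i, d)]))"
        "0 < wvar v ''m''" "wvar u ''M'' \<le> wvar v ''M''" "wvar v ''M'' \<le> L" "listed v N'" "distinct N'"
        "set N' = active A \<union> {k. (k, 0) \<in> set (Q @ [(i, d)])}" for v v' N'
    proof -
      \<comment> \<open>The position just reached has a free level because \<open>m\<close> is
        positive; the earlier positions keep the level they had.\<close>
      have "\<exists>l \<le> wvar v ''M''. \<forall>i \<in> active (A @ B1). lev i \<noteq> l" if "Q @ [(i, d)] = B1 @ B2" for B1 B2
      proof (cases B2 rule: rev_cases)
        case Nil
        then have "B1 = Q @ [(i, d)]" using that by simp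
        then show ?thesis using ex_free_level[OF \<open>counts v lev _\<close> \<open>0 < wvar v ''m''\<close>] by simp
      next
        case (snoc B3 x)
        then have "Q = B1 @ B3" using that by simp
        from free[OF this] show ?thesis using \<open>wvar u ''M'' \<le> wvar v ''M''\<close> order_trans by blast
      qed
      then show ?thesis using that unfolding Inv_def Q'
        by (auto simp: counts_def listed_def intro!: exI[of _ N'])
    qed
    define u1 where "u1 = effect (WAssign ''j'' (WArr ''iv'' (WVar ''y''))) u"
    have u1: "u1 = u\<lparr>wvar := (wvar u)(''j'' := i)\<rparr>" using inv const iv by (simp add: u1_def)
    have cond: "bval (Not (WEq (WVar ''y'') (WVar ''b''))) u" using inv const ch(3) 1(1) by (auto simp: b_def)
    have body: "runs sweep_body u (\<lambda>n s'. Inv (pre @ [e]) post s' \<and>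
      n + 20 * (L - wvar s' ''M'') \<le> 20 * (L - wvar u ''M'') + 80)"
    proof (cases "d = 0")
      case True
      then have B': "B = Q @ (i, 0) # map ev post" using B by simp
      note ai = active_insert[OF B']
      have act: "runs activate u1 (\<lambda>n s'. (counts s' lev (insert i (active (A @ Q))) \<and> listed s' (N @ [i]) \<and>
        0 < wvar s' ''m'' \<and> wvar u1 ''M'' \<le> wvar s' ''M'' \<and> wvar s' ''M'' \<le> L \<and>
        n + 20 * (L - wvar s' ''M'') \<le> 20 * (L - wvar u1 ''M'') + 50) \<and> unchanged activate u1 s')"
      proof (rule runs_unchanged, rule runs_activate)
        show "counts u1 lev (active (A @ Q))" "listed u1 N" using inv N u1 by (auto simp: counts_def listed_def)
        show "warr u1 ''level'' i = lev i" using u1 const level i by simp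
        fix M' assume cov: "\<And>l. l \<le> M' \<Longrightarrow> \<exists>i' \<in> insert i (active (A @ Q)). lev i' = l"
        show "M' < L"
        proof (rule less_new_level[OF cov, where t = "fst (Is ! i)"])
          show "insert i (active (A @ Q)) \<subseteq> {..<n}" using i by (auto simp: active_def)
          show "fst (Is ! i) \<in> (\<Inter>i' \<in> insert i (active (A @ Q)). points (Is ! i'))"
            using active_step[OF B'] unfolding ai(1) by blast
          show "fst (Is ! i) \<in> points I" using B_left[of i] B' by (auto simp: points_def)
        qed
      qed (use ai u1 inv in auto)
      have iN: "i \<notin> set N"
      proof -
        have "(i, 0) \<notin> set A" "(i, 0) \<notin> set Q" using distinct_events B' by auto
        then show ?thesis using N by (auto simp: active_def)
      qed
      show ?thesis unfolding sweep_body_def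
      proof (rule runs_Seq, rule runs_loop_free, simp, fold u1_def, rule runs_Seq, rule runs_If_loop_free_cond, goal_cases)
        case (1 n1)
        show ?case
        proof (rule runs_mono[OF act], goal_cases)
          case (1 n2 v)
          have fv: "counts v lev (insert i (active (A @ Q)))" "listed v (N @ [i])" "0 < wvar v ''m''"
            "wvar u1 ''M'' \<le> wvar v ''M''" "wvar v ''M'' \<le> L"
            "n2 + 20 * (L - wvar v ''M'') \<le> 20 * (L - wvar u1 ''M'') + 50" "unchanged activate u1 v"
            using 1(2) by auto
          have yv: "wvar v ''y'' = e" using unchangedD(1)[OF fv(7), of "''y''"] u1 inv by (simp add: activate_changes)
          have bv: "warr v ''bn'' = warr s ''bn''"
            using unchangedD(3)[OF fv(7), of "''bn''"] u1 const by (simp add: activate_changes)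
          show ?case
          proof (rule runs_mono[OF tail[OF yv bv]], goal_cases)
            case (1 n3 v')
            have "Inv (pre @ [e]) post v'"
            proof (rule next_inv)
              show "v' = v\<lparr>wvar := (wvar v)(''y'' := hd (post @ [b]))\<rparr>" using 1 by simp
              show "counts v lev (active (A @ Q @ [(i, d)]))" using fv(1) ai(1) True by simp
              show "wvar u ''M'' \<le> wvar v ''M''" using fv(4) u1 by simp
              show "set (N @ [i]) = active A \<union> {k. (k, 0) \<in> set (Q @ [(i, d)])}" using N True by auto
              show "distinct (N @ [i])" using N iN by simp
            qed (use fv in auto)
            then show ?case using 1 fv(6) u1 \<open>n1 \<le> _\<close> by simp
          qed
        qed
      next
        case (2 n1)
        then show ?case using True const iv inv u1 by simp
      qed
    next
      case False
      then have d1: "d = 1" using d by simp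
      then have B': "B = Q @ (i, 1) # map ev post" using B by simp
      note ad = active_delete[OF B']
      have deact: "runs deactivate u1 (\<lambda>n s'. (counts s' lev (active (A @ Q) - {i}) \<and>
        wvar u1 ''m'' \<le> wvar s' ''m'' \<and> wvar s' ''M'' = wvar u1 ''M'' \<and> n \<le> 50) \<and> unchanged deactivate u1 s')"
      proof (rule runs_unchanged, rule runs_deactivate)
        show "counts u1 lev (active (A @ Q))" using inv u1 by (auto simp: counts_def)
        show "warr u1 ''level'' i = lev i" using u1 const level i by simp
      qed (use ad u1 in auto)
      show ?thesis unfolding sweep_body_def
      proof (rule runs_Seq, rule runs_loop_free, simp, fold u1_def, rule runs_Seq, rule runs_If_loop_free_cond, goal_cases)
        case (1 n1)
        then show ?case using False const iv inv u1 by simp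
      next
        case (2 n1)
        show ?case
        proof (rule runs_mono[OF deact], goal_cases)
          case (1 n2 v)
          have fv: "counts v lev (active (A @ Q) - {i})" "wvar u1 ''m'' \<le> wvar v ''m''"
            "wvar v ''M'' = wvar u1 ''M''" "n2 \<le> 50" "unchanged deactivate u1 v"
            using 1(2) by auto
          have yv: "wvar v ''y'' = e" using unchangedD(1)[OF fv(5), of "''y''"] u1 inv by (simp add: activate_changes)
          have bv: "warr v ''bn'' = warr s ''bn''"
            using unchangedD(3)[OF fv(5), of "''bn''"] u1 const by (simp add: activate_changes)
          have lv: "listed v N"
            using unchangedD(1)[OF fv(5), of "''k''"] unchangedD(3)[OF fv(5), of "''nb''"] u1 N(1)
            by (simp add: activate_changes listed_def)
          show ?case
          proof (rule runs_mono[OF tail[OF yv bv]], goal_cases)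
            case (1 n3 v')
            have "Inv (pre @ [e]) post v'"
            proof (rule next_inv)
              show "v' = v\<lparr>wvar := (wvar v)(''y'' := hd (post @ [b]))\<rparr>" using 1 by simp
              show "counts v lev (active (A @ Q @ [(i, d)]))" using fv(1) ad(1) d1 by simp
              show "0 < wvar v ''m''" using fv(2) inv(3) u1 by simp
              show "wvar u ''M'' \<le> wvar v ''M''" "wvar v ''M'' \<le> L" using fv(3) u1 inv(4) by simp_all
              show "listed v N" by (rule lv)
              show "distinct N" by (rule N(2))
              show "set N = active A \<union> {k. (k, 0) \<in> set (Q @ [(i, d)])}" using N(3) d1 by simp
            qed
            then show ?case using 1 fv(3,4) u1 \<open>n1 \<le> _\<close> by simp
          qed
        qed
      qed
    qed
    show ?case using cond body by blast
  next
    case (2 u)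
    have "wvar u ''b'' = b"
      using unchangedD(1)[OF 2(2), of "''b''"] s0 by (simp add: sweep_body_def activate_changes b_def)
    then show ?case using 2(1) by (simp add: Inv_def)
  next
    case 3
    have "\<exists>l \<le> wvar s ''M''. \<forall>i \<in> active A. lev i \<noteq> l" by (rule ex_free_level[OF init(1,5)])
    then show ?case using init s0 by (auto simp: Inv_def counts_def listed_def intro!: exI[of _ N0])
  qed
  \<comment> \<open>A neighbor contains the left endpoint of \<open>I\<close> or starts inside
    \<open>I\<close>. The walk and the sweep thus enlist every neighbor exactly once.\<close>
  have nb: "active A \<union> {i. (i, 0) \<in> set B} = neighbors Is I"
  proof -
    have "(i, 1) \<notin> set A" "i < n" if left: "(i, 0) \<in> set B" for i
    proof -
      obtain B1 B2 where "B = B1 @ (i, 0) # B2" using left by (meson split_list)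
      from active_insert(4)[OF this] show "(i, 1) \<notin> set A" by simp
      show "i < n" using index_less[of i 0] left by simp
    qed
    then show ?thesis unfolding neighbors_eq active_def by auto
  qed
  show ?thesis unfolding sweep_def
  proof (rule runs_Seq, rule runs_loop_free, simp, fold s0_def, rule runs_mono[OF loop], goal_cases)
    case (1 n1 n2 s')
    have inv: "Inv Bs [] s'" using 1 by simp
    have free: "\<exists>l \<le> wvar s' ''M''. \<forall>i \<in> active (A @ B1). lev i \<noteq> l" if "B = B1 @ B2" for B1 B2
      using inv that unfolding Inv_def evB by blast
    have "L \<le> wvar s' ''M''" by (rule new_level_le[OF free])
    moreover have "wvar s' ''M'' \<le> L" using inv by (simp add: Inv_def)
    ultimately have M_eq: "wvar s' ''M'' = L" by simp
    obtain N where N: "listed s' N" "distinct N" "set N = active A \<union> {i. (i, 0) \<in> set B}"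
      using inv unfolding Inv_def evB by blast
    have "length Bs = length B" using evB by auto
    then have "n1 + n2 \<le> 20 * (L - wvar s ''M'') + 100 * length B + 20"
      using 1 s0 cond_cost by simp
    moreover have "counts s' lev (active (A @ B))" using inv by (simp add: Inv_def evB)
    ultimately show ?case using N nb M_eq by auto
  qed
qed

end


section \<open>Offset, degrees and cleanup\<close>

text \<open>Nonzero counters can occur only on levels of neighbors, so clearing these restores the
  zero array in time proportional to the degree. Doubled degrees are kept by two increments, as the
  machine cannot multiply. The array \<open>u\<close> marks the offsets taken on the new
  level.\<close>

definition finish_body :: com where
  "finish_body = Seq (WAssign ''j'' (WArr ''nb'' (WVar ''q'')))
    (Seq (WAssign ''l'' (WArr ''level'' (WVar ''j'')))
    (Seq (WStore ''cnt'' (WVar ''l'') (WConst 0))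
    (Seq (WStore ''deg'' (WVar ''j'') (WSucc (WSucc (WArr ''deg'' (WVar ''j'')))))
    (Seq (If (WLess (WVar ''W'') (WArr ''deg'' (WVar ''j''))) (WAssign ''W'' (WArr ''deg'' (WVar ''j''))) Skip)
    (Seq (WAssign ''g'' (WSucc (WSucc (WVar ''g''))))
    (Seq (If (WEq (WVar ''l'') (WVar ''M'')) (WStore ''u'' (WArr ''offset'' (WVar ''j'')) (WConst 1)) Skip)
     (WAssign ''q'' (WSucc (WVar ''q'')))))))))"

definition finish_init :: com where
  "finish_init = Seq (WAssign ''q'' (WConst 0)) (Seq (WAssign ''g'' (WConst 2))
    (Seq (WStore ''u'' (WConst 1) (WConst 0)) (WStore ''u'' (WConst 2) (WConst 0))))"

definition commit :: com where
  "commit = Seq (WStore ''deg'' (WVar ''n'') (WVar ''g''))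
    (Seq (If (WLess (WVar ''W'') (WVar ''g'')) (WAssign ''W'' (WVar ''g'')) Skip)
    (Seq (WStore ''level'' (WVar ''n'') (WVar ''M''))
    (Seq (If (WEq (WArr ''u'' (WConst 1)) (WConst 0)) (WStore ''offset'' (WVar ''n'') (WConst 1))
       (If (WEq (WArr ''u'' (WConst 2)) (WConst 0)) (WStore ''offset'' (WVar ''n'') (WConst 2))
         (WStore ''offset'' (WVar ''n'') (WConst 3))))
    (Seq (RStore ''R'' (WVar ''n'') (RVar ''hi'')) (WAssign ''n'' (WSucc (WVar ''n'')))))))"

definition finish :: com where
  "finish = Seq finish_init (Seq (While (WLess (WVar ''q'') (WVar ''k'')) finish_body) commit)"

text \<open>
  \<open>deg\<close> holds twice the degree plus two, a bound on the number of endpoints inside an interval;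
  \<open>W\<close> is its maximum.
\<close>

definition store :: "interval list \<Rightarrow> state \<Rightarrow> bool" where
  "store Is s \<longleftrightarrow> wvar s ''n'' = length Is \<and>
    (\<forall>j < length Is. warr s ''level'' j = level_of Is j \<and> warr s ''offset'' j = offset_of Is j \<and>
      rarr s ''R'' j = snd (Is ! j) \<and> warr s ''deg'' j = 2 * degree Is j + 2 \<and> 2 * degree Is j + 2 \<le> wvar s ''W'') \<and>
    wvar s ''W'' \<le> (if Is = [] then 0 else 2 * max_degree Is + 2)"

text \<open>Some offset among the three is always free, so 3 can be chosen without a test once 1 and
  2 are found taken.\<close>

lemma new_offset_cases:
  assumes "\<forall>J \<in> set (Is @ [I]). is_interval_pair J"
  defines "used k \<equiv> \<exists>j \<in> neighbors Is I. level_of Is j = new_level (config_of Is) I \<and> offset_of Is j = k"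
  shows "new_offset (config_of Is) I = (if \<not> used 1 then 1 else if \<not> used 2 then 2 else 3)"
proof -
  define p where "p = new_offset (config_of Is) I"
  have sym: "intersects I J \<longleftrightarrow> intersects J I" for J by (simp add: intersects_def Int_commute)
  have p: "p \<in> {1, 2, 3}" using new_offset(1)[OF assms(1)] p_def by simp
  have np: "\<not> used p" using new_offset(2)[OF assms(1)] sym unfolding used_def p_def neighbors_def by blast
  have le: "p \<le> k" if "k \<in> {1, 2, 3}" "\<not> used k" for k
    unfolding p_def new_offset_def Ball_config_of case_prod_beta
    by (rule Least_le) (use that sym in \<open>auto simp: used_def neighbors_def\<close>)
  show ?thesis
  proof (cases "used 1")
    case False
    then show ?thesis using le[of 1] p unfolding p_def[symmetric] by auto
  next
    case True
    then have "p \<noteq> 1" using np by blast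
    show ?thesis
    proof (cases "used 2")
      case False
      then show ?thesis using le[of 2] p \<open>p \<noteq> 1\<close> True unfolding p_def[symmetric] by auto
    next
      case True2: True
      then have "p \<noteq> 2" using np by blast
      then show ?thesis using p \<open>p \<noteq> 1\<close> True True2 unfolding p_def[symmetric] by auto
    qed
  qed
qed

context arrival begin

lemma runs_finish:
  assumes st: "store Is s" and N: "listed s N" "distinct N" "set N = neighbors Is I"
    and c: "counts s lev (active (A @ B))" and M: "wvar s ''M'' = L" and hi: "rvar s ''hi'' = snd I"
  shows "runs finish s (\<lambda>k s'. store (Is @ [I]) s' \<and> (\<forall>l. warr s' ''cnt'' l = 0) \<and> k \<le> 100 * length N + 100)"
proof -
  define Wm where "Wm = 2 * max_degree (Is @ [I]) + 2"
  define s0 where "s0 = effect finish_init s"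
  have s0: "wvar s0 = (wvar s)(''q'' := 0, ''g'' := 2)" "rarr s0 = rarr s" "rvar s0 = rvar s"
    "warr s0 = (warr s)(''u'' := (warr s ''u'')(1 := 0, 2 := 0))"
    by (simp_all add: s0_def finish_init_def)
  have stD: "warr s ''level'' j = lev j" "warr s ''offset'' j = offset_of Is j"
    "warr s ''deg'' j = 2 * degree Is j + 2" "2 * degree Is j + 2 \<le> wvar s ''W''" if "j < n" for j
    using st that by (simp_all add: store_def)
  have Wm: "wvar s ''W'' \<le> Wm"
  proof (cases "Is = []")
    case False
    have "max_degree (take n (Is @ [I])) \<le> max_degree (Is @ [I])"
      by (rule max_degree_take_le) (use False in auto)
    then show ?thesis using st False by (simp add: store_def Wm_def)
  qed (use st in \<open>simp add: store_def\<close>)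
  have deg_Wm: "2 * degree (Is @ [I]) j + 2 \<le> Wm" if "j \<le> n" for j
    using degree_le_max_degree[of j "Is @ [I]"] that by (simp add: Wm_def)
  have N_less: "j < n" if "j \<in> set N" for j using that N(3) by (simp add: neighbors_def)
  define used where "used X p \<longleftrightarrow> (\<exists>j \<in> X. lev j = L \<and> offset_of Is j = p)" for X and p :: nat
  define Inv where "Inv pre post v \<longleftrightarrow> wvar v ''q'' = length pre \<and> wvar v ''g'' = 2 + 2 * length pre \<and>
    (\<forall>l. warr v ''cnt'' l = (if l \<in> lev ` set pre then 0 else warr s ''cnt'' l)) \<and>
    (\<forall>j. warr v ''deg'' j = (if j \<in> set pre then warr s ''deg'' j + 2 else warr s ''deg'' j)) \<and>
    (\<forall>j < n. warr v ''deg'' j \<le> wvar v ''W'') \<and> wvar v ''W'' \<le> Wm \<and>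
    (\<forall>p \<in> {1, 2}. warr v ''u'' p = 0 \<longleftrightarrow> \<not> used (set pre) p)" for pre post :: "nat list" and v :: state
  have lf: "loop_free finish_body" by (simp add: finish_body_def)
  have const: "warr v a = warr s a" if "unchanged finish_body s0 v" "a \<in> {''level'', ''offset'', ''nb''}" for v a
    using unchangedD(3)[OF that(1), of a] that(2) s0 by (auto simp: finish_body_def)
  have constw: "wvar v a = wvar s a" if "unchanged finish_body s0 v" "a \<in> {''k'', ''M'', ''n''}" for v a
    using unchangedD(1)[OF that(1), of a] that(2) s0 by (auto simp: finish_body_def)
  have loop: "runs (While (WLess (WVar ''q'') (WVar ''k'')) finish_body) s0
    (\<lambda>m s'. Inv N [] s' \<and> m + 0 \<le> 0 + (80 + bcost (WLess (WVar ''q'') (WVar ''k''))) * length N +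
      bcost (WLess (WVar ''q'') (WVar ''k'')))"
  proof (rule runs_While_list[where \<psi> = "\<lambda>_. 0"], goal_cases)
    case (1 pre e post v)
    have inv: "wvar v ''q'' = length pre" "wvar v ''g'' = 2 + 2 * length pre"
      "\<And>l. warr v ''cnt'' l = (if l \<in> lev ` set pre then 0 else warr s ''cnt'' l)"
      "\<And>j. warr v ''deg'' j = (if j \<in> set pre then warr s ''deg'' j + 2 else warr s ''deg'' j)"
      "\<And>j. j < n \<Longrightarrow> warr v ''deg'' j \<le> wvar v ''W''" "wvar v ''W'' \<le> Wm"
      using 1(2) unfolding Inv_def by blast+
    from 1(2) have inv_u: "\<forall>p \<in> {1, 2}. warr v ''u'' p = 0 \<longleftrightarrow> \<not> used (set pre) p"
      unfolding Inv_def by (elim conjE)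
    have e: "e < n" "e \<notin> set pre" using 1(1) N(2) N_less[of e] by auto
    have k: "wvar v ''k'' = length N" using constw[OF 1(3), of "''k''"] N(1) by (simp add: listed_def)
    have nbe: "warr v ''nb'' (length pre) = e"
      using const[OF 1(3), of "''nb''"] N(1) 1(1) by (simp add: listed_def)
    have lve: "warr v ''level'' e = lev e" and ofe: "warr v ''offset'' e = offset_of Is e"
      using const[OF 1(3)] stD[OF e(1)] by simp_all
    have Mv: "wvar v ''M'' = L" using constw[OF 1(3), of "''M''"] M by simp
    define D where "D = warr s ''deg'' e + 2"
    have D: "warr v ''deg'' e + 2 = D" using inv(4)[of e] e(2) by (simp add: D_def)
    \<comment> \<open>As a neighbor of \<open>I\<close>, \<open>e\<close> has gained one in degree,
      so its doubled degree grows by two and stays within the new maximum.\<close>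
    have DW: "D \<le> Wm"
    proof -
      have "e \<in> neighbors Is I" using 1(1) N(3) by auto
      then show ?thesis using degree_snoc[OF e(1), of I] deg_Wm[of e] stD(3)[OF e(1)] e(1) by (simp add: D_def)
    qed
    define v' where "v' = effect finish_body v"
    have v': "wvar v' ''q'' = Suc (length pre)" "wvar v' ''g'' = Suc (Suc (wvar v ''g''))"
      "warr v' ''cnt'' = (warr v ''cnt'')(lev e := 0)"
      "warr v' ''deg'' = (warr v ''deg'')(e := D)"
      "wvar v' ''W'' = max (wvar v ''W'') D"
      "warr v' ''u'' = (if lev e = L then (warr v ''u'')(offset_of Is e := 1) else warr v ''u'')"
      unfolding v'_def finish_body_def by (simp_all add: inv(1) nbe lve ofe Mv D[symmetric] max_def)
    have usedS: "used (set (pre @ [e])) p \<longleftrightarrow> used (set pre) p \<or> (lev e = L \<and> offset_of Is e = p)" for p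
      by (auto simp: used_def)
    have "Inv (pre @ [e]) post v'"
      unfolding Inv_def
    proof (intro conjI allI impI ballI)
      fix l show "warr v' ''cnt'' l = (if l \<in> lev ` set (pre @ [e]) then 0 else warr s ''cnt'' l)"
        using v'(3) inv(3)[of l] by auto
    next
      fix j show "warr v' ''deg'' j = (if j \<in> set (pre @ [e]) then warr s ''deg'' j + 2 else warr s ''deg'' j)"
        using v'(4) inv(4)[of j] by (auto simp: D_def)
    next
      fix j assume "j < n"
      then show "warr v' ''deg'' j \<le> wvar v' ''W''" using v'(4,5) inv(5)[of j] by auto
    next
      fix p :: nat assume "p \<in> {1, 2}"
      with inv_u have "warr v ''u'' p = 0 \<longleftrightarrow> \<not> used (set pre) p" by (rule bspec)
      then show "warr v' ''u'' p = 0 \<longleftrightarrow> \<not> used (set (pre @ [e])) p" using v'(6) usedS[of p] by auto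
    qed (use v' inv DW in auto)
    then have "runs finish_body v (\<lambda>m s'. Inv (pre @ [e]) post s' \<and> m + 0 \<le> 0 + 80)"
      by (intro runs_loop_free[OF lf]) (simp add: v'_def finish_body_def)
    moreover have "bval (WLess (WVar ''q'') (WVar ''k'')) v" using inv(1) k 1(1) by simp
    ultimately show ?case by blast
  next
    case (2 v)
    then show ?case using constw[OF 2(2), of "''k''"] N(1) by (simp add: Inv_def listed_def)
  next
    case 3
    have "\<not> used {} p" for p by (simp add: used_def)
    then show ?case using s0 stD Wm by (auto simp: Inv_def)
  qed
  have lfr: "loop_free commit" by (simp add: commit_def)
  show ?thesis unfolding finish_def
  proof (rule runs_Seq, rule runs_loop_free, simp add: finish_init_def, fold s0_def, rule runs_Seq,
      rule runs_mono[OF runs_unchanged[OF loop]], rule runs_loop_free[OF lfr], goal_cases)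
    case (1 m1 m2 v m3)
    have inv: "Inv N [] v" and m2: "m2 \<le> 87 * length N + 10" and un: "unchanged finish_body s0 v"
      using 1(3) by (auto simp: unchanged_def)
    define v' where "v' = effect commit v"
    have nv: "wvar v ''n'' = n" "wvar v ''M'' = L"
      using constw[OF un] st M by (simp_all add: store_def)
    have hiv: "rvar v ''hi'' = snd I" "rarr v ''R'' = rarr s ''R''"
      using unchangedD(2,4)[OF un] s0 hi by (simp_all add: finish_body_def)
    have u12: "warr v ''u'' (Suc 0) = 0 \<longleftrightarrow> \<not> used (neighbors Is I) 1" "warr v ''u'' 2 = 0 \<longleftrightarrow> \<not> used (neighbors Is I) 2"
      using inv N(3) by (auto simp: Inv_def)
    have g: "wvar v ''g'' = 2 * degree (Is @ [I]) n + 2"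
    proof -
      have "length N = card (neighbors Is I)" using N by (metis distinct_card)
      then show ?thesis using inv by (simp add: Inv_def degree_new)
    qed
    define p where "p = new_offset (config_of Is) I"
    have p: "p = (if \<not> used (neighbors Is I) 1 then 1 else if \<not> used (neighbors Is I) 2 then 2 else 3)"
      unfolding p_def used_def by (rule new_offset_cases[OF valid])
    have v': "wvar v' ''n'' = Suc n" "warr v' ''deg'' = (warr v ''deg'')(n := wvar v ''g'')"
      "wvar v' ''W'' = max (wvar v ''W'') (wvar v ''g'')" "warr v' ''level'' = (warr v ''level'')(n := L)"
      "warr v' ''offset'' = (warr v ''offset'')(n := p)" "rarr v' ''R'' = (rarr s ''R'')(n := snd I)"
      "warr v' ''cnt'' = warr v ''cnt''"
      unfolding v'_def commit_def using p u12
      by (cases "used (neighbors Is I) 1"; cases "used (neighbors Is I) 2"; simp add: nv hiv max_def)+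
    have deg: "warr v ''deg'' j = 2 * degree (Is @ [I]) j + 2" if "j < n" for j
      using inv stD(3)[OF that] degree_snoc[OF that, of I] N(3) by (simp add: Inv_def)
    have "store (Is @ [I]) v'"
      unfolding store_def
    proof (intro conjI allI impI)
      fix j assume "j < length (Is @ [I])"
      then consider "j < n" | "j = n" by fastforce
      note j = this
      show "warr v' ''level'' j = level_of (Is @ [I]) j"
        using j by cases (use v'(4) const[OF un, of "''level''"] stD(1) in \<open>simp_all add: nth_kt_sls_snoc\<close>)
      show "warr v' ''offset'' j = offset_of (Is @ [I]) j"
        using j by cases (use v'(5) const[OF un, of "''offset''"] stD(2) p_def in \<open>simp_all add: nth_kt_sls_snoc\<close>)
      show "rarr v' ''R'' j = snd ((Is @ [I]) ! j)"
        using j by cases (use v'(6) st in \<open>simp_all add: store_def nth_append\<close>)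
      show "warr v' ''deg'' j = 2 * degree (Is @ [I]) j + 2"
        using j by cases (use v'(2) deg g in simp_all)
      show "2 * degree (Is @ [I]) j + 2 \<le> wvar v' ''W''"
        using j
      proof cases
        case 1
        have "\<forall>j < n. warr v ''deg'' j \<le> wvar v ''W''" using inv unfolding Inv_def by (elim conjE)
        with 1 have "warr v ''deg'' j \<le> wvar v ''W''" by blast
        then show ?thesis using deg[OF 1] v'(3) by simp
      next
        case 2
        then show ?thesis using g v'(3) by simp
      qed
    next
      have "wvar v ''W'' \<le> Wm" using inv by (simp add: Inv_def)
      then show "wvar v' ''W'' \<le> (if Is @ [I] = [] then 0 else 2 * max_degree (Is @ [I]) + 2)"
        using v'(3) g deg_Wm[of n] by (simp add: Wm_def)
    qed (use v' in simp)
    \<comment> \<open>A level carried by no neighbor has counter 0 already, because the intervals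
      still active after the sweep are neighbors.\<close>
    moreover have "warr v' ''cnt'' l = 0" for l
    proof (cases "l \<in> lev ` set N")
      case False
      then have "{i \<in> active (A @ B). lev i = l} = {}" using active_AB N(3) by auto
      then have "warr s ''cnt'' l = 0" using c by (simp add: counts_def)
      then show ?thesis using inv v'(7) by (simp add: Inv_def)
    qed (use inv v'(7) in \<open>simp add: Inv_def\<close>)
    moreover have "m1 \<le> 20" using 1(1) by (simp add: finish_init_def)
    moreover have "m3 \<le> 60" using 1(4) by (simp add: commit_def)
    ultimately show ?case unfolding v'_def[symmetric] using m2 by simp
  qed
qed

end

section \<open>The complete program\<close>

text \<open>One such frame lemma per phase of an arrival. The exceptions cover the names a phase may
  write, so each part of the invariant is carried over the phases that do not touch it.\<close>

lemma exec_insert_leaf_unchanged: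
  assumes "exec (insert_leaf tst v side) s k s'"
  shows "a \<notin> {''x'', ''y'', ''z'', ''d'', ''fr'', ''top''} \<Longrightarrow> wvar s' a = wvar s a"
    "a \<notin> {''nx'', ''dn'', ''ct'', ''bn'', ''bp'', ''iv'', ''sd''} \<Longrightarrow> warr s' a = warr s a"
    "rvar s' = rvar s"
    "b \<noteq> ''ky'' \<Longrightarrow> rarr s' b = rarr s b"
proof -
  note u = unchangedD[OF exec_unchanged[OF assms]]
  have w: "wvars (insert_leaf tst v side) \<subseteq> {''x'', ''y'', ''z'', ''d'', ''fr'', ''top''}"
    by (simp add: insert_leaf_def grow_root_def descend_def scan_def split_def
    split_body_def add_leaf_def link_def attach_def)
  have a: "warrs (insert_leaf tst v side) \<subseteq> {''nx'', ''dn'', ''ct'', ''bn'', ''bp'', ''iv'', ''sd''}"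
    by (simp add: insert_leaf_def grow_root_def descend_def scan_def split_def
    split_body_def add_leaf_def link_def attach_def)
  show "wvar s' a = wvar s a" if "a \<notin> {''x'', ''y'', ''z'', ''d'', ''fr'', ''top''}"
    by (rule u(1)) (rule contra_subsetD[OF w that])
  show "warr s' a = warr s a" if "a \<notin> {''nx'', ''dn'', ''ct'', ''bn'', ''bp'', ''iv'', ''sd''}"
    by (rule u(3)) (rule contra_subsetD[OF a that])
  have "rvars (insert_leaf tst v side) = {}"
    by (simp add: insert_leaf_def grow_root_def descend_def scan_def split_def
    split_body_def add_leaf_def link_def attach_def)
  then show "rvar s' = rvar s" by (intro ext u(2)) simp
  have r: "rarrs (insert_leaf tst v side) \<subseteq> {''ky''}"
    by (simp add: insert_leaf_def grow_root_def descend_def scan_def split_def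
    split_body_def add_leaf_def link_def attach_def)
  show "rarr s' b = rarr s b" if "b \<noteq> ''ky''"
    by (rule u(4), rule contra_subsetD[OF r]) (use that in simp)
qed

lemma exec_walk_unchanged:
  assumes "exec walk s k s'"
  shows "a \<notin> {''y'', ''w'', ''j'', ''k'', ''l'', ''m'', ''M''} \<Longrightarrow> wvar s' a = wvar s a"
    "a \<notin> {''nb'', ''cnt''} \<Longrightarrow> warr s' a = warr s a"
    "rvar s' = rvar s"
    "rarr s' = rarr s"
proof -
  note u = unchangedD[OF exec_unchanged[OF assms]]
  have w: "wvars walk \<subseteq> {''y'', ''w'', ''j'', ''k'', ''l'', ''m'', ''M''}"
    by (simp add: walk_def walk_body_def activate_changes)
  have a: "warrs walk \<subseteq> {''nb'', ''cnt''}"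
    by (simp add: walk_def walk_body_def activate_changes)
  show "wvar s' a = wvar s a" if "a \<notin> {''y'', ''w'', ''j'', ''k'', ''l'', ''m'', ''M''}"
    by (rule u(1)) (rule contra_subsetD[OF w that])
  show "warr s' a = warr s a" if "a \<notin> {''nb'', ''cnt''}"
    by (rule u(3)) (rule contra_subsetD[OF a that])
  have "rvars walk = {}" by (simp add: walk_def walk_body_def activate_changes)
  then show "rvar s' = rvar s" by (intro ext u(2)) simp
  have "rarrs walk = {}" by (simp add: walk_def walk_body_def activate_changes)
  then show "rarr s' = rarr s" by (intro ext u(4)) simp
qed

lemma exec_sweep_unchanged:
  assumes "exec sweep s k s'"
  shows "a \<notin> {''y'', ''j'', ''k'', ''l'', ''m'', ''M''} \<Longrightarrow> wvar s' a = wvar s a"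
    "a \<notin> {''nb'', ''cnt''} \<Longrightarrow> warr s' a = warr s a"
    "rvar s' = rvar s"
    "rarr s' = rarr s"
proof -
  note u = unchangedD[OF exec_unchanged[OF assms]]
  have w: "wvars sweep \<subseteq> {''y'', ''j'', ''k'', ''l'', ''m'', ''M''}"
    by (simp add: sweep_def sweep_body_def activate_changes)
  have a: "warrs sweep \<subseteq> {''nb'', ''cnt''}"
    by (simp add: sweep_def sweep_body_def activate_changes)
  show "wvar s' a = wvar s a" if "a \<notin> {''y'', ''j'', ''k'', ''l'', ''m'', ''M''}"
    by (rule u(1)) (rule contra_subsetD[OF w that])
  show "warr s' a = warr s a" if "a \<notin> {''nb'', ''cnt''}"
    by (rule u(3)) (rule contra_subsetD[OF a that])
  have "rvars sweep = {}" by (simp add: sweep_def sweep_body_def activate_changes)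
  then show "rvar s' = rvar s" by (intro ext u(2)) simp
  have "rarrs sweep = {}" by (simp add: sweep_def sweep_body_def activate_changes)
  then show "rarr s' = rarr s" by (intro ext u(4)) simp
qed

lemma exec_finish_unchanged:
  assumes "exec finish s k s'"
  shows "a \<notin> {''j'', ''l'', ''W'', ''g'', ''q'', ''n''} \<Longrightarrow> wvar s' a = wvar s a"
    "a \<notin> {''cnt'', ''deg'', ''u'', ''level'', ''offset''} \<Longrightarrow> warr s' a = warr s a"
    "b \<noteq> ''R'' \<Longrightarrow> rarr s' b = rarr s b"
proof -
  note u = unchangedD[OF exec_unchanged[OF assms]]
  have w: "wvars finish \<subseteq> {''j'', ''l'', ''W'', ''g'', ''q'', ''n''}"
    by (simp add: finish_def finish_init_def finish_body_def commit_def)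
  have a: "warrs finish \<subseteq> {''cnt'', ''deg'', ''u'', ''level'', ''offset''}"
    by (simp add: finish_def finish_init_def finish_body_def commit_def)
  show "wvar s' a = wvar s a" if "a \<notin> {''j'', ''l'', ''W'', ''g'', ''q'', ''n''}"
    by (rule u(1)) (rule contra_subsetD[OF w that])
  show "warr s' a = warr s a" if "a \<notin> {''cnt'', ''deg'', ''u'', ''level'', ''offset''}"
    by (rule u(3)) (rule contra_subsetD[OF a that])
  have r: "rarrs finish \<subseteq> {''R''}"
    by (simp add: finish_def finish_init_def finish_body_def commit_def)
  show "rarr s' b = rarr s b" if "b \<noteq> ''R''"
    by (rule u(4), rule contra_subsetD[OF r]) (use that in simp)
qed

text \<open>Strict here and nonstrict in \<open>right_test\<close>: a left endpoint is placed in
  front of all events at its coordinate and a right endpoint behind them, as the order of closed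
  intervals demands.\<close>

definition left_test :: "wexp \<Rightarrow> bexp" where
  "left_test e = RLess (RArr ''ky'' e) (RVar ''lo'')"

definition right_test :: "wexp \<Rightarrow> bexp" where
  "right_test e = Not (RLess (RVar ''hi'') (RArr ''ky'' e))"

definition start :: com where
  "start = Seq (WAssign ''k'' (WConst 0)) (Seq (WAssign ''M'' (WConst 0)) (WAssign ''m'' (WConst 1)))"

definition arrive :: com where
  "arrive = Seq (insert_leaf left_test ''lo'' 0) (Seq (WAssign ''a'' (WVar ''z''))
    (Seq (insert_leaf right_test ''hi'' 1) (Seq (WAssign ''b'' (WVar ''z''))
    (Seq start (Seq walk (Seq sweep finish))))))"

text \<open>The list of leaves is a schedule once each leaf is read as an event through
  \<open>iv\<close> and \<open>sd\<close>. Zero counters let the next arrival start from the empty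
  active set at no cost.\<close>

definition invariant :: "interval list \<Rightarrow> state \<Rightarrow> bool" where
  "invariant Is s \<longleftrightarrow> (\<exists>h es. index s h es \<and> schedule Is (map (event_of s) es) \<and>
    (\<forall>e \<in> set es. rarr s ''ky'' e = event_key Is (event_of s e))) \<and>
    store Is s \<and> (\<forall>l. warr s ''cnt'' l = 0)"

lemma store_cong:
  assumes "wvar s' ''n'' = wvar s ''n''" "wvar s' ''W'' = wvar s ''W''" "rarr s' ''R'' = rarr s ''R''"
    "\<And>a. a \<in> {''level'', ''offset'', ''deg''} \<Longrightarrow> warr s' a = warr s a"
  shows "store Is s \<Longrightarrow> store Is s'"
  using assms unfolding store_def by simp

lemma index_chains:
  assumes "index s h (us @ a # bs @ b # cs)"
  shows "chain (warr s ''bp'') (a # rev us) 1" "warr s ''bn'' a = hd (bs @ [b])" "chain (warr s ''bn'') bs b"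
    "1 \<notin> set us" "b \<notin> set bs"
proof -
  have "chain (warr s ''bp'') (rev cs @ b # rev bs @ a # rev us) 1"
    "chain (warr s ''bn'') ((1 # us) @ a # bs @ b # cs) 0"
    using assms by (simp_all add: index_def)
  then show "chain (warr s ''bp'') (a # rev us) 1" "warr s ''bn'' a = hd (bs @ [b])" "chain (warr s ''bn'') bs b"
    unfolding chain_append chain.simps by (simp_all add: hd_append)
  show "1 \<notin> set us" "b \<notin> set bs" using index_leaves(1)[OF assms] by auto
qed

text \<open>The two heights are those of the tree in front of the two searches, over at most
  \<open>2 (length Is + 1)\<close> leaves each, counting the sentinel and, for the second search,
  the new left endpoint.\<close>

lemma runs_arrive:
  assumes valid: "\<forall>J \<in> set (Is @ [I]). is_interval_pair J" and inv: "invariant Is s"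
    and lo: "rvar s ''lo'' = fst I" and hi: "rvar s ''hi'' = snd I"
  shows "runs arrive s (\<lambda>k s'. invariant (Is @ [I]) s' \<and>
    (\<exists>h h'. 2 ^ h \<le> 2 * (length Is + 1) \<and> 2 ^ h' \<le> 2 * (length Is + 1) \<and>
      k \<le> 200 * h + 200 * h' + 600 * max_degree (Is @ [I]) + 2000))"
proof -
  define n where "n = length Is"
  have I: "fst I \<le> snd I" using valid by (simp add: is_interval_pair_def)
  obtain h es where ix: "index s h es" and sch: "schedule Is (map (event_of s) es)"
    and ky: "\<forall>e \<in> set es. rarr s ''ky'' e = event_key Is (event_of s e)"
    and st: "store Is s" and cnt: "\<forall>l. warr s ''cnt'' l = 0"
    using inv unfolding invariant_def by blast
  obtain us vs where uv: "map (event_of s) es = us @ vs"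
    and us: "\<forall>u \<in> set us. event_key Is u < fst I" and vs: "\<forall>w \<in> set vs. \<not> event_key Is w < fst I"
  proof -
    have "sorted_wrt (before Is) (map (event_of s) es)" using sch by (simp add: schedule_def)
    then have "\<exists>us vs. map (event_of s) es = us @ vs \<and> (\<forall>u \<in> set us. event_key Is u < fst I) \<and>
        (\<forall>w \<in> set vs. \<not> event_key Is w < fst I)"
      by (rule sorted_split) simp
    then show ?thesis using that by blast
  qed
  obtain Us Vs where es: "es = Us @ Vs" and Us: "map (event_of s) Us = us" and Vs: "map (event_of s) Vs = vs"
    using uv by (auto simp: map_eq_append_conv)
  have sch1: "schedule Is (us @ vs)" using sch uv by simp
  have len_es: "length es = 2 * n"
  proof -
    have "distinct (us @ vs)" "set (us @ vs) = {..<n} \<times> {0, 1}" using sch1 by (simp_all add: schedule_def n_def)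
    then have "length (us @ vs) = card ({..<n} \<times> {0 :: nat, 1})" using distinct_card[of "us @ vs"] by simp
    also have "\<dots> = 2 * n" by (simp add: card_cartesian_product)
    finally show ?thesis using arg_cong[OF uv, of length] by simp
  qed
  have fr: "e < wvar s ''fr''" if "e \<in> set es" for e using index_leaves(2)[OF ix, of e] that by simp
  have nn: "wvar s ''n'' = n" using st by (simp add: store_def n_def)
  have t1: "is_test left_test (\<lambda>x. x < fst I) (rvar s)"
    by (auto simp: is_test_def left_test_def lo)
  have ins1: "runs (insert_leaf left_test ''lo'' 0) s (\<lambda>k s'. \<exists>h'. index s' h' (Us @ wvar s' ''z'' # Vs) \<and>
    wvar s ''fr'' \<le> wvar s' ''z'' \<and> (\<forall>a < wvar s ''fr''. rarr s' ''ky'' a = rarr s ''ky'' a) \<and>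
    rarr s' ''ky'' (wvar s' ''z'') = rvar s ''lo'' \<and>
    warr s' ''iv'' = (warr s ''iv'')(wvar s' ''z'' := wvar s ''n'') \<and>
    warr s' ''sd'' = (warr s ''sd'')(wvar s' ''z'' := 0) \<and> k \<le> 200 * h + 500)"
  proof (rule runs_insert_leaf[OF ix[unfolded es] t1])
    show "\<forall>u \<in> set Us. rarr s ''ky'' u < fst I" using ky us es Us by auto
    show "\<forall>w \<in> set Vs. \<not> rarr s ''ky'' w < fst I" using ky vs es Vs by auto
  qed
  show ?thesis unfolding arrive_def
  proof (rule runs_Seq, rule runs_mono[OF ins1], rule runs_Seq, rule runs_loop_free, simp, rule runs_Seq, goal_cases)
    case (1 k1 s1 k2)
    define z1 where "z1 = wvar s1 ''z''"
    obtain h1 where ix1: "index s1 h1 (Us @ z1 # Vs)" and z1: "wvar s ''fr'' \<le> z1"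
      and ky1: "\<forall>a < wvar s ''fr''. rarr s1 ''ky'' a = rarr s ''ky'' a" and kz1: "rarr s1 ''ky'' z1 = fst I"
      and iv1: "warr s1 ''iv'' = (warr s ''iv'')(z1 := n)" and sd1: "warr s1 ''sd'' = (warr s ''sd'')(z1 := 0)"
      and k1: "k1 \<le> 200 * h + 500"
      using 1(2) lo nn unfolding z1_def by auto
    note c1 = exec_insert_leaf_unchanged[OF 1(1)]
    define s2 where "s2 = effect (WAssign ''a'' (WVar ''z'')) s1"
    have s2: "s2 = s1\<lparr>wvar := (wvar s1)(''a'' := z1)\<rparr>" by (simp add: s2_def z1_def)
    have ix2: "index s2 h1 (Us @ z1 # Vs)" by (rule index_cong[OF _ _ _ _ ix1]) (use s2 in auto)
    have ev2: "event_of s2 e = event_of s e" if "e \<in> set es" for e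
      using fr[OF that] z1 iv1 sd1 s2 by simp
    have ev2z: "event_of s2 z1 = (n, 0)" using iv1 sd1 s2 by simp
    have map2: "map (event_of s2) (Us @ z1 # Vs) = us @ (n, 0) # vs"
    proof -
      have m: "map (event_of s2) xs = map (event_of s) xs" if "set xs \<subseteq> set es" for xs
        by (rule map_cong[OF refl], rule ev2) (use that in blast)
      have "set Us \<subseteq> set es" "set Vs \<subseteq> set es" using es by auto
      then have "map (event_of s2) Us = us" "map (event_of s2) Vs = vs"
        using trans[OF m Us] trans[OF m Vs] by blast+
      then show ?thesis using ev2z by (simp only: map_append list.map)
    qed
    have in_range: "fst (event_of s e) < n" if "e \<in> set es" for e
    proof -
      have "set (us @ vs) = {..<n} \<times> {0, 1}" using sch1 by (simp add: schedule_def n_def)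
      then have "event_of s ` set es = {..<n} \<times> {0, 1}" using arg_cong[OF uv, of set] by simp
      then have "event_of s e \<in> {..<n} \<times> {0, 1}" using imageI[OF that, of "event_of s"] by simp
      then show ?thesis by simp
    qed
    have ky2: "rarr s2 ''ky'' e = event_key (Is @ [I]) (event_of s2 e)" if "e \<in> set (Us @ z1 # Vs)" for e
    proof (cases "e = z1")
      case True
      then show ?thesis using kz1 s2 ev2z by (simp add: event_key_def n_def)
    next
      case False
      then have e: "e \<in> set es" using that es by auto
      then have "rarr s2 ''ky'' e = event_key Is (event_of s e)" using ky1 fr ky s2 by simp
      also have "\<dots> = event_key (Is @ [I]) (event_of s e)"
        using in_range[OF e] by (simp add: event_key_def nth_append n_def)
      finally show ?thesis using ev2[OF e] by simp
    qed
    obtain us' vs' where uv': "us @ (n, 0) # vs = us' @ vs'"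
      and us': "\<forall>u \<in> set us'. event_key (Is @ [I]) u \<le> snd I" and vs': "\<forall>w \<in> set vs'. \<not> event_key (Is @ [I]) w \<le> snd I"
    proof -
      have "\<exists>us' vs'. us @ (n, 0) # vs = us' @ vs' \<and> (\<forall>u \<in> set us'. event_key (Is @ [I]) u \<le> snd I) \<and>
          (\<forall>w \<in> set vs'. \<not> event_key (Is @ [I]) w \<le> snd I)"
        by (rule sorted_split[OF sorted_insert_left[OF sch1 us vs, folded n_def]]) simp
      then show ?thesis using that by blast
    qed
    obtain B where B: "us' = us @ (n, 0) # B" "vs = B @ vs'"
      and sch': "schedule (Is @ [I]) (us @ (n, 0) # B @ (n, 1) # vs')"
      using schedule_insert[OF I sch1 n_def us vs uv' us' vs'] by blast
    obtain Bs Cs where Vs': "Vs = Bs @ Cs" and Bs: "map (event_of s) Bs = B" and Cs: "map (event_of s) Cs = vs'"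
      using Vs unfolding B(2) by (auto simp: map_eq_append_conv)
    have sub: "set Us \<subseteq> set es" "set Bs \<subseteq> set es" "set Cs \<subseteq> set es" using es Vs' by auto
    have mp2: "map (event_of s2) Us = us" "map (event_of s2) Bs = B" "map (event_of s2) Cs = vs'"
    proof -
      have m: "map (event_of s2) xs = map (event_of s) xs" if "set xs \<subseteq> set es" for xs
        by (rule map_cong[OF refl], rule ev2) (use that in blast)
      show "map (event_of s2) Us = us" "map (event_of s2) Bs = B" "map (event_of s2) Cs = vs'"
        by (rule trans[OF m[OF sub(1)] Us] trans[OF m[OF sub(2)] Bs] trans[OF m[OF sub(3)] Cs])+
    qed
    have rv2: "rvar s2 = rvar s" using c1(3) s2 by simp
    have t2: "is_test right_test (\<lambda>x. x \<le> snd I) (rvar s2)"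
      by (auto simp: is_test_def right_test_def rv2 hi not_less)
    have ix2': "index s2 h1 ((Us @ z1 # Bs) @ Cs)" using ix2 Vs' by simp
    have n2: "wvar s2 ''n'' = n" using c1(1)[of "''n''"] s2 nn by simp
    have ins2: "runs (insert_leaf right_test ''hi'' 1) s2 (\<lambda>k s'. \<exists>h'. index s' h' ((Us @ z1 # Bs) @ wvar s' ''z'' # Cs) \<and>
      wvar s2 ''fr'' \<le> wvar s' ''z'' \<and> (\<forall>a < wvar s2 ''fr''. rarr s' ''ky'' a = rarr s2 ''ky'' a) \<and>
      rarr s' ''ky'' (wvar s' ''z'') = rvar s2 ''hi'' \<and>
      warr s' ''iv'' = (warr s2 ''iv'')(wvar s' ''z'' := wvar s2 ''n'') \<and>
      warr s' ''sd'' = (warr s2 ''sd'')(wvar s' ''z'' := 1) \<and> k \<le> 200 * h1 + 500)"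
    proof (rule runs_insert_leaf[OF ix2' t2])
      show "\<forall>u \<in> set (Us @ z1 # Bs). rarr s2 ''ky'' u \<le> snd I"
      proof
        fix u assume u: "u \<in> set (Us @ z1 # Bs)"
        then have "event_of s2 u \<in> event_of s2 ` set (Us @ z1 # Bs)" by (rule imageI)
        also have "\<dots> = set us'" unfolding B(1) mp2(1,2)[symmetric] ev2z[symmetric] by (simp add: image_Un)
        finally show "rarr s2 ''ky'' u \<le> snd I" using us' ky2[of u] u Vs' by auto
      qed
      show "\<forall>w \<in> set Cs. \<not> rarr s2 ''ky'' w \<le> snd I"
      proof
        fix w assume w: "w \<in> set Cs"
        then have "event_of s2 w \<in> event_of s2 ` set Cs" by (rule imageI)
        also have "\<dots> = set vs'" unfolding mp2(3)[symmetric] by simp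
        finally show "\<not> rarr s2 ''ky'' w \<le> snd I" using vs' ky2[of w] w Vs' by auto
      qed
    qed
    have k2: "k2 \<le> 2" using 1(3) by simp
    have hb: "2 ^ h \<le> 2 * (n + 1)" using index_leaves(3)[OF ix] len_es by simp
    have hb1: "2 ^ h1 \<le> 2 * (n + 1)" using index_leaves(3)[OF ix1] len_es es by simp
    show ?case unfolding s2_def[symmetric]
    proof (rule runs_mono[OF ins2], rule runs_Seq, rule runs_loop_free, simp, rule runs_Seq, rule runs_loop_free,
        simp add: start_def, rule runs_Seq, goal_cases)
      case (1 k3 s3 k4 k5)
      define z2 where "z2 = wvar s3 ''z''"
      obtain h2 where ix3: "index s3 h2 (Us @ z1 # Bs @ z2 # Cs)" and z2: "wvar s2 ''fr'' \<le> z2"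
        and ky3: "\<forall>a < wvar s2 ''fr''. rarr s3 ''ky'' a = rarr s2 ''ky'' a" and kz2: "rarr s3 ''ky'' z2 = snd I"
        and iv3: "warr s3 ''iv'' = (warr s2 ''iv'')(z2 := n)" and sd3: "warr s3 ''sd'' = (warr s2 ''sd'')(z2 := 1)"
        and k3: "k3 \<le> 200 * h1 + 500"
        using 1(2) hi rv2 n2 unfolding z2_def by auto
      note c3 = exec_insert_leaf_unchanged[OF 1(1)]
      define s4 where "s4 = effect start (effect (WAssign ''b'' (WVar ''z'')) s3)"
      have s4: "wvar s4 = (wvar s3)(''b'' := z2, ''k'' := 0, ''M'' := 0, ''m'' := 1)" "warr s4 = warr s3"
        "rarr s4 = rarr s3" "rvar s4 = rvar s3"
        by (simp_all add: s4_def start_def z2_def)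
      have fr2: "e < wvar s2 ''fr''" if "e \<in> set (Us @ z1 # Bs @ Cs)" for e
        using index_leaves(2)[OF ix2', of e] that by auto
      have ev4: "event_of s4 e = event_of s2 e" if "e \<in> set (Us @ z1 # Bs @ Cs)" for e
        using fr2[OF that] z2 iv3 sd3 s4 by simp
      have ev4z: "event_of s4 z2 = (n, 1)" using iv3 sd3 s4 by simp
      have mp4: "map (event_of s4) Us = us" "map (event_of s4) Bs = B" "map (event_of s4) Cs = vs'" "event_of s4 z1 = (n, 0)"
      proof -
        have m: "map (event_of s4) xs = map (event_of s2) xs" if "set xs \<subseteq> set (Us @ z1 # Bs @ Cs)" for xs
          by (rule map_cong[OF refl], rule ev4) (use that in blast)
        have sub': "set Us \<subseteq> set (Us @ z1 # Bs @ Cs)" "set Bs \<subseteq> set (Us @ z1 # Bs @ Cs)"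
          "set Cs \<subseteq> set (Us @ z1 # Bs @ Cs)" by auto
        show "map (event_of s4) Us = us" "map (event_of s4) Bs = B" "map (event_of s4) Cs = vs'"
          by (rule trans[OF m[OF sub'(1)] mp2(1)] trans[OF m[OF sub'(2)] mp2(2)] trans[OF m[OF sub'(3)] mp2(3)])+
        show "event_of s4 z1 = (n, 0)" using ev4[of z1] ev2z by simp
      qed
      have map4: "map (event_of s4) (Us @ z1 # Bs @ z2 # Cs) = us @ (n, 0) # B @ (n, 1) # vs'"
        using mp4 ev4z by (simp only: map_append list.map)
      have ky4: "rarr s4 ''ky'' e = event_key (Is @ [I]) (event_of s4 e)" if "e \<in> set (Us @ z1 # Bs @ z2 # Cs)" for e
      proof (cases "e = z2")
        case True
        then show ?thesis using kz2 s4 ev4z by (simp add: event_key_def n_def)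
      next
        case False
        then have e: "e \<in> set (Us @ z1 # Bs @ Cs)" using that by auto
        then show ?thesis using ky3 fr2[OF e] s4 ky2[of e] ev4[OF e] Vs' by auto
      qed
      interpret arrival Is I us B vs'
        by unfold_locales (use valid sch' in \<open>simp_all add: n_def\<close>)
      have ix4: "index s4 h2 (Us @ z1 # Bs @ z2 # Cs)" by (rule index_cong[OF _ _ _ _ ix3]) (use s4 in auto)
      note ch = index_chains[OF ix4]
      have w4: "wvar s4 ''a'' = z1" "wvar s4 ''b'' = z2" using s4 c3(1)[of "''a''"] s2 by simp_all
      have st4: "store Is s4"
      proof (rule store_cong[OF _ _ _ _ st])
        show "wvar s4 ''n'' = wvar s ''n''" "wvar s4 ''W'' = wvar s ''W''"
          using s4 s2 c3(1) c1(1) by simp_all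
        show "rarr s4 ''R'' = rarr s ''R''" using s4 s2 c3(4)[of "''R''"] c1(4)[of "''R''"] by simp
        show "warr s4 a = warr s a" if "a \<in> {''level'', ''offset'', ''deg''}" for a
          using s4 s2 c3(2)[of a] c1(2)[of a] that by auto
      qed
      have cnt4: "\<forall>l. warr s4 ''cnt'' l = 0"
        using s4 s2 c3(2)[of "''cnt''"] c1(2)[of "''cnt''"] cnt by simp
      have rv4: "rvar s4 = rvar s" using s4 c3(3) rv2 by simp
      have fl: "free_levels lev {} 0 = {0}" by (auto simp: free_levels_def)
      have init: "counts s4 lev {}" "listed s4 []" "wvar s4 ''M'' = 0" "0 < wvar s4 ''m''"
        using cnt4 s4 fl by (simp_all add: counts_def listed_def)
      have stD: "\<forall>i < length Is. rarr s4 ''R'' i = snd (Is ! i)" "\<forall>i < length Is. warr s4 ''level'' i = lev i"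
        "\<forall>j < length Is. 2 * degree Is j + 2 \<le> wvar s4 ''W''"
        using st4 by (simp_all add: store_def)
      define D where "D = max_degree (Is @ [I])"
      have card_nb: "card (neighbors Is I) \<le> D"
        using degree_le_max_degree[of "length Is" "Is @ [I]"] by (simp add: degree_new D_def)
      have W4: "wvar s4 ''W'' \<le> 2 * D + 2"
      proof (cases "Is = []")
        case False
        have "max_degree (take (length Is) (Is @ [I])) \<le> max_degree (Is @ [I])"
          by (rule max_degree_take_le) (use False in auto)
        then show ?thesis using st4 False by (simp add: store_def D_def)
      qed (use st4 in \<open>simp add: store_def\<close>)
      have LD: "L \<le> D" using new_level_le_card card_nb by simp
      have run_walk: "runs walk s4 (\<lambda>n s'. \<exists>N. listed s' N \<and> distinct N \<and> set N = active us \<and> counts s' lev (active us) \<and>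
        0 < wvar s' ''m'' \<and> wvar s' ''M'' \<le> L \<and> n + 20 * (L - wvar s' ''M'') \<le> 20 * L + 100 * wvar s4 ''W'' + 20)"
        by (rule runs_walk[OF mp4(1) _ ch(4) stD(1,2) _ stD(3) init]) (use ch(1) w4 rv4 lo in auto)
      show ?case unfolding s4_def[symmetric]
      proof (rule runs_mono[OF run_walk], rule runs_Seq, goal_cases)
        case (1 k6 s5)
        obtain N0 where N0: "listed s5 N0" "distinct N0" "set N0 = active us" "counts s5 lev (active us)"
          "0 < wvar s5 ''m''" "wvar s5 ''M'' \<le> L"
          and k6: "k6 + 20 * (L - wvar s5 ''M'') \<le> 20 * L + 100 * wvar s4 ''W'' + 20"
          using 1(2) by blast
        note c5 = exec_walk_unchanged[OF 1(1)]
        have a5: "warr s5 a = warr s4 a" if "a \<notin> {''nb'', ''cnt''}" for a using c5(2) that by blast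
        have w5: "wvar s5 ''a'' = z1" "wvar s5 ''b'' = z2" using c5(1) w4 by simp_all
        have run_sweep: "runs sweep s5 (\<lambda>n s'. \<exists>N. listed s' N \<and> distinct N \<and> set N = neighbors Is I \<and>
          counts s' lev (active (us @ B)) \<and> wvar s' ''M'' = L \<and> n \<le> 20 * (L - wvar s5 ''M'') + 100 * length B + 20)"
          by (rule runs_sweep[where ?N0.0 = N0 and Bs = Bs]) (use mp4(2) ch w5 a5 stD N0 in auto)
        show ?case
        proof (rule runs_mono[OF run_sweep], goal_cases)
          case (1 k7 s6)
          obtain N where N: "listed s6 N" "distinct N" "set N = neighbors Is I" "counts s6 lev (active (us @ B))"
            "wvar s6 ''M'' = L" and k7: "k7 \<le> 20 * (L - wvar s5 ''M'') + 100 * length B + 20"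
            using 1(2) by blast
          note c6 = exec_sweep_unchanged[OF 1(1)]
          have a6: "warr s6 a = warr s4 a" if "a \<notin> {''nb'', ''cnt''}" for a using c6(2) a5 that by simp
          have st6: "store Is s6"
          proof (rule store_cong[OF _ _ _ _ st4])
            show "wvar s6 ''n'' = wvar s4 ''n''" "wvar s6 ''W'' = wvar s4 ''W''" using c6(1) c5(1) by simp_all
            show "rarr s6 ''R'' = rarr s4 ''R''" using c6(4) c5(4) by simp
            show "warr s6 a = warr s4 a" if "a \<in> {''level'', ''offset'', ''deg''}" for a
              by (rule a6) (use that in auto)
          qed
          have hi6: "rvar s6 ''hi'' = snd I" using c6(3) c5(3) rv4 hi by simp
          show ?case
          proof (rule runs_mono[OF runs_finish[OF st6 N hi6]], goal_cases)
            case (1 k8 s7)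
            note c7 = exec_finish_unchanged[OF 1(1)]
            have ix7: "index s7 h2 (Us @ z1 # Bs @ z2 # Cs)"
            proof (rule index_cong[OF _ _ _ _ ix4])
              show "wvar s7 ''fr'' = wvar s4 ''fr''" "wvar s7 ''top'' = wvar s4 ''top''"
                using c7(1) c6(1) c5(1) by simp_all
              show "rarr s7 ''ky'' = rarr s4 ''ky''" using c7(3)[of "''ky''"] c6(4) c5(4) by simp
              show "warr s7 a = warr s4 a" if "a \<in> {''nx'', ''dn'', ''ct'', ''bn'', ''bp''}" for a
                using c7(2)[of a] a6[of a] that by auto
            qed
            have ev7: "event_of s7 = event_of s4"
              using c7(2)[of "''iv''"] c7(2)[of "''sd''"] a6[of "''iv''"] a6[of "''sd''"] by simp
            have ky7: "rarr s7 ''ky'' = rarr s4 ''ky''" using c7(3)[of "''ky''"] c6(4) c5(4) by simp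
            have "invariant (Is @ [I]) s7"
              unfolding invariant_def
              using ix7 ev7 map4 sch' ky4 ky7 1(2) by (metis (no_types, lifting))
            \<comment> \<open>The potential \<open>20 (L - M)\<close> left over by the walk is the
              one the sweep starts with, so it cancels. Up to constants, walk, sweep and cleanup
              take at most 200 D, 200 D and 100 D, and raising \<open>M\<close> takes 20 L.\<close>
            moreover have "k1 + (k2 + (k3 + (k4 + (k5 + (k6 + (k7 + k8)))))) \<le> 200 * h + 200 * h1 + 600 * D + 2000"
            proof -
              have "length N = card (neighbors Is I)" using N(2,3) by (metis distinct_card)
              then have "k8 \<le> 100 * D + 100" using 1(2) card_nb by simp
              moreover have "length B \<le> 2 * D" using length_B card_nb by simp
              moreover have "k4 \<le> 2" "k5 \<le> 6" using \<open>k4 \<le> _\<close> \<open>k5 \<le> _\<close> by (simp_all add: start_def)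
              ultimately show ?thesis using k1 k2 k3 k6 k7 W4 LD by simp
            qed
            ultimately show ?case using hb hb1 unfolding n_def D_def by auto
          qed
        qed
      qed
    qed
  qed
qed

section \<open>Initialization and whole runs\<close>

definition initialize :: com where
  "initialize = If (WEq (WVar ''top'') (WConst 0))
    (Seq (WAssign ''top'' (WConst 2)) (Seq (WAssign ''fr'' (WConst 3))
    (Seq (WStore ''dn'' (WConst 2) (WConst 1)) (WStore ''ct'' (WConst 2) (WConst 1))))) Skip"

definition kt_program :: com where
  "kt_program = Seq initialize arrive"

lemma with_input_simps [simp]:
  "wvar (with_input I s) = wvar s" "warr (with_input I s) = warr s" "rarr (with_input I s) = rarr s"
  "rvar (with_input I s) ''lo'' = fst I" "rvar (with_input I s) ''hi'' = snd I"
  by (simp_all add: with_input_def)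

lemma invariant_initialize: "invariant [] (effect initialize (with_input I initial_state))"
proof -
  define s where "s = effect initialize (with_input I initial_state)"
  have s: "wvar s = (\<lambda>_. 0)(''top'' := 2, ''fr'' := 3)" "rarr s = (\<lambda>_ _. 0)"
    "warr s = (\<lambda>_ _. 0)(''dn'' := (\<lambda>_. 0)(2 := 1), ''ct'' := (\<lambda>_. 0)(2 := 1))"
    by (simp_all add: s_def initialize_def initial_state_def)
  have "family s 0 2 [Node 1 []]" using s by (simp add: family_def)
  then have "index s 0 []" using s unfolding index_def by (auto intro!: exI[of _ "[Node 1 []]"])
  moreover have "schedule [] []" by (simp add: schedule_def)
  moreover have "store [] s" using s by (simp add: store_def)
  moreover have "warr s ''cnt'' l = 0" for l using s by simp
  ultimately show ?thesis unfolding s_def[symmetric] invariant_def by fastforce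
qed

lemma invariant_top: "invariant Is s \<Longrightarrow> 0 < wvar s ''top''"
  unfolding invariant_def index_def family_def by auto

lemma invariant_with_input:
  assumes "invariant Is s" shows "invariant Is (with_input I s)"
proof -
  have "index s h es \<Longrightarrow> index (with_input I s) h es" for h es by (rule index_cong[of _ s]) simp_all
  moreover have "store Is s \<Longrightarrow> store Is (with_input I s)" by (rule store_cong[of _ s]) simp_all
  ultimately show ?thesis using assms unfolding invariant_def by auto
qed

definition reached :: "interval list \<Rightarrow> state \<Rightarrow> bool" where
  "reached Is s \<longleftrightarrow> (if Is = [] then s = initial_state else invariant Is s)"

text \<open>Heights stand in for logarithms and keep the bound in the naturals until
  \<open>time_bound_real\<close>.\<close>

definition time_bound :: "interval list \<Rightarrow> nat \<Rightarrow> bool" where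
  "time_bound Is k \<longleftrightarrow> (\<exists>h h'. 2 ^ h \<le> 2 * length Is \<and> 2 ^ h' \<le> 2 * length Is \<and>
    k \<le> 200 * h + 200 * h' + 600 * max_degree Is + 2100)"

lemma kt_program_step:
  assumes valid: "\<forall>J \<in> set (Is @ [I]). is_interval_pair J" and "reached Is s"
  obtains k s' where "exec kt_program (with_input I s) k s'" "reached (Is @ [I]) s'" "time_bound (Is @ [I]) k"
proof -
  define s1 where "s1 = effect initialize (with_input I s)"
  have inv: "invariant Is s1"
  proof (cases "Is = []")
    case True
    then show ?thesis using assms(2) invariant_initialize by (simp add: reached_def s1_def)
  next
    case False
    then have inv: "invariant Is (with_input I s)"
      using assms(2) invariant_with_input by (simp add: reached_def)
    then have "s1 = with_input I s" using invariant_top[OF inv] by (simp add: s1_def initialize_def)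
    then show ?thesis using inv by simp
  qed
  have rv: "rvar s1 ''lo'' = fst I" "rvar s1 ''hi'' = snd I" by (simp_all add: s1_def initialize_def)
  have "runs kt_program (with_input I s) (\<lambda>k s'. invariant (Is @ [I]) s' \<and> time_bound (Is @ [I]) k)"
    unfolding kt_program_def
  proof (rule runs_Seq, rule runs_loop_free, simp add: initialize_def, fold s1_def,
      rule runs_mono[OF runs_arrive[OF valid inv rv]], goal_cases)
    case (1 k1 k2 s')
    have "k1 \<le> 40" using 1(1) by (simp add: initialize_def)
    then show ?case using 1(3) unfolding time_bound_def by fastforce
  qed
  then show ?thesis using that unfolding runs_def reached_def by auto
qed

lemma kt_program_runs:
  assumes "\<forall>J \<in> set Is. is_interval_pair J"
  shows "\<exists>s T. run_insertions kt_program Is s T \<and> (\<forall>i \<le> length Is. reached (take i Is) (s i)) \<and>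
    (\<forall>i < length Is. time_bound (take (Suc i) Is) (T i))"
  using assms
proof (induction Is rule: rev_induct)
  case Nil
  show ?case by (intro exI[of _ "\<lambda>_. initial_state"]) (simp add: run_insertions_def reached_def)
next
  case (snoc I Is)
  define n where "n = length Is"
  obtain s T where run: "run_insertions kt_program Is s T"
    and reach: "\<forall>i \<le> n. reached (take i Is) (s i)" and time: "\<forall>i < n. time_bound (take (Suc i) Is) (T i)"
    using snoc by (auto simp: n_def)
  have "reached Is (s n)" using reach by (auto simp: n_def)
  then obtain k s' where step: "exec kt_program (with_input I (s n)) k s'" "reached (Is @ [I]) s'"
    "time_bound (Is @ [I]) k"
    using kt_program_step snoc.prems by blast
  define s2 T2 where "s2 = s(Suc n := s')" and "T2 = T(n := k)"
  have "run_insertions kt_program (Is @ [I]) s2 T2"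
    unfolding run_insertions_def
  proof (intro conjI allI impI)
    show "s2 0 = initial_state" using run by (simp add: run_insertions_def s2_def)
    fix i assume "i < length (Is @ [I])"
    then consider "i < n" | "i = n" by (fastforce simp: n_def)
    then show "exec kt_program (with_input ((Is @ [I]) ! i) (s2 i)) (T2 i) (s2 (Suc i))"
    proof cases
      case 1
      then show ?thesis using run by (simp add: run_insertions_def s2_def T2_def nth_append n_def)
    next
      case 2
      then show ?thesis using step(1) by (simp add: s2_def T2_def n_def)
    qed
  qed
  moreover have "reached (take i (Is @ [I])) (s2 i)" if "i \<le> length (Is @ [I])" for i
  proof (cases "i = Suc n")
    case False
    then have "i \<le> n" using that by (simp add: n_def)
    then show ?thesis using reach by (simp add: s2_def n_def)
  qed (use step(2) in \<open>simp add: s2_def n_def\<close>)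
  moreover have "time_bound (take (Suc i) (Is @ [I])) (T2 i)" if "i < length (Is @ [I])" for i
  proof (cases "i = n")
    case False
    then have "i < n" using that by (simp add: n_def)
    then show ?thesis using time by (simp add: T2_def n_def)
  qed (use step(3) in \<open>simp add: T2_def n_def\<close>)
  ultimately show ?case by blast
qed

lemma invariant_colors:
  assumes valid: "\<forall>J \<in> set Is. is_interval_pair J" and inv: "invariant Is s" and "Is \<noteq> []"
  shows "\<forall>j < length Is. current_color s j = kt_sls Is ! j"
    and "proper_coloring Is (current_color s)"
    and "card (current_color s ` {..<length Is}) \<le> 3 * clique_number Is - 2"
proof -
  show col: "\<forall>j < length Is. current_color s j = kt_sls Is ! j"
    using inv by (simp add: invariant_def store_def current_color_def)
  then show "proper_coloring Is (current_color s)"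
    unfolding proper_coloring_def edge_iff using kt_sls_proper[OF valid] by simp
  have "current_color s ` {..<length Is} = (!) (kt_sls Is) ` {..<length Is}"
    by (rule image_cong) (use col in auto)
  then show "card (current_color s ` {..<length Is}) \<le> 3 * clique_number Is - 2"
    using card_colors[OF valid assms(3)] by simp
qed

lemma time_bound_real:
  assumes "time_bound (take i Is) k" "0 < i" "i \<le> length Is"
  shows "real k \<le> 3000 * (1 + log 2 (real (length Is)) + real (max_degree Is))"
proof -
  obtain h h' where hh: "2 ^ h \<le> 2 * i" "2 ^ h' \<le> 2 * i"
    and k: "k \<le> 200 * h + 200 * h' + 600 * max_degree (take i Is) + 2100"
    using assms unfolding time_bound_def by auto
  have n: "0 < length Is" using assms(2,3) by linarith
  have log: "log 2 (real (2 * length Is)) = 1 + log 2 (real (length Is))"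
    using n by (simp add: log_mult)
  have "2 ^ h \<le> 2 * length Is" "2 ^ h' \<le> 2 * length Is" using hh assms(3) by linarith+
  from this[THEN le_log2_of_power]
  have "real h \<le> 1 + log 2 (real (length Is))" "real h' \<le> 1 + log 2 (real (length Is))"
    unfolding log .
  moreover have "max_degree (take i Is) \<le> max_degree Is" by (rule max_degree_take_le[OF assms(2,3)])
  moreover have "0 \<le> log 2 (real (length Is))" using n by (simp add: Suc_le_eq)
  \<comment> \<open>The two searches contribute 400 times one plus the logarithm; with the additive
    2100 the constant part is 2500, below 3000.\<close>
  ultimately show ?thesis using k by (simp add: algebra_simps)
qed

text \<open>The summand 1 accounts for a single interval, where both the logarithm and the maximum
  degree vanish while the insertion still takes time.\<close>

theorem theorem2:
  shows "\<exists>(P :: com) (C :: real). \<forall>Is :: interval list.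
    (\<forall>I \<in> set Is. is_interval_pair I) \<longrightarrow>
    (\<exists>s T. run_insertions P Is s T \<and>
      (\<forall>i \<in> {1..length Is}.
         (\<forall>j < i. current_color (s i) j = kt_sls (take i Is) ! j) \<and>
         proper_coloring (take i Is) (current_color (s i)) \<and>
         card (current_color (s i) ` {..<i}) \<le> 3 * clique_number (take i Is) - 2) \<and>
      real (\<Sum>i < length Is. T i)
        \<le> C * real (length Is) * (1 + log 2 (real (length Is)) + real (max_degree Is)))"
proof (intro exI[of _ kt_program] exI[of _ 3000] allI impI)
  fix Is :: "interval list"
  assume valid: "\<forall>I \<in> set Is. is_interval_pair I"
  obtain s T where run: "run_insertions kt_program Is s T"
    and reach: "\<forall>i \<le> length Is. reached (take i Is) (s i)"
    and time: "\<forall>i < length Is. time_bound (take (Suc i) Is) (T i)"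
    using kt_program_runs[OF valid] by blast
  have "(\<forall>j < i. current_color (s i) j = kt_sls (take i Is) ! j) \<and>
      proper_coloring (take i Is) (current_color (s i)) \<and>
      card (current_color (s i) ` {..<i}) \<le> 3 * clique_number (take i Is) - 2"
    if "i \<in> {1..length Is}" for i
  proof -
    have len: "length (take i Is) = i" "take i Is \<noteq> []" using that by auto
    have "invariant (take i Is) (s i)" using reach that len(2) by (auto simp: reached_def)
    moreover have "\<forall>J \<in> set (take i Is). is_interval_pair J" using valid by (meson in_set_takeD)
    ultimately show ?thesis using invariant_colors[of "take i Is" "s i"] len by simp
  qed
  moreover have "real (\<Sum>i < length Is. T i)
      \<le> 3000 * real (length Is) * (1 + log 2 (real (length Is)) + real (max_degree Is))"
  proof -
    define b where "b = 3000 * (1 + log 2 (real (length Is)) + real (max_degree Is))"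
    \<comment> \<open>Every insertion obeys the same worst-case bound \<open>b\<close>, so the
      amortized bound is obtained by multiplying with the number of insertions.\<close>
    have "(\<Sum>i < length Is. real (T i)) \<le> (\<Sum>i < length Is. b)"
      by (rule sum_mono) (use time time_bound_real in \<open>auto simp: b_def Suc_le_eq\<close>)
    then show ?thesis by (simp add: b_def mult_ac)
  qed
  ultimately show "\<exists>s T. run_insertions kt_program Is s T \<and>
      (\<forall>i \<in> {1..length Is}.
         (\<forall>j < i. current_color (s i) j = kt_sls (take i Is) ! j) \<and>
         proper_coloring (take i Is) (current_color (s i)) \<and>
         card (current_color (s i) ` {..<i}) \<le> 3 * clique_number (take i Is) - 2) \<and>
      real (\<Sum>i < length Is. T i)
        \<le> 3000 * real (length Is) * (1 + log 2 (real (length Is)) + real (max_degree Is))"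
    using run by blast
qed

end
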